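(* Assume that $\tau$ is in the limit circle case at $a$ and $b$, and let $\{v_j(i,\cdot)\}_{j=1,2}$ be the orthonormal basis of $\mathcal N_i$ obtained from $\{u_j(i,\cdot)\}_{j=1,2}$ by the Gram–Schmidt process (given explicitly in the context). Then the following hold. (i) If $\alpha,\beta\in(0,\pi)$, then the Donoghue $m$-function $M_{T_{\alpha,\beta},\mathcal N_i}^{Do}(\cdot):\mathbb C\setminus\mathbb R\to\mathcal B(\mathcal N_i)$ for $T_{\alpha,\beta}$ satisfies $M_{T_{\alpha,\beta},\mathcal N_i}^{Do}(\pm i)=\pm i\,I_{\mathcal N_i}$ and $$M_{T_{\alpha,\beta},\mathcal N_i}^{Do}(z)=M_{T_{0,0},\mathcal N_i}^{Do}(z)+(i-z)\sum_{j,k,\ell=1}^2\big[K_{\alpha,\beta}(z)^{-1}\big]_{j,k}W_{\ell,k}^{Kr}(z)\,(u_j(\overline z,\cdot),\cdot)_{L^2_r((a,b))}v_\ell(i,\cdot)\big|_{\mathcal N_i},$$ for $z\in\mathbb C\setminus\mathbb R$, $z\neq\pm i$, where $$K_{\alpha,\beta}(z)=\begin{pmatrix}\cot(\beta)+\widetilde u_1^{\,\prime}(z,b)&-\widetilde u_1^{\,\prime}(z,a)\\ \widetilde u_2^{\,\prime}(z,b)&-\cot(\alpha)-\widetilde u_2^{\,\prime}(z,a)\end{pmatrix}.$$ (ii) If $\varphi\in[0,2\pi)$ and $R\in SL(2,\mathbb R)$ with $R_{1,2}\neq0$, then the Donoghue $m$-function $M_{T_{\varphi,R},\mathcal N_i}^{Do}(\cdot):\mathbb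 C\setminus\mathbb R\to\mathcal B(\mathcal N_i)$ for $T_{\varphi,R}$ satisfies $M_{T_{\varphi,R},\mathcal N_i}^{Do}(\pm i)=\pm i\,I_{\mathcal N_i}$ and $$M_{T_{\varphi,R},\mathcal N_i}^{Do}(z)=M_{T_{0,0},\mathcal N_i}^{Do}(z)+(i-z)\sum_{j,k,\ell=1}^2\big[K_{\varphi,R}(z)^{-1}\big]_{j,k}W_{\ell,k}^{Kr}(z)\,(u_j(\overline z,\cdot),\cdot)_{L^2_r((a,b))}v_\ell(i,\cdot)\big|_{\mathcal N_i},$$ for $z\in\mathbb C\setminus\mathbb R$, $z\neq\pm i$, where $$K_{\varphi,R}(z)=\begin{pmatrix}-\dfrac{R_{2,2}}{R_{1,2}}+\widetilde u_1^{\,\prime}(z,b)&\dfrac{e^{-i\varphi}}{R_{1,2}}-\widetilde u_1^{\,\prime}(z,a)\\ \dfrac{e^{i\varphi}}{R_{1,2}}+\widetilde u_2^{\,\prime}(z,b)&-\dfrac{R_{1,1}}{R_{1,2}}-\widetilde u_2^{\,\prime}(z,a)\end{pmatrix}.$$ In both parts, with $\kappa=\operatorname{Im}(\widetilde u_2^{\,\prime}(i,b))/\operatorname{Im}(\widetilde u_1^{\,\prime}(i,b))$, $$W_{1,1}^{Kr}(z)=c_1(i)\big[\widetilde u_1^{\,\prime}(z,b)-\widetilde u_1^{\,\prime}(-i,b)\big],\qquad W_{1,2}^{Kr}(z)=c_1(i)\big[\widetilde u_2^{\,\prime}(z,b)+\widetilde u_1^{\,\prime}(-i,a)\big],$$ $$W_{2,1}^{Kr}(z)=-c_2(i)\Big\{\kappa\big[\widetilde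 u_1^{\,\prime}(z,b)-\widetilde u_1^{\,\prime}(-i,b)\big]+\widetilde u_2^{\,\prime}(-i,b)+\widetilde u_1^{\,\prime}(z,a)\Big\},$$ $$W_{2,2}^{Kr}(z)=-c_2(i)\Big\{\kappa\big[\widetilde u_2^{\,\prime}(z,b)+\widetilde u_1^{\,\prime}(-i,a)\big]+\widetilde u_2^{\,\prime}(z,a)-\widetilde u_2^{\,\prime}(-i,a)\Big\}.$$
   Context: Let $(a,b)\subseteq\mathbb R$ (possibly unbounded) and let $p,q,r$ be Lebesgue measurable functions on $(a,b)$ with $r>0$ a.e., $r\in L^1_{loc}((a,b))$; $p>0$ a.e., $1/p\in L^1_{loc}((a,b))$; $q$ real-valued a.e., $q\in L^1_{loc}((a,b))$. Put $\tau f=\frac1r\big[-(pf')'+qf\big]$, $f^{[1]}=pf'$, and $W(f,g)(x)=f(x)g^{[1]}(x)-f^{[1]}(x)g(x)$. Let $L^2_r((a,b))=L^2((a,b);r\,dx)$ with inner product $(\cdot,\cdot)_{L^2_r((a,b))}$ linear in the second argument. The maximal operator is $T_{max}f=\tau f$ with $\mathrm{dom}(T_{max})=\{g\in L^2_r((a,b)) : g,g^{[1]}\in AC_{loc}((a,b)),\ \tau g\in L^2_r((a,b))\}$. The minimal operator $T_{min}$ is the closure of the restriction of $T_{max}$ to those $g\in\mathrm{dom}(T_{max})$ with compact support in $(a,b)$. For $f,g\in\mathrm{dom}(T_{max})$ the limits $W(f,g)(a)=\lim_{x\downarrow a}W(f,g)(x)$ and $W(f,g)(b)=\lim_{x\uparrow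 b}W(f,g)(x)$ exist. $\tau$ is in the limit circle case at an endpoint if for every $z\in\mathbb C$ all solutions of $\tau u=zu$ are in $L^2_r$ near that endpoint. Put $\mathcal N_z=\ker(T_{max}-zI)$; in the present situation $\dim\mathcal N_{\pm i}=2$. Generalized boundary values: fix real-valued $v_1,v_2\in\mathrm{dom}(T_{max})$ with $W(v_1,v_2)(a)=W(v_1,v_2)(b)=1$ and, for $g\in\mathrm{dom}(T_{max})$ and $d\in\{a,b\}$, set $\widetilde g(d)=-W(v_2,g)(d)$ and $\widetilde g^{\,\prime}(d)=W(v_1,g)(d)$. (If $T_{min}$ is bounded from below one takes $v_1,v_2$ equal near each endpoint $d$ to a nonprincipal solution $\widehat u_d(\lambda_0,\cdot)$ and a principal solution $u_d(\lambda_0,\cdot)$ of $\tau u=\lambda_0u$ with $W(\widehat u_d,u_d)=1$, $\lambda_0\in\mathbb R$. These functions $v_1,v_2$ are unrelated to the basis functions $v_j(i,\cdot)$ below.) Self-adjoint extensions of $T_{min}$ (all are restrictions of $T_{max}$): for $\alpha,\beta\in[0,\pi)$, $\mathrm{dom}(T_{\alpha,\beta})$ consists of all $g\in\mathrm{dom}(T_{max})$ with $\cos(\alpha)\widetilde g(a)+\sin(\alpha)\widetilde g^{\,\prime}(a)=0$ and $\cos(\beta)\widetilde g(b)+\sin(\beta)\widetilde g^{\,\prime}(b)=0$; for $\varphi\in[0,2\pi)$ and $R=(R_{j,k})_{j,k=1}^2\in SL(2,\mathbb R)$, $\mathrm{dom}(T_{\varphi,R})$ consists of all $g\in\mathrm{dom}(T_{max})$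 with $(\widetilde g(b),\widetilde g^{\,\prime}(b))^\top=e^{i\varphi}R\,(\widetilde g(a),\widetilde g^{\,\prime}(a))^\top$. In particular $\mathrm{dom}(T_{0,0})=\{g\in\mathrm{dom}(T_{max}):\widetilde g(a)=\widetilde g(b)=0\}$. For $z\in\rho(T_{0,0})$, $u_1(z,\cdot),u_2(z,\cdot)$ are the solutions of $\tau u=zu$ with $\widetilde u_1(z,a)=0$, $\widetilde u_1(z,b)=1$, $\widetilde u_2(z,a)=1$, $\widetilde u_2(z,b)=0$; $\widetilde u_j^{\,\prime}(z,d)$ denotes the second generalized boundary value of $u_j(z,\cdot)$ at $d\in\{a,b\}$. The orthonormal basis of $\mathcal N_i$ is $$v_1(i,\cdot)=c_1(i)u_1(i,\cdot),\qquad v_2(i,\cdot)=c_2(i)\Big[u_2(i,\cdot)-\frac{\operatorname{Im}(\widetilde u_2^{\,\prime}(i,b))}{\operatorname{Im}(\widetilde u_1^{\,\prime}(i,b))}u_1(i,\cdot)\Big],$$ $$c_1(i)=\|u_1(i,\cdot)\|_{L^2_r((a,b))}^{-1}=\big[-\operatorname{Im}(\widetilde u_1^{\,\prime}(i,b))\big]^{-1/2},$$ $$c_2(i)=\Big\|u_2(i,\cdot)-\frac{\operatorname{Im}(\widetilde u_2^{\,\prime}(i,b))}{\operatorname{Im}(\widetilde u_1^{\,\prime}(i,b))}u_1(i,\cdot)\Big\|_{L^2_r((a,b))}^{-1}=\Big[\operatorname{Im}(\widetilde u_2^{\,\prime}(i,a))+\frac{[\operatorname{Im}(\widetilde u_2^{\,\prime}(i,b))]^2}{\operatorname{Im}(\widetilde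 u_1^{\,\prime}(i,b))}\Big]^{-1/2}.$$ For a self-adjoint extension $T$ of $T_{min}$, the Donoghue $m$-function is $M_{T,\mathcal N_i}^{Do}(z)=zI_{\mathcal N_i}+(z^2+1)P_{\mathcal N_i}(T-zI)^{-1}P_{\mathcal N_i}\big|_{\mathcal N_i}$, $z\in\mathbb C\setminus\mathbb R$, where $P_{\mathcal N_i}$ is the orthogonal projection onto $\mathcal N_i$ and $I_{\mathcal N_i}$ the identity on $\mathcal N_i$. The symbol $(f,\cdot)_{L^2_r((a,b))}\,h$ denotes the rank-one operator $g\mapsto(f,g)_{L^2_r((a,b))}h$. *)

theory Defs
  imports "HOL-Analysis.Analysis"
begin

section \<open>Sturm--Liouville data and local absolute continuity\<close>

text \<open>
  The coefficients are total functions on the reals of which only the restriction to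
  the (possibly unbounded) interval from \<open>sl_a\<close> to \<open>sl_b\<close> matters.
\<close>

record sl_data =
  sl_a :: ereal
  sl_b :: ereal
  sl_p :: "real \<Rightarrow> real"
  sl_q :: "real \<Rightarrow> real"
  sl_r :: "real \<Rightarrow> real"

definition sl_int :: "sl_data \<Rightarrow> real set" where
  "sl_int S = einterval (sl_a S) (sl_b S)"

definition L1_loc :: "real set \<Rightarrow> (real \<Rightarrow> real) \<Rightarrow> bool" where
  "L1_loc I f \<longleftrightarrow> (\<forall>K. compact K \<and> K \<subseteq> I \<longrightarrow> integrable (lebesgue_on K) f)"

definition sl_admissible :: "sl_data \<Rightarrow> bool" where
  "sl_admissible S \<longleftrightarrow>
     sl_a S < sl_b S \<and>
     sl_p S \<in> borel_measurable (lebesgue_on (sl_int S)) \<and>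
     sl_q S \<in> borel_measurable (lebesgue_on (sl_int S)) \<and>
     sl_r S \<in> borel_measurable (lebesgue_on (sl_int S)) \<and>
     (AE x in lebesgue_on (sl_int S). sl_r S x > 0) \<and> L1_loc (sl_int S) (sl_r S) \<and>
     (AE x in lebesgue_on (sl_int S). sl_p S x > 0) \<and> L1_loc (sl_int S) (\<lambda>x. 1 / sl_p S x) \<and>
     L1_loc (sl_int S) (sl_q S)"

text \<open>
  The usual epsilon-delta definition; a finite family of non-overlapping compact
  subintervals of \<open>A\<close> is a division of some subset of \<open>A\<close>.
\<close>

definition abs_cont_on :: "real set \<Rightarrow> (real \<Rightarrow> complex) \<Rightarrow> bool" where
  "abs_cont_on A f \<longleftrightarrow>
     (\<forall>\<epsilon>>0. \<exists>\<delta>>0. \<forall>D U. D division_of U \<and> U \<subseteq> A \<and> (\<Sum>K\<in>D. Sup K - Inf K) < \<delta> \<longrightarrow>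
        (\<Sum>K\<in>D. cmod (f (Sup K) - f (Inf K))) < \<epsilon>)"

definition AC_loc :: "real set \<Rightarrow> (real \<Rightarrow> complex) \<Rightarrow> bool" where
  "AC_loc I f \<longleftrightarrow> (\<forall>c d. {c..d} \<subseteq> I \<longrightarrow> abs_cont_on {c..d} f)"


section \<open>The Hilbert space\<close>

text \<open>
  Elements of the weighted \<open>L\<^sup>2\<close>-space are represented by functions, and identified when
  they agree almost everywhere on the interval (relation \<open>ae_eq\<close>); values outside the
  interval are irrelevant.
\<close>

definition sl_measure :: "sl_data \<Rightarrow> real measure" where
  "sl_measure S = density (lebesgue_on (sl_int S)) (\<lambda>x. ennreal (sl_r S x))"

definition ae_eq :: "sl_data \<Rightarrow> (real \<Rightarrow> complex) \<Rightarrow> (real \<Rightarrow> complex) \<Rightarrow> bool" where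
  "ae_eq S f g \<longleftrightarrow> (AE x in lebesgue_on (sl_int S). f x = g x)"

definition L2r :: "sl_data \<Rightarrow> (real \<Rightarrow> complex) set" where
  "L2r S = {f. f \<in> borel_measurable (lebesgue_on (sl_int S)) \<and>
               integrable (sl_measure S) (\<lambda>x. (cmod (f x))\<^sup>2)}"

definition L2r_inner :: "sl_data \<Rightarrow> (real \<Rightarrow> complex) \<Rightarrow> (real \<Rightarrow> complex) \<Rightarrow> complex" where
  "L2r_inner S f g = (LINT x|sl_measure S. cnj (f x) * g x)"

definition L2r_norm :: "sl_data \<Rightarrow> (real \<Rightarrow> complex) \<Rightarrow> real" where
  "L2r_norm S f = sqrt (LINT x|sl_measure S. (cmod (f x))\<^sup>2)"

text \<open>
  The orthogonal projection onto a closed subspace \<open>N\<close>, each element of which is given by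
  at least one representative in the set \<open>N\<close>; it is determined up to \<open>ae_eq\<close>.
\<close>

definition orth_proj ::
    "sl_data \<Rightarrow> (real \<Rightarrow> complex) set \<Rightarrow> (real \<Rightarrow> complex) \<Rightarrow> real \<Rightarrow> complex" where
  "orth_proj S N f = (SOME g. g \<in> N \<and> (\<forall>h\<in>N. L2r_inner S h (\<lambda>x. f x - g x) = 0))"

definition bounded_operator_on ::
    "sl_data \<Rightarrow> (real \<Rightarrow> complex) set \<Rightarrow> ((real \<Rightarrow> complex) \<Rightarrow> real \<Rightarrow> complex) \<Rightarrow> bool" where
  "bounded_operator_on S N A \<longleftrightarrow>
     (\<forall>f\<in>N. A f \<in> N) \<and>
     (\<forall>f\<in>N. \<forall>g\<in>N. ae_eq S f g \<longrightarrow> ae_eq S (A f) (A g)) \<and>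
     (\<forall>f\<in>N. \<forall>g\<in>N. \<forall>c d. ae_eq S (A (\<lambda>x. c * f x + d * g x)) (\<lambda>x. c * A f x + d * A g x)) \<and>
     (\<exists>C. \<forall>f\<in>N. L2r_norm S (A f) \<le> C * L2r_norm S f)"


section \<open>The differential expression and the maximal operator\<close>

text \<open>
  The product of \<open>p\<close> and the derivative of \<open>f\<close> is defined only almost everywhere;
  the quasi-derivative is its locally absolutely continuous representative, which is unique
  on the interval if it exists.
\<close>

definition is_qderiv :: "sl_data \<Rightarrow> (real \<Rightarrow> complex) \<Rightarrow> (real \<Rightarrow> complex) \<Rightarrow> bool" where
  "is_qderiv S f h \<longleftrightarrow> AC_loc (sl_int S) h \<and>
     ae_eq S h (\<lambda>x. of_real (sl_p S x) * vector_derivative f (at x))"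

definition qderiv :: "sl_data \<Rightarrow> (real \<Rightarrow> complex) \<Rightarrow> real \<Rightarrow> complex" where
  "qderiv S f = (SOME h. is_qderiv S f h)"

definition sl_regular :: "sl_data \<Rightarrow> (real \<Rightarrow> complex) \<Rightarrow> bool" where
  "sl_regular S f \<longleftrightarrow> AC_loc (sl_int S) f \<and> (\<exists>h. is_qderiv S f h)"

definition sl_tau :: "sl_data \<Rightarrow> (real \<Rightarrow> complex) \<Rightarrow> real \<Rightarrow> complex" where
  "sl_tau S f x = 1 / of_real (sl_r S x) *
     (- vector_derivative (qderiv S f) (at x) + of_real (sl_q S x) * f x)"

definition wronsk ::
    "sl_data \<Rightarrow> (real \<Rightarrow> complex) \<Rightarrow> (real \<Rightarrow> complex) \<Rightarrow> real \<Rightarrow> complex" where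
  "wronsk S f g x = f x * qderiv S g x - qderiv S f x * g x"

definition dom_max :: "sl_data \<Rightarrow> (real \<Rightarrow> complex) set" where
  "dom_max S = {g \<in> L2r S. sl_regular S g \<and> sl_tau S g \<in> L2r S}"

definition sl_solution :: "sl_data \<Rightarrow> complex \<Rightarrow> (real \<Rightarrow> complex) \<Rightarrow> bool" where
  "sl_solution S z u \<longleftrightarrow> sl_regular S u \<and> ae_eq S (sl_tau S u) (\<lambda>x. z * u x)"

text \<open>The deficiency subspaces, i.e. the kernels of the maximal operator shifted by \<open>z\<close>.\<close>

definition sl_N :: "sl_data \<Rightarrow> complex \<Rightarrow> (real \<Rightarrow> complex) set" where
  "sl_N S z = {u \<in> dom_max S. ae_eq S (sl_tau S u) (\<lambda>x. z * u x)}"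

definition limit_circle_a :: "sl_data \<Rightarrow> bool" where
  "limit_circle_a S \<longleftrightarrow> (\<forall>z u. sl_solution S z u \<longrightarrow>
     (\<exists>c\<in>sl_int S. set_integrable (sl_measure S) {..<c} (\<lambda>x. (cmod (u x))\<^sup>2)))"

definition limit_circle_b :: "sl_data \<Rightarrow> bool" where
  "limit_circle_b S \<longleftrightarrow> (\<forall>z u. sl_solution S z u \<longrightarrow>
     (\<exists>c\<in>sl_int S. set_integrable (sl_measure S) {c<..} (\<lambda>x. (cmod (u x))\<^sup>2)))"


section \<open>Generalized boundary values\<close>

text \<open>
  An endpoint is represented by the filter of one-sided approach to it from inside the
  interval; this covers infinite endpoints as well.
\<close>

definition end_a :: "sl_data \<Rightarrow> real filter" where
  "end_a S = filtermap real_of_ereal (at_right (sl_a S))"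

definition end_b :: "sl_data \<Rightarrow> real filter" where
  "end_b S = filtermap real_of_ereal (at_left (sl_b S))"

definition wronsk_at ::
    "sl_data \<Rightarrow> (real \<Rightarrow> complex) \<Rightarrow> (real \<Rightarrow> complex) \<Rightarrow> real filter \<Rightarrow> complex" where
  "wronsk_at S f g F = Lim F (wronsk S f g)"

text \<open>
  A boundary frame is a pair of real-valued functions, with respect to which the generalized
  boundary values \<open>gbv\<close> and \<open>gbv'\<close> of \<open>g\<close> at an endpoint are formed.
\<close>

definition boundary_frame ::
    "sl_data \<Rightarrow> (real \<Rightarrow> complex) \<times> (real \<Rightarrow> complex) \<Rightarrow> bool" where
  "boundary_frame S v \<longleftrightarrow>
     fst v \<in> dom_max S \<and> snd v \<in> dom_max S \<and>
     (\<forall>x\<in>sl_int S. fst v x \<in> \<real> \<and> snd v x \<in> \<real>) \<and>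
     wronsk_at S (fst v) (snd v) (end_a S) = 1 \<and> wronsk_at S (fst v) (snd v) (end_b S) = 1"

definition gbv :: "sl_data \<Rightarrow> (real \<Rightarrow> complex) \<times> (real \<Rightarrow> complex) \<Rightarrow>
    (real \<Rightarrow> complex) \<Rightarrow> real filter \<Rightarrow> complex" where
  "gbv S v g F = - wronsk_at S (snd v) g F"

definition gbv' :: "sl_data \<Rightarrow> (real \<Rightarrow> complex) \<times> (real \<Rightarrow> complex) \<Rightarrow>
    (real \<Rightarrow> complex) \<Rightarrow> real filter \<Rightarrow> complex" where
  "gbv' S v g F = wronsk_at S (fst v) g F"


section \<open>Self-adjoint extensions and Donoghue m-functions\<close>

text \<open>
  All operators considered are restrictions of the maximal operator, so each is given by its
  domain \<open>D\<close> and acts as \<open>sl_tau\<close>.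
\<close>

definition dom_sep :: "sl_data \<Rightarrow> (real \<Rightarrow> complex) \<times> (real \<Rightarrow> complex) \<Rightarrow>
    real \<Rightarrow> real \<Rightarrow> (real \<Rightarrow> complex) set" where
  "dom_sep S v \<alpha> \<beta> = {g \<in> dom_max S.
     of_real (cos \<alpha>) * gbv S v g (end_a S) + of_real (sin \<alpha>) * gbv' S v g (end_a S) = 0 \<and>
     of_real (cos \<beta>) * gbv S v g (end_b S) + of_real (sin \<beta>) * gbv' S v g (end_b S) = 0}"

definition dom_coupled :: "sl_data \<Rightarrow> (real \<Rightarrow> complex) \<times> (real \<Rightarrow> complex) \<Rightarrow>
    real \<Rightarrow> real^2^2 \<Rightarrow> (real \<Rightarrow> complex) set" where
  "dom_coupled S v \<phi> R = {g \<in> dom_max S.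
     (vector [gbv S v g (end_b S), gbv' S v g (end_b S)] :: complex^2) =
       exp (\<i> * of_real \<phi>) *s (map_matrix of_real R *v
         vector [gbv S v g (end_a S), gbv' S v g (end_a S)])}"

definition sl_resolvent ::
    "sl_data \<Rightarrow> (real \<Rightarrow> complex) set \<Rightarrow> complex \<Rightarrow> (real \<Rightarrow> complex) \<Rightarrow> real \<Rightarrow> complex" where
  "sl_resolvent S D z f = (SOME g. g \<in> D \<and> ae_eq S (\<lambda>x. sl_tau S g x - z * g x) f)"

definition donoghue ::
    "sl_data \<Rightarrow> (real \<Rightarrow> complex) set \<Rightarrow> complex \<Rightarrow> (real \<Rightarrow> complex) \<Rightarrow> real \<Rightarrow> complex" where
  "donoghue S D z g = (\<lambda>x. z * g x + (z\<^sup>2 + 1) *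
     orth_proj S (sl_N S \<i>) (sl_resolvent S D z (orth_proj S (sl_N S \<i>) g)) x)"


section \<open>The basis and the coefficient matrices\<close>

text \<open>The solutions \<open>u\<^sub>1(z,\<cdot>)\<close> and \<open>u\<^sub>2(z,\<cdot>)\<close>, indexed by the two-element type.\<close>

definition sl_u :: "sl_data \<Rightarrow> (real \<Rightarrow> complex) \<times> (real \<Rightarrow> complex) \<Rightarrow>
    2 \<Rightarrow> complex \<Rightarrow> real \<Rightarrow> complex" where
  "sl_u S v j z = (SOME u. sl_solution S z u \<and>
     gbv S v u (end_a S) = (if j = 1 then 0 else 1) \<and>
     gbv S v u (end_b S) = (if j = 1 then 1 else 0))"

definition u'_a :: "sl_data \<Rightarrow> (real \<Rightarrow> complex) \<times> (real \<Rightarrow> complex) \<Rightarrow>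
    2 \<Rightarrow> complex \<Rightarrow> complex" where
  "u'_a S v j z = gbv' S v (sl_u S v j z) (end_a S)"

definition u'_b :: "sl_data \<Rightarrow> (real \<Rightarrow> complex) \<times> (real \<Rightarrow> complex) \<Rightarrow>
    2 \<Rightarrow> complex \<Rightarrow> complex" where
  "u'_b S v j z = gbv' S v (sl_u S v j z) (end_b S)"

definition kappa :: "sl_data \<Rightarrow> (real \<Rightarrow> complex) \<times> (real \<Rightarrow> complex) \<Rightarrow> real" where
  "kappa S v = Im (u'_b S v 2 \<i>) / Im (u'_b S v 1 \<i>)"

definition c1 :: "sl_data \<Rightarrow> (real \<Rightarrow> complex) \<times> (real \<Rightarrow> complex) \<Rightarrow> real" where
  "c1 S v = 1 / L2r_norm S (sl_u S v 1 \<i>)"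

definition c2 :: "sl_data \<Rightarrow> (real \<Rightarrow> complex) \<times> (real \<Rightarrow> complex) \<Rightarrow> real" where
  "c2 S v = 1 / L2r_norm S (\<lambda>x. sl_u S v 2 \<i> x - of_real (kappa S v) * sl_u S v 1 \<i> x)"

definition v_basis :: "sl_data \<Rightarrow> (real \<Rightarrow> complex) \<times> (real \<Rightarrow> complex) \<Rightarrow>
    2 \<Rightarrow> real \<Rightarrow> complex" where
  "v_basis S v j x =
     (if j = 1 then of_real (c1 S v) * sl_u S v 1 \<i> x
      else of_real (c2 S v) * (sl_u S v 2 \<i> x - of_real (kappa S v) * sl_u S v 1 \<i> x))"

definition K_sep :: "sl_data \<Rightarrow> (real \<Rightarrow> complex) \<times> (real \<Rightarrow> complex) \<Rightarrow>
    real \<Rightarrow> real \<Rightarrow> complex \<Rightarrow> complex^2^2" where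
  "K_sep S v \<alpha> \<beta> z = vector [
     vector [of_real (cot \<beta>) + u'_b S v 1 z, - u'_a S v 1 z],
     vector [u'_b S v 2 z, - of_real (cot \<alpha>) - u'_a S v 2 z]]"

definition K_coupled :: "sl_data \<Rightarrow> (real \<Rightarrow> complex) \<times> (real \<Rightarrow> complex) \<Rightarrow>
    real \<Rightarrow> real^2^2 \<Rightarrow> complex \<Rightarrow> complex^2^2" where
  "K_coupled S v \<phi> R z = vector [
     vector [- of_real (R $ 2 $ 2 / R $ 1 $ 2) + u'_b S v 1 z,
             exp (- \<i> * of_real \<phi>) / of_real (R $ 1 $ 2) - u'_a S v 1 z],
     vector [exp (\<i> * of_real \<phi>) / of_real (R $ 1 $ 2) + u'_b S v 2 z,
             - of_real (R $ 1 $ 1 / R $ 1 $ 2) - u'_a S v 2 z]]"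

definition W_Kr :: "sl_data \<Rightarrow> (real \<Rightarrow> complex) \<times> (real \<Rightarrow> complex) \<Rightarrow>
    complex \<Rightarrow> complex^2^2" where
  "W_Kr S v z = vector [
     vector [of_real (c1 S v) * (u'_b S v 1 z - u'_b S v 1 (- \<i>)),
             of_real (c1 S v) * (u'_b S v 2 z + u'_a S v 1 (- \<i>))],
     vector [- of_real (c2 S v) * (of_real (kappa S v) * (u'_b S v 1 z - u'_b S v 1 (- \<i>))
                + u'_b S v 2 (- \<i>) + u'_a S v 1 z),
             - of_real (c2 S v) * (of_real (kappa S v) * (u'_b S v 2 z + u'_a S v 1 (- \<i>))
                + u'_a S v 2 z - u'_a S v 2 (- \<i>))]]"

end

theory Submission
  imports Defs
begin

text \<open>
  Why the theorem holds. Let \<open>z\<close> be nonreal and different from \<open>\<plusminus>\<i>\<close>. For \<open>f\<close> in the eigenspace of \<open>\<i>\<close> the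
  function \<open>f / (\<i> - z)\<close> solves \<open>(\<tau> - z) g = f\<close>, so each resolvent differs from it by a combination of
  \<open>u\<^sub>1(z,\<cdot>)\<close> and \<open>u\<^sub>2(z,\<cdot>)\<close>, fixed by the boundary conditions. Both kinds of boundary conditions say that,
  up to sign, the derivative boundary values are the image of the boundary values under a Hermitian
  matrix (\<open>sep_eq\<close>, \<open>coupled_eq\<close>). Comparing with Dirichlet conditions leaves a linear system with the transpose of the
  matrix \<open>K\<close> for the two coefficients; by Green's formula its right-hand side is
  \<open>(u\<^sub>j(cnj z,\<cdot>), f)\<close> (\<open>resolvent_herm\<close>). Projecting to
  the eigenspace of \<open>\<i>\<close> produces the inner products \<open>(v\<^sub>l(\<i>,\<cdot>), u\<^sub>k(z,\<cdot>))\<close>, which Green's formula evaluates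
  to the entries of \<^const>\<open>W_Kr\<close> divided by \<open>- (z + \<i>)\<close> (\<open>W_Kr_eq\<close>); the factor \<open>z\<^sup>2 + 1\<close> turns this into
  \<open>\<i> - z\<close>. At \<open>z = \<plusminus>\<i>\<close> that factor vanishes.

  Invertibility of \<open>K\<close>, uniqueness of the resolvent and the existence of \<open>u\<^sub>1\<close>, \<open>u\<^sub>2\<close> all rest on one fact
  (\<open>sl_N_zero\<close>): a solution of \<open>\<tau> u = z u\<close> for which the boundary terms in Green's formula for the conjugate
  of \<open>u\<close> and \<open>u\<close> cancel is zero, since
  Green's formula gives \<open>Im z \<parallel>u\<parallel>\<^sup>2 = 0\<close>. The boundary terms are expressed by generalized boundary values
  through the Pluecker identity (\<open>pluecker\<close>).

  The analytic input is Green's formula on the maximal domain (\<open>green\<close>) and the solvability of initial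
  value problems with locally integrable coefficients (\<open>linear_system_exists\<close>, by a Picard series).
  Both rest on the equivalence of absolute continuity with being an indefinite integral: Lebesgue's
  differentiation theorem (\<open>lebesgue_differentiation\<close>) is derived from Henstock's lemma and Vitali's
  covering lemma, and an absolutely continuous function has a density
  (\<open>ac_has_density\<close>) since it is a difference of increasing absolutely continuous
  functions, to whose Stieltjes measures the Radon--Nikodym theorem applies.
\<close>

section \<open>Absolutely continuous functions\<close>

text \<open>
  The total increment \<^term>\<open>vsum f D\<close> of \<open>f\<close> over the finite family \<open>D\<close> of compact intervals, and the
  total length \<^term>\<open>tlen D\<close> of that family.
\<close>

abbreviation (input) vsum :: "(real \<Rightarrow> 'a::real_normed_vector) \<Rightarrow> real set set \<Rightarrow> real" where
  "vsum f D \<equiv> (\<Sum>K\<in>D. norm (f (Sup K) - f (Inf K)))"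

abbreviation (input) tlen :: "real set set \<Rightarrow> real" where
  "tlen D \<equiv> (\<Sum>K\<in>D. Sup K - Inf K)"

text \<open>
  Absolute continuity in the sense of \<^const>\<open>abs_cont_on\<close>, for functions with values in any normed
  space: the decomposition into monotone parts needs real-valued functions.
\<close>

definition ac_on :: "real set \<Rightarrow> (real \<Rightarrow> 'a::real_normed_vector) \<Rightarrow> bool" where
  "ac_on A f \<longleftrightarrow>
     (\<forall>\<epsilon>>0. \<exists>\<delta>>0. \<forall>D U. D division_of U \<and> U \<subseteq> A \<and> tlen D < \<delta> \<longrightarrow>
        vsum f D < \<epsilon>)"

lemma ac_onD:
  assumes "ac_on A f" "\<epsilon> > 0"
  shows "\<exists>\<delta>. \<delta> > 0 \<and> (\<forall>D U. D division_of U \<longrightarrow> U \<subseteq> A \<longrightarrow> tlen D < \<delta> \<longrightarrow>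
    vsum f D < \<epsilon>)"
proof -
  from assms obtain \<delta> where "\<delta> > 0" "\<forall>D U. D division_of U \<and> U \<subseteq> A \<and> tlen D < \<delta> \<longrightarrow>
    vsum f D < \<epsilon>" unfolding ac_on_def by metis
  then show ?thesis by blast
qed

lemma abs_cont_on_eq_ac_on: "abs_cont_on A f \<longleftrightarrow> ac_on A f"
  by (simp add: abs_cont_on_def ac_on_def)

lemma division_real_memE:
  assumes "D division_of U" "K \<in> D"
  obtains s t :: real where "K = {s..t}" "s \<le> t"
proof -
  obtain s t where "K = cbox s t" using division_ofD(4)[OF assms] by blast
  moreover have "K \<noteq> {}" using division_ofD(3)[OF assms] .
  ultimately show thesis using that[of s t] by auto
qed

lemma division_real_measure:
  assumes "D division_of (U::real set)"
  shows "tlen D = measure lebesgue U"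
proof -
  have "tlen D = (\<Sum>K\<in>D. measure lebesgue K)"
  proof (rule sum.cong[OF refl])
    fix K assume "K \<in> D"
    then obtain s t where "K = {s..t}" "s \<le> t" using division_real_memE[OF assms] by blast
    then show "Sup K - Inf K = measure lebesgue K" by simp
  qed
  then show ?thesis using content_division[OF assms] by simp
qed

section \<open>Differentiation of indefinite integrals\<close>

text \<open>
  The points at which the average of \<open>f\<close> over arbitrarily short intervals issuing from the point
  stays away from the value of \<open>f\<close> by more than \<open>1 / n\<close> form a negligible set. The intervals
  witnessing this can be taken fine for the gauge of Henstock's lemma; a disjoint subfamily covers
  a fixed proportion of the set, and Henstock's lemma bounds its total length.
\<close>

lemma lebesgue_differentiation_aux:
  fixes f :: "real \<Rightarrow> 'b::euclidean_space"
  assumes f: "f integrable_on {c..d}" and n: "n > 0"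
  shows "negligible {x \<in> {c<..<d}. \<forall>\<delta>>0. \<exists>u v. u < v \<and> v - u < \<delta> \<and> {u..v} \<subseteq> {c..d} \<and> (x = u \<or> x = v) \<and>
            norm ((v - u) *\<^sub>R f x - integral {u..v} f) > (v - u) / n}" (is "negligible ?E")
proof -
  define E where "E = ?E"
  have "negligible E"
    unfolding negligible_outer_le
  proof (intro allI impI)
    fix e :: real assume "e > 0"
    have e': "e / (5 * n) > 0" using \<open>e > 0\<close> n by simp
    obtain \<gamma> where \<gamma>: "gauge \<gamma>" and hen: "\<And>p. \<lbrakk>p tagged_partial_division_of (cbox c d); \<gamma> fine p\<rbrakk> \<Longrightarrow>
               sum (\<lambda>(x,k). norm(measure lborel k *\<^sub>R f x - integral k f)) p < e / (5 * n)"
      using Henstock_lemma[of f c d, OF _ e'] f by auto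
    define Q where "Q x u v \<longleftrightarrow> u < v \<and> v - u \<le> 1 \<and> {u..v} \<subseteq> {c..d} \<and> (x = u \<or> x = v) \<and> {u..v} \<subseteq> \<gamma> x \<and>
              norm ((v - u) *\<^sub>R f x - integral {u..v} f) > (v - u) / n" for x u v
    have "\<exists>u v. Q x u v" if "x \<in> E" for x
    proof -
      have "open (\<gamma> x)" "x \<in> \<gamma> x" using \<gamma> by (auto simp: gauge_def)
      then obtain r where r: "r > 0" "ball x r \<subseteq> \<gamma> x" using open_contains_ball by blast
      define \<delta> where "\<delta> = min r 1"
      have "\<delta> > 0" using r by (simp add: \<delta>_def)
      with that[unfolded E_def] obtain u v where uv: "u < v" "v - u < \<delta>" "{u..v} \<subseteq> {c..d}" "x = u \<or> x = v"
         "norm ((v - u) *\<^sub>R f x - integral {u..v} f) > (v - u) / n" by blast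
      have "{u..v} \<subseteq> ball x r" using uv by (auto simp: dist_real_def \<delta>_def)
      with uv r have "Q x u v" by (auto simp: \<delta>_def Q_def)
      then show ?thesis by blast
    qed
    then obtain u v where uvQ: "\<And>x. x \<in> E \<Longrightarrow> Q x (u x) (v x)" by metis
    have uv: "\<And>x. x \<in> E \<Longrightarrow> u x < v x \<and> v x - u x \<le> 1 \<and> {u x..v x} \<subseteq> {c..d} \<and> (x = u x \<or> x = v x) \<and> {u x..v x} \<subseteq> \<gamma> x \<and>
              norm ((v x - u x) *\<^sub>R f x - integral {u x..v x} f) > (v x - u x) / n"
      using uvQ unfolding Q_def by blast
    define a where "a x = (u x + v x) / 2" for x
    define r where "r x = (v x - u x) / 2" for x
    have cb: "cball (a x) (k * r x) = {a x - k * r x .. a x + k * r x}" for x k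
      by (simp add: cball_eq_atLeastAtMost)
    have cb1: "cball (a x) (r x) = {u x..v x}" for x
      by (simp add: cball_eq_atLeastAtMost a_def r_def field_simps)
    have S: "E \<subseteq> (\<Union>x\<in>E. cball (a x) (r x))"
    proof
      fix x assume x: "x \<in> E"
      then have "x \<in> cball (a x) (r x)" using uv[OF x] unfolding cb1 by auto
      with x show "x \<in> (\<Union>x\<in>E. cball (a x) (r x))" by blast
    qed
    have rB: "0 < r x \<and> r x \<le> 1" if "x \<in> E" for x using uv[OF that] by (simp add: r_def)
    \<comment> \<open>Vitali: the fivefold enlargements of disjoint intervals cover the exceptional set, so the factor 5 enters the choice of the gauge.\<close>
    obtain C where C: "countable C" "C \<subseteq> E"
       "pairwise (\<lambda>i j. disjnt (cball (a i) (r i)) (cball (a j) (r j))) C"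
       "E \<subseteq> (\<Union>i\<in>C. cball (a i) (5 * r i))"
      using Vitali_covering_lemma_cballs[OF S, of 1] rB by blast
    have fin: "(\<Sum>x\<in>F. v x - u x) \<le> e / 5" if F: "F \<subseteq> C" "finite F" for F
    proof -
      define p where "p = (\<lambda>x. (x, {u x..v x})) ` F"
      have inj: "inj_on (\<lambda>x. (x, {u x..v x})) F" by (simp add: inj_on_def)
      have FE: "x \<in> E" if "x \<in> F" for x using that F C by blast
      have "p tagged_partial_division_of (cbox c d)"
        unfolding tagged_partial_division_of_def
      proof (intro conjI allI impI)
        show "finite p" using F by (simp add: p_def)
      next
        fix x K assume "(x, K) \<in> p"
        then have x: "x \<in> F" "K = {u x..v x}" by (auto simp: p_def)
        note U = uv[OF FE[OF x(1)]]
        show "x \<in> K" "K \<subseteq> cbox c d" using U x by auto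
        show "\<exists>a b. K = cbox a b" using x by (metis box_real(2))
      next
        fix x K y L assume as: "(x, K) \<in> p \<and> (y, L) \<in> p \<and> (x, K) \<noteq> (y, L)"
        then have x: "x \<in> F" "y \<in> F" "x \<noteq> y" "K = {u x..v x}" "L = {u y..v y}" by (auto simp: p_def)
        then have "disjnt K L" using C(3) F by (auto simp: pairwise_def cb1)
        then show "interior K \<inter> interior L = {}" using interior_subset[of K] interior_subset[of L] unfolding disjnt_def by blast
      qed
      moreover have "\<gamma> fine p" using uv[OF FE] by (auto simp: fine_def p_def)
      ultimately have "sum (\<lambda>(x,k). norm(measure lborel k *\<^sub>R f x - integral k f)) p < e / (5 * n)" by (rule hen)
      also have "sum (\<lambda>(x,k). norm(measure lborel k *\<^sub>R f x - integral k f)) p =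
            (\<Sum>x\<in>F. norm ((v x - u x) *\<^sub>R f x - integral {u x..v x} f))"
        unfolding p_def sum.reindex[OF inj]
      proof (rule sum.cong[OF refl])
        fix x assume "x \<in> F"
        then show "((\<lambda>(x,k). norm(measure lborel k *\<^sub>R f x - integral k f)) \<circ> (\<lambda>x. (x, {u x..v x}))) x =
          norm ((v x - u x) *\<^sub>R f x - integral {u x..v x} f)" using uv[OF FE[OF \<open>x \<in> F\<close>]] by simp
      qed
      finally have "(\<Sum>x\<in>F. norm ((v x - u x) *\<^sub>R f x - integral {u x..v x} f)) < e / (5 * n)" .
      moreover have "(\<Sum>x\<in>F. (v x - u x) / n) \<le> (\<Sum>x\<in>F. norm ((v x - u x) *\<^sub>R f x - integral {u x..v x} f))"
        using uv[OF FE] by (intro sum_mono) (simp add: less_imp_le)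
      ultimately have "(\<Sum>x\<in>F. (v x - u x)) / n \<le> e / (5 * n)" by (simp add: sum_divide_distrib)
      then show ?thesis using n by (simp add: field_simps)
    qed
    define T where "T = (\<lambda>x. cball (a x) (5 * r x)) ` C"
    have cT: "countable T" using C by (simp add: T_def)
    have bnd: "measure lebesgue (\<Union>D') \<le> e" if D': "D' \<subseteq> T" "finite D'" for D'
    proof -
      obtain F where F: "F \<subseteq> C" "finite F" "D' = (\<lambda>x. cball (a x) (5 * r x)) ` F"
        using finite_subset_image[OF D'(2) D'(1)[unfolded T_def]] by blast
      have "measure lebesgue (\<Union>D') \<le> (\<Sum>x\<in>F. measure lebesgue (cball (a x) (5 * r x)))"
        unfolding F(3) by (rule measure_UNION_le) (use F in auto)
      also have "\<dots> = (\<Sum>x\<in>F. 5 * (v x - u x))"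
      proof (rule sum.cong[OF refl])
        fix x assume "x \<in> F"
        then have "x \<in> E" using F C by blast
        then have "r x > 0" "5 * (v x - u x) = 10 * r x" using rB by (simp_all add: r_def)
        then show "measure lebesgue (cball (a x) (5 * r x)) = 5 * (v x - u x)"
          unfolding cb by simp
      qed
      also have "\<dots> \<le> e" unfolding sum_distrib_left[symmetric] using fin[OF F(1,2)] by simp
      finally show ?thesis .
    qed
    have Tm: "A \<in> lmeasurable" if "A \<in> T" for A using that by (auto simp: T_def)
    have "\<Union>T \<in> lmeasurable \<and> measure lebesgue (\<Union>T) \<le> e"
      using fmeasurable_Union_bound[OF cT Tm bnd] measure_Union_bound[OF cT Tm bnd] by blast
    moreover have "E \<subseteq> \<Union>T" using C(4) by (simp add: T_def)
    ultimately show "\<exists>T. E \<subseteq> T \<and> T \<in> lmeasurable \<and> measure lebesgue T \<le> e" by blast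
  qed
  then show ?thesis unfolding E_def .
qed

theorem lebesgue_differentiation:
  fixes f :: "real \<Rightarrow> 'b::euclidean_space"
  assumes f: "f integrable_on {c..d}"
  shows "negligible {x \<in> {c<..<d}. \<not> ((\<lambda>x. integral {c..x} f) has_vector_derivative f x) (at x)}"
proof -
  let ?E = "\<lambda>n::nat. {x \<in> {c<..<d}. \<forall>\<delta>>0. \<exists>u v. u < v \<and> v - u < \<delta> \<and> {u..v} \<subseteq> {c..d} \<and> (x = u \<or> x = v) \<and>
            norm ((v - u) *\<^sub>R f x - integral {u..v} f) > (v - u) / real (Suc n)}"
  have neg: "negligible (\<Union>n. ?E n)"
    by (intro negligible_Union_nat lebesgue_differentiation_aux[OF f]) simp
  show ?thesis
  proof (rule negligible_subset[OF neg], rule subsetI)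
    fix x assume x: "x \<in> {x \<in> {c<..<d}. \<not> ((\<lambda>x. integral {c..x} f) has_vector_derivative f x) (at x)}"
    show "x \<in> (\<Union>n. ?E n)"
    proof (rule ccontr)
      define P where "P \<delta> n u v \<longleftrightarrow> u < v \<and> v - u < \<delta> \<and> {u..v} \<subseteq> {c..d} \<and> (x = u \<or> x = v) \<and>
            norm ((v - u) *\<^sub>R f x - integral {u..v} f) > (v - u) / real (Suc n)" for \<delta> u v and n :: nat
      assume nx: "x \<notin> (\<Union>n. ?E n)"
      have "((\<lambda>x. integral {c..x} f) has_vector_derivative f x) (at x)"
        unfolding has_vector_derivative_def has_derivative_at_alt
      proof (intro conjI allI impI)
        show "bounded_linear (\<lambda>h. h *\<^sub>R f x)" by (rule bounded_linear_scaleR_left)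
        fix e :: real assume "e > 0"
        then obtain n where n: "1 / real (Suc n) < e" using nat_approx_posE by blast
        from nx have "x \<notin> ?E n" by blast
        then have "\<not> (\<forall>\<delta>>0. \<exists>u v. P \<delta> n u v)"
          using x by (simp add: P_def)
        then obtain \<delta> where d0: "\<delta> > 0" "\<And>u v. \<not> P \<delta> n u v" by blast
        have d: "norm ((v - u) *\<^sub>R f x - integral {u..v} f) \<le> (v - u) / real (Suc n)"
          if "u < v" "v - u < \<delta>" "{u..v} \<subseteq> {c..d}" "x = u \<or> x = v" for u v
          using d0(2)[of u v] that unfolding P_def by linarith
        define \<delta>' where "\<delta>' = min \<delta> (min (x - c) (d - x))"
        have "\<delta>' > 0" using d0 x by (simp add: \<delta>'_def)
        moreover have "norm (integral {c..y} f - integral {c..x} f - (y - x) *\<^sub>R f x) \<le> e * norm (y - x)"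
          if y: "norm (y - x) < \<delta>'" for y
        proof (cases "y = x")
          case False
          have yc: "c < y" "y < d" using y by (auto simp: \<delta>'_def abs_if split: if_splits)
          define u v where "u = min x y" and "v = max x y"
          have sub: "{u..v} \<subseteq> {c..d}" using x yc by (auto simp: u_def v_def)
          have "norm ((v - u) *\<^sub>R f x - integral {u..v} f) \<le> (v - u) / real (Suc n)"
            by (rule d) (use sub False y in \<open>auto simp: u_def v_def \<delta>'_def\<close>)
          also have "\<dots> = (1 / real (Suc n)) * norm (y - x)" by (simp add: u_def v_def)
          also have "\<dots> \<le> e * norm (y - x)" using n by (intro mult_right_mono) auto
          finally have 1: "norm ((v - u) *\<^sub>R f x - integral {u..v} f) \<le> e * norm (y - x)" .
          have int: "f integrable_on {c..v}"
            by (rule integrable_subinterval_real[OF f]) (use x yc in \<open>auto simp: v_def\<close>)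
          have comb: "integral {c..u} f + integral {u..v} f = integral {c..v} f"
            by (rule Henstock_Kurzweil_Integration.integral_combine) (use x yc int in \<open>auto simp: u_def v_def\<close>)
          show ?thesis
          proof (cases "x < y")
            case True
            then have "integral {c..y} f - integral {c..x} f = integral {u..v} f" "v - u = y - x"
              using comb by (auto simp: u_def v_def algebra_simps)
            then show ?thesis using 1 by (simp add: norm_minus_commute)
          next
            case False
            then have *: "integral {c..y} f - integral {c..x} f = - integral {u..v} f" "y - x = - (v - u)"
              using comb by (auto simp: u_def v_def algebra_simps)
            have "integral {c..y} f - integral {c..x} f - (y - x) *\<^sub>R f x = (v - u) *\<^sub>R f x - integral {u..v} f"
              unfolding * by (simp add: algebra_simps)
            then show ?thesis using 1 by simp
          qed
        qed auto
        ultimately show "\<exists>d>0. \<forall>y. norm (y - x) < d \<longrightarrow>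
            norm (integral {c..y} f - integral {c..x} f - (y - x) *\<^sub>R f x) \<le> e * norm (y - x)" by blast
      qed
      with x show False by blast
    qed
  qed
qed


section \<open>The variation of an absolutely continuous function\<close>

text \<open>
  The variation over \<open>{x..y}\<close>. The supremum runs over divisions of arbitrary subsets of the interval,
  so that monotonicity in the interval is immediate; it is meaningful only if the increments are
  bounded, which is \<open>var_bounded\<close>.
\<close>

definition variation :: "(real \<Rightarrow> real) \<Rightarrow> real \<Rightarrow> real \<Rightarrow> real" where
  "variation f x y = (SUP D\<in>{D. \<exists>U. D division_of U \<and> U \<subseteq> {x..y}}. vsum f D)"

definition var_bounded :: "(real \<Rightarrow> real) \<Rightarrow> real \<Rightarrow> real \<Rightarrow> bool" where
  "var_bounded f x y \<longleftrightarrow> (\<exists>B. \<forall>D U. D division_of U \<longrightarrow> U \<subseteq> {x..y} \<longrightarrow> vsum f D \<le> B)"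

text \<open>
  Cutting every member of a division down to \<open>{x..y}\<close>. Distinct members may have the same nonempty trace,
  but only if the trace is a single point, over which \<open>f\<close> has no increment.
\<close>

lemma vsum_restrict:
  fixes x y :: real and f :: "real \<Rightarrow> real"
  assumes D: "D division_of U"
  defines "D' \<equiv> {k1 \<inter> k2 | k1 k2. k1 \<in> D \<and> k2 \<in> {{x..y}} \<and> k1 \<inter> k2 \<noteq> {}}"
  shows "D' division_of (U \<inter> {x..y})"
    and "vsum f D' = (\<Sum>K\<in>D. if K \<inter> {x..y} = {} then 0 else norm (f (Sup (K \<inter> {x..y})) - f (Inf (K \<inter> {x..y}))))"
proof -
  have "{k. k = {x..y} \<and> k \<noteq> {}} division_of {x..y}"
  proof (cases "x \<le> y")
    case True
    then have "{k. k = {x..y} \<and> k \<noteq> {}} = {cbox x y}" by auto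
    then show ?thesis using True division_of_self[of x y] by simp
  next
    case False
    then have "{k. k = {x..y} \<and> k \<noteq> {}} = {}" by auto
    then show ?thesis using False division_of_trivial by simp
  qed
  from division_inter[OF D this]
  have "{k1 \<inter> k2 | k1 k2. k1 \<in> D \<and> k2 \<in> {k. k = {x..y} \<and> k \<noteq> {}} \<and> k1 \<inter> k2 \<noteq> {}} division_of (U \<inter> {x..y})" .
  moreover have "D' = {k1 \<inter> k2 | k1 k2. k1 \<in> D \<and> k2 \<in> {k. k = {x..y} \<and> k \<noteq> {}} \<and> k1 \<inter> k2 \<noteq> {}}"
    unfolding D'_def by blast
  ultimately show "D' division_of (U \<inter> {x..y})" by simp
  define E where "E = {K \<in> D. K \<inter> {x..y} \<noteq> {}}"
  have fin: "finite D" using division_ofD(1)[OF D] .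
  have D': "D' = (\<lambda>K. K \<inter> {x..y}) ` E" unfolding D'_def E_def by auto
  have "vsum f D' = (\<Sum>K\<in>E. norm (f (Sup (K \<inter> {x..y})) - f (Inf (K \<inter> {x..y}))))"
    unfolding D'
  proof (subst sum.reindex_nontrivial)
    show "finite E" using fin by (simp add: E_def)
    fix K L assume KL: "K \<in> E" "L \<in> E" "K \<noteq> L" "K \<inter> {x..y} = L \<inter> {x..y}"
    then have "K \<in> D" "L \<in> D" by (auto simp: E_def)
    then obtain s t s' t' where st: "K = {s..t}" "s \<le> t" "L = {s'..t'}" "s' \<le> t'"
      using division_real_memE[OF D] by metis
    have int: "interior K \<inter> interior L = {}"
      using division_ofD(5)[OF D] \<open>K \<in> D\<close> \<open>L \<in> D\<close> KL(3) by blast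
    have K: "K \<inter> {x..y} = {max s x..min t y}" using st by auto
    have ne: "max s x \<le> min t y" using KL(1) unfolding E_def using K by auto
    have "\<not> max s x < min t y"
    proof
      assume "max s x < min t y"
      then have "interior (K \<inter> {x..y}) \<noteq> {}" unfolding K interior_atLeastAtMost_real using dense[of "max s x" "min t y"] by auto
      moreover have "interior (K \<inter> {x..y}) \<subseteq> interior K \<inter> interior L"
        using KL(4) by (metis interior_mono Int_lower1 Int_subset_iff)
      ultimately show False using int by simp
    qed
    then have "max s x = min t y" using ne by linarith
    then show "norm (f (Sup (K \<inter> {x..y})) - f (Inf (K \<inter> {x..y}))) = 0" unfolding K by simp
  qed simp
  also have "\<dots> = (\<Sum>K\<in>D. if K \<inter> {x..y} = {} then 0 else norm (f (Sup (K \<inter> {x..y})) - f (Inf (K \<inter> {x..y}))))"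
    unfolding E_def using fin by (subst sum.inter_filter) (auto intro!: sum.cong)
  finally show "vsum f D' = \<dots>" .
qed

lemma vsum_split:
  fixes f :: "real \<Rightarrow> real"
  assumes D: "D division_of U" "U \<subseteq> {x..y}" and m: "x \<le> m" "m \<le> y"
  obtains D1 D2 U1 U2 where "D1 division_of U1" "U1 \<subseteq> {x..m}" "D2 division_of U2" "U2 \<subseteq> {m..y}"
    "vsum f D \<le> vsum f D1 + vsum f D2"
proof -
  let ?g = "\<lambda>K. if K = {} then 0 else norm (f (Sup K) - f (Inf K))"
  define D1 where "D1 = {k1 \<inter> k2 | k1 k2. k1 \<in> D \<and> k2 \<in> {{x..m}} \<and> k1 \<inter> k2 \<noteq> {}}"
  define D2 where "D2 = {k1 \<inter> k2 | k1 k2. k1 \<in> D \<and> k2 \<in> {{m..y}} \<and> k1 \<inter> k2 \<noteq> {}}"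
  note s1 = vsum_restrict(2)[OF D(1), where x = x and y = m and f = f, folded D1_def]
  note s2 = vsum_restrict(2)[OF D(1), where x = m and y = y and f = f, folded D2_def]
  note r1 = vsum_restrict(1)[OF D(1), where x = x and y = m, folded D1_def]
  note r2 = vsum_restrict(1)[OF D(1), where x = m and y = y, folded D2_def]
  have "vsum f D \<le> (\<Sum>K\<in>D. ?g (K \<inter> {x..m}) + ?g (K \<inter> {m..y}))"
  proof (rule sum_mono)
    fix K assume K: "K \<in> D"
    then obtain s t where st: "K = {s..t}" "s \<le> t" using division_real_memE[OF D(1)] by metis
    have "K \<subseteq> {x..y}" using division_ofD(2)[OF D(1) K] D(2) by blast
    then have xy: "x \<le> s" "t \<le> y" using st by auto
    have i1: "K \<inter> {x..m} = {s..min t m}" and i2: "K \<inter> {m..y} = {max s m..t}" using st xy by auto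
    consider "t \<le> m" | "m \<le> s" | "s < m" "m < t" by linarith
    then show "norm (f (Sup K) - f (Inf K)) \<le> ?g (K \<inter> {x..m}) + ?g (K \<inter> {m..y})"
    proof cases
      case 1
      then have "min t m = t" by simp
      then show ?thesis unfolding i1 i2 using st by simp
    next
      case 2
      then have "max s m = s" by simp
      then show ?thesis unfolding i1 i2 using st by simp
    next
      case 3
      then have "min t m = m" "max s m = m" by auto
      then show ?thesis unfolding i1 i2 using st 3 by simp
    qed
  qed
  also have "\<dots> = vsum f D1 + vsum f D2" unfolding s1 s2 by (simp add: sum.distrib)
  finally show thesis using r1 r2 that[of D1 "U \<inter> {x..m}" D2 "U \<inter> {m..y}"] by blast
qed

lemma var_bounded_trans:
  assumes "var_bounded f x m" "var_bounded f m y" "x \<le> m" "m \<le> y"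
  shows "var_bounded f x y"
proof -
  obtain B1 where B1: "\<And>D U. D division_of U \<Longrightarrow> U \<subseteq> {x..m} \<Longrightarrow> vsum f D \<le> B1"
    using assms(1) unfolding var_bounded_def by blast
  obtain B2 where B2: "\<And>D U. D division_of U \<Longrightarrow> U \<subseteq> {m..y} \<Longrightarrow> vsum f D \<le> B2"
    using assms(2) unfolding var_bounded_def by blast
  have "vsum f D \<le> B1 + B2" if D: "D division_of U" "U \<subseteq> {x..y}" for D U
  proof -
    obtain D1 D2 U1 U2 where *: "D1 division_of U1" "U1 \<subseteq> {x..m}" "D2 division_of U2" "U2 \<subseteq> {m..y}"
      "vsum f D \<le> vsum f D1 + vsum f D2" by (rule vsum_split[OF D assms(3,4), of f])
    then show ?thesis using B1[OF *(1,2)] B2[OF *(3,4)] by linarith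
  qed
  then show ?thesis unfolding var_bounded_def by blast
qed

text \<open>
  On intervals shorter than the \<open>\<delta>\<close> belonging to \<open>\<epsilon> = 1\<close> all increments are at most 1, and
  boundedness is passed on to adjacent intervals.
\<close>

lemma ac_on_var_bounded:
  assumes f: "ac_on {c..d} f" and "c \<le> d"
  shows "var_bounded f c d"
proof -
  from ac_onD[OF f zero_less_one] obtain \<delta> where d':
    "\<delta> > 0 \<and> (\<forall>D U. D division_of U \<longrightarrow> U \<subseteq> {c..d} \<longrightarrow> tlen D < \<delta> \<longrightarrow> vsum f D < 1)"
    ..
  note d = conjunct1[OF d'] conjunct2[OF d', rule_format]
  have "c \<le> c \<and> d \<le> d \<longrightarrow> var_bounded f c d"
    using \<open>c \<le> d\<close>
  proof (induction rule: Bolzano[where P = "\<lambda>x y. c \<le> x \<and> y \<le> d \<longrightarrow> var_bounded f x y"])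
    case (trans a b c') then show ?case using var_bounded_trans by auto
  next
    case (local x)
    have "var_bounded f a b" if ab: "a \<le> x" "x \<le> b" "b - a < \<delta>" "c \<le> a" "b \<le> d" for a b
      unfolding var_bounded_def
    proof (intro exI[of _ 1] allI impI)
      fix D U assume D: "D division_of U" "U \<subseteq> {a..b}"
      have "tlen D = measure lebesgue U" by (rule division_real_measure[OF D(1)])
      also have "\<dots> \<le> measure lebesgue {a..b}"
        by (rule measure_mono_fmeasurable) (use D lmeasurable_division[OF D(1)] in \<open>auto intro: fmeasurableD\<close>)
      also have "\<dots> < \<delta>" using ab d by simp
      finally have "tlen D < \<delta>" .
      moreover have "U \<subseteq> {c..d}" using D ab by auto
      ultimately show "vsum f D \<le> 1" using d(2)[OF D(1)] by force
    qed
    then show ?case using \<open>\<delta> > 0\<close> by blast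
  qed
  then show ?thesis by simp
qed

lemma var_bounded_subset:
  assumes "var_bounded f c d" "c \<le> x" "y \<le> d"
  shows "var_bounded f x y"
proof -
  have "{x..y} \<subseteq> {c..d}" using assms by auto
  then show ?thesis using assms(1) unfolding var_bounded_def by (meson order_trans)
qed

lemma vsum_le_variation:
  assumes "var_bounded f x y" "D division_of U" "U \<subseteq> {x..y}"
  shows "vsum f D \<le> variation f x y"
  unfolding variation_def
proof (rule cSUP_upper)
  show "D \<in> {D. \<exists>U. D division_of U \<and> U \<subseteq> {x..y}}" using assms by blast
  show "bdd_above (vsum f ` {D. \<exists>U. D division_of U \<and> U \<subseteq> {x..y}})"
    using assms(1) unfolding var_bounded_def bdd_above_def by blast
qed

lemma variation_least:
  assumes "\<And>D U. D division_of U \<Longrightarrow> U \<subseteq> {x..y} \<Longrightarrow> vsum f D \<le> B"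
  shows "variation f x y \<le> B"
  unfolding variation_def
proof (rule cSUP_least)
  show "{D. \<exists>U. D division_of U \<and> U \<subseteq> {x..y}} \<noteq> {}" using division_of_trivial by blast
qed (use assms in blast)

lemma variation_approx:
  assumes "e > 0"
  shows "\<exists>D U. D division_of U \<and> U \<subseteq> {x..y} \<and> variation f x y - e < vsum f D"
proof (rule ccontr)
  assume "\<not> ?thesis"
  then have "vsum f D \<le> variation f x y - e" if "D division_of U" "U \<subseteq> {x..y}" for D U
    using that not_le by blast
  then have "variation f x y \<le> variation f x y - e" by (rule variation_least)
  with assms show False by simp
qed

lemma abs_diff_le_variation:
  assumes "var_bounded f x y" "x \<le> y"
  shows "\<bar>f y - f x\<bar> \<le> variation f x y"
proof -
  have "{cbox x y} division_of {x..y}" using division_of_self[of x y] assms(2) by simp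
  from vsum_le_variation[OF assms(1) this] assms(2) show ?thesis by simp
qed

lemma variation_subadd:
  assumes "var_bounded f x y" "x \<le> m" "m \<le> y"
  shows "variation f x y \<le> variation f x m + variation f m y"
proof (rule variation_least)
  fix D U assume D: "D division_of U" "U \<subseteq> {x..y}"
  obtain D1 D2 U1 U2 where *: "D1 division_of U1" "U1 \<subseteq> {x..m}" "D2 division_of U2" "U2 \<subseteq> {m..y}"
      "vsum f D \<le> vsum f D1 + vsum f D2" by (rule vsum_split[OF D assms(2,3), of f])
  have "var_bounded f x m" "var_bounded f m y" using var_bounded_subset assms by auto
  then show "vsum f D \<le> variation f x m + variation f m y"
    using vsum_le_variation[OF _ *(1,2)] vsum_le_variation[OF _ *(3,4)] *(5) by fastforce
qed

text \<open>
  Refining each member of a division. The families \<open>d K\<close> may share members, but only one-point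
  intervals, on which \<open>h\<close> vanishes.
\<close>

lemma division_UN:
  fixes h :: "real set \<Rightarrow> real"
  assumes D: "D division_of U" and d: "\<And>K. K \<in> D \<Longrightarrow> d K division_of W K" "\<And>K. K \<in> D \<Longrightarrow> W K \<subseteq> K"
    and h: "\<And>x. h {x} = 0"
  shows "(\<Union>K\<in>D. d K) division_of (\<Union>K\<in>D. W K)" and "sum h (\<Union>K\<in>D. d K) = (\<Sum>K\<in>D. sum h (d K))"
proof -
  have fin: "finite D" "\<And>K. K \<in> D \<Longrightarrow> finite (d K)" using division_ofD(1) D d by auto
  have sub: "J \<subseteq> K" if "K \<in> D" "J \<in> d K" for J K using division_ofD(2)[OF d(1)[OF that(1)] that(2)] d(2)[OF that(1)] by blast
  have int: "interior J \<inter> interior J' = {}" if "K \<in> D" "K' \<in> D" "K \<noteq> K'" "J \<in> d K" "J' \<in> d K'" for J J' K K'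
    using division_ofD(5)[OF D that(1,2,3)] interior_mono[OF sub[OF that(1,4)]] interior_mono[OF sub[OF that(2,5)]] by blast
  show "(\<Union>K\<in>D. d K) division_of (\<Union>K\<in>D. W K)"
  proof (rule division_ofI)
    show "finite (\<Union>K\<in>D. d K)" using fin by blast
    show "\<Union> (\<Union>K\<in>D. d K) = (\<Union>K\<in>D. W K)" using division_ofD(6)[OF d(1)] by blast
  next
    fix J assume "J \<in> (\<Union>K\<in>D. d K)"
    then obtain K where K: "K \<in> D" "J \<in> d K" by blast
    show "J \<subseteq> (\<Union>K\<in>D. W K)" "J \<noteq> {}" "\<exists>a b. J = cbox a b"
      using division_ofD(2,3,4)[OF d(1)[OF K(1)] K(2)] K by blast+
  next
    fix J J' assume "J \<in> (\<Union>K\<in>D. d K)" "J' \<in> (\<Union>K\<in>D. d K)" "J \<noteq> J'"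
    then obtain K K' where K: "K \<in> D" "J \<in> d K" "K' \<in> D" "J' \<in> d K'" by blast
    show "interior J \<inter> interior J' = {}"
    proof (cases "K = K'")
      case True then show ?thesis using division_ofD(5)[OF d(1)[OF K(1)]] K \<open>J \<noteq> J'\<close> by blast
    next
      case False then show ?thesis using int K by blast
    qed
  qed
  have "(\<Union>K\<in>D. d K) = snd ` (SIGMA K:D. d K)" by force
  then have "sum h (\<Union>K\<in>D. d K) = sum h (snd ` (SIGMA K:D. d K))" by simp
  also have "\<dots> = sum (h \<circ> snd) (SIGMA K:D. d K)"
  proof (rule sum.reindex_nontrivial)
    show "finite (SIGMA K:D. d K)" using fin by blast
    fix p q assume pq: "p \<in> (SIGMA K:D. d K)" "q \<in> (SIGMA K:D. d K)" "p \<noteq> q" "snd p = snd q"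
    then obtain K K' J where K: "p = (K, J)" "q = (K', J)" "K \<in> D" "J \<in> d K" "K' \<in> D" "J \<in> d K'" "K \<noteq> K'" by force
    obtain s t where st: "J = {s..t}" "s \<le> t" using division_real_memE[OF d(1)[OF K(3)] K(4)] by blast
    have "interior J = {}" using int[OF K(3,5,7,4,6)] by simp
    then have "s = t" using st by simp
    then show "h (snd p) = 0" using h st K by simp
  qed
  also have "\<dots> = (\<Sum>K\<in>D. sum h (d K))" by (subst sum.Sigma) (use fin in \<open>auto simp: split_def\<close>)
  finally show "sum h (\<Union>K\<in>D. d K) = (\<Sum>K\<in>D. sum h (d K))" .
qed

lemma variation_superadd:
  assumes b: "var_bounded f x y" and m: "x \<le> m" "m \<le> y"
  shows "variation f x m + variation f m y \<le> variation f x y"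
proof (rule field_le_epsilon)
  fix e :: real assume "e > 0"
  then have e2: "e / 2 > 0" by simp
  obtain D1 U1 where 1: "D1 division_of U1" "U1 \<subseteq> {x..m}" "variation f x m - e / 2 < vsum f D1"
    using variation_approx[OF e2, of x m f] by blast
  obtain D2 U2 where 2: "D2 division_of U2" "U2 \<subseteq> {m..y}" "variation f m y - e / 2 < vsum f D2"
    using variation_approx[OF e2, of m y f] by blast
  have "interior U1 \<inter> interior U2 \<subseteq> interior {x..m} \<inter> interior {m..y}"
    using interior_mono[OF 1(2)] interior_mono[OF 2(2)] by blast
  also have "\<dots> = {}" by auto
  finally have int: "interior U1 \<inter> interior U2 = {}" by simp
  have div: "(D1 \<union> D2) division_of (U1 \<union> U2)" by (rule division_disjoint_union[OF 1(1) 2(1) int])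
  have "vsum f (D1 \<union> D2) = vsum f D1 + vsum f D2"
  proof (rule sum.union_inter_neutral)
    show "finite D1" "finite D2" using 1 2 division_ofD(1) by auto
    show "\<forall>K\<in>D1 \<inter> D2. norm (f (Sup K) - f (Inf K)) = 0"
    proof
      fix K assume K: "K \<in> D1 \<inter> D2"
      then obtain s t where st: "K = {s..t}" "s \<le> t" using division_real_memE[OF 1(1)] by blast
      have "K \<subseteq> {x..m}" "K \<subseteq> {m..y}" using K division_ofD(2)[OF 1(1)] division_ofD(2)[OF 2(1)] 1(2) 2(2) by blast+
      then have "s = t" using st by auto
      then show "norm (f (Sup K) - f (Inf K)) = 0" using st by simp
    qed
  qed
  moreover have "U1 \<union> U2 \<subseteq> {x..y}" using 1(2) 2(2) m by auto
  ultimately have "vsum f D1 + vsum f D2 \<le> variation f x y"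
    using vsum_le_variation[OF b div] by simp
  then show "variation f x m + variation f m y \<le> variation f x y + e" using 1(3) 2(3) by linarith
qed

text \<open>
  The variation of an absolutely continuous function is absolutely continuous: nearly optimal
  divisions of the members of \<open>D\<close> together form a division of no greater total length.
\<close>

lemma ac_on_variation:
  assumes f: "ac_on {c..d} f"
  shows "ac_on {c..d} (variation f c)"
  unfolding ac_on_def
proof (intro allI impI)
  fix e :: real assume "e > 0"
  then have e2: "e / 3 > 0" by simp
  from ac_onD[OF f e2] obtain \<delta> where d':
    "\<delta> > 0 \<and> (\<forall>D U. D division_of U \<longrightarrow> U \<subseteq> {c..d} \<longrightarrow> tlen D < \<delta> \<longrightarrow> vsum f D < e / 3)"
    ..
  note d = conjunct1[OF d'] conjunct2[OF d', rule_format]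
  have "vsum (variation f c) D < e"
    if D: "D division_of U" "U \<subseteq> {c..d}" "tlen D < \<delta>" for D U
  proof -
    have fin: "finite D" using division_ofD(1)[OF D(1)] .
    define e' where "e' = e / (3 * (real (card D) + 1))"
    have e': "e' > 0" using \<open>e > 0\<close> by (simp add: e'_def)
    define Q where "Q K E W \<longleftrightarrow> E division_of W \<and> W \<subseteq> {Inf K..Sup K} \<and> variation f (Inf K) (Sup K) - e' < vsum f E"
      for K E W
    have "\<exists>E W. Q K E W" for K
      unfolding Q_def using variation_approx[OF e', of "Inf K" "Sup K" f] by simp
    then obtain E W where Q: "\<And>K. Q K (E K) (W K)" by metis
    then have EW: "\<And>K. E K division_of W K" "\<And>K. W K \<subseteq> {Inf K..Sup K}"
       "\<And>K. variation f (Inf K) (Sup K) - e' < vsum f (E K)" unfolding Q_def by blast+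
    have Wsub: "W K \<subseteq> K" if K: "K \<in> D" for K
    proof -
      obtain s t where "K = {s..t}" "s \<le> t" using division_real_memE[OF D(1) K] by blast
      then show ?thesis using EW(2)[of K] by simp
    qed
    have div: "(\<Union>K\<in>D. E K) division_of (\<Union>K\<in>D. W K)"
      and vs: "(\<Sum>K\<in>(\<Union>K\<in>D. E K). norm (f (Sup K) - f (Inf K))) = (\<Sum>K\<in>D. \<Sum>J\<in>E K. norm (f (Sup J) - f (Inf J)))"
      using division_UN[OF D(1) EW(1) Wsub, of "\<lambda>K. norm (f (Sup K) - f (Inf K))"] by simp_all
    have WU: "(\<Union>K\<in>D. W K) \<subseteq> U" using Wsub division_ofD(2)[OF D(1)] by blast
    have "measure lebesgue (\<Union>K\<in>D. W K) \<le> measure lebesgue U"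
      by (rule measure_mono_fmeasurable[OF WU]) (use lmeasurable_division[OF div] lmeasurable_division[OF D(1)] in \<open>auto intro: fmeasurableD\<close>)
    then have "tlen (\<Union>K\<in>D. E K) < \<delta>"
      using D(3) unfolding division_real_measure[OF div] division_real_measure[OF D(1)] by linarith
    then have "vsum f (\<Union>K\<in>D. E K) < e / 3" using d(2)[OF div] WU D(2) by blast
    then have *: "(\<Sum>K\<in>D. vsum f (E K)) < e / 3" unfolding vs .
    have "vsum (variation f c) D \<le> (\<Sum>K\<in>D. vsum f (E K) + e')"
    proof (rule sum_mono)
      fix K assume K: "K \<in> D"
      obtain s t where st: "K = {s..t}" "s \<le> t" using division_real_memE[OF D(1) K] by blast
      have "K \<subseteq> {c..d}" using division_ofD(2)[OF D(1) K] D(2) by blast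
      then have cd: "c \<le> s" "t \<le> d" using st by auto
      have b: "var_bounded f c t"
        by (rule var_bounded_subset[OF ac_on_var_bounded[OF f]]) (use cd st in auto)
      have bst: "var_bounded f s t" by (rule var_bounded_subset[OF b]) (use cd in auto)
      have "variation f c t \<le> variation f c s + variation f s t" "variation f c s + variation f s t \<le> variation f c t"
        using variation_subadd[OF b cd(1) st(2)] variation_superadd[OF b cd(1) st(2)] by auto
      moreover have "0 \<le> variation f s t" using abs_diff_le_variation[OF bst st(2)] by linarith
      ultimately have "\<bar>variation f c t - variation f c s\<bar> = variation f s t" by linarith
      then show "norm (variation f c (Sup K) - variation f c (Inf K)) \<le> vsum f (E K) + e'"
        using EW(3)[of K] st by simp
    qed
    also have "\<dots> = (\<Sum>K\<in>D. vsum f (E K)) + card D * e'" by (simp add: sum.distrib)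
    also have "card D * e' \<le> e / 3"
    proof -
      have "card D * e' \<le> (real (card D) + 1) * e'" using e' by simp
      also have "\<dots> = e / 3" unfolding e'_def by (simp add: add_pos_nonneg field_simps)
      finally show ?thesis .
    qed
    finally show ?thesis using * \<open>e > 0\<close> by linarith
  qed
  then show "\<exists>\<delta>>0. \<forall>D U. D division_of U \<and> U \<subseteq> {c..d} \<and> tlen D < \<delta> \<longrightarrow>
        vsum (variation f c) D < e" using d(1) by blast
qed

lemma ac_on_diff:
  assumes "ac_on A f" "ac_on A g"
  shows "ac_on A (\<lambda>x. f x - g x)"
  unfolding ac_on_def
proof (intro allI impI)
  fix e :: real assume "e > 0"
  then have e2: "e / 2 > 0" by simp
  from ac_onD[OF assms(1) e2] obtain \<delta>1 where one: "\<delta>1 > 0 \<and> (\<forall>D U. D division_of U \<longrightarrow> U \<subseteq> A \<longrightarrow>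
      tlen D < \<delta>1 \<longrightarrow> vsum f D < e / 2)" ..
  note 1 = conjunct1[OF one] conjunct2[OF one, rule_format]
  from ac_onD[OF assms(2) e2] obtain \<delta>2 where two: "\<delta>2 > 0 \<and> (\<forall>D U. D division_of U \<longrightarrow> U \<subseteq> A \<longrightarrow>
      tlen D < \<delta>2 \<longrightarrow> vsum g D < e / 2)" ..
  note 2 = conjunct1[OF two] conjunct2[OF two, rule_format]
  have "(\<Sum>K\<in>D. norm (f (Sup K) - g (Sup K) - (f (Inf K) - g (Inf K)))) < e"
    if D: "D division_of U" "U \<subseteq> A" "tlen D < min \<delta>1 \<delta>2" for D U
  proof -
    have "(\<Sum>K\<in>D. norm (f (Sup K) - g (Sup K) - (f (Inf K) - g (Inf K)))) \<le>
        (\<Sum>K\<in>D. norm (f (Sup K) - f (Inf K)) + norm (g (Sup K) - g (Inf K)))"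
    proof (rule sum_mono)
      fix K
      have "f (Sup K) - g (Sup K) - (f (Inf K) - g (Inf K)) = (f (Sup K) - f (Inf K)) - (g (Sup K) - g (Inf K))" by simp
      then show "norm (f (Sup K) - g (Sup K) - (f (Inf K) - g (Inf K))) \<le> norm (f (Sup K) - f (Inf K)) + norm (g (Sup K) - g (Inf K))"
        by (metis norm_triangle_ineq4)
    qed
    also have "\<dots> < e / 2 + e / 2"
      unfolding sum.distrib by (rule add_strict_mono) (use 1(2)[OF D(1,2)] 2(2)[OF D(1,2)] D(3) in auto)
    finally show ?thesis by simp
  qed
  moreover have "min \<delta>1 \<delta>2 > 0" using 1 2 by simp
  ultimately show "\<exists>\<delta>>0. \<forall>D U. D division_of U \<and> U \<subseteq> A \<and> tlen D < \<delta> \<longrightarrow>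
        (\<Sum>K\<in>D. norm (f (Sup K) - g (Sup K) - (f (Inf K) - g (Inf K)))) < e" by blast
qed

lemma ac_on_decompose:
  assumes f: "ac_on {c..d} (f :: real \<Rightarrow> real)"
  obtains g h where "ac_on {c..d} g" "ac_on {c..d} h" "mono_on {c..d} g" "mono_on {c..d} h" "f = (\<lambda>x. g x - h x)"
proof
  let ?V = "variation f c"
  show "ac_on {c..d} ?V" by (rule ac_on_variation[OF f])
  show "ac_on {c..d} (\<lambda>x. ?V x - f x)" by (intro ac_on_diff ac_on_variation f)
  show "f = (\<lambda>x. ?V x - (?V x - f x))" by simp
  have *: "\<bar>f y - f x\<bar> \<le> ?V y - ?V x" if "c \<le> x" "x \<le> y" "y \<le> d" for x y
  proof -
    have b: "var_bounded f c y" by (rule var_bounded_subset[OF ac_on_var_bounded[OF f]]) (use that in auto)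
    have "var_bounded f x y" by (rule var_bounded_subset[OF b]) (use that in auto)
    then show ?thesis using variation_superadd[OF b that(1,2)] abs_diff_le_variation[of f x y] that by linarith
  qed
  show "mono_on {c..d} ?V" "mono_on {c..d} (\<lambda>x. ?V x - f x)"
    using * by (force intro!: mono_onI simp: abs_le_iff)+
qed

section \<open>Densities of absolutely continuous functions\<close>

lemma AE_lebesgue_on_iff_negligible:
  assumes "I \<in> sets lebesgue"
  shows "(AE x in lebesgue_on I. P x) \<longleftrightarrow> negligible {x \<in> I. \<not> P x}"
proof -
  have *: "{x \<in> space lebesgue. \<not> (x \<in> I \<longrightarrow> P x)} = {x \<in> I. \<not> P x}" by auto
  have "(AE x in lebesgue_on I. P x) \<longleftrightarrow> (AE x in lebesgue. x \<in> I \<longrightarrow> P x)"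
    by (rule AE_restrict_space_iff) (use assms in simp)
  also have "\<dots> \<longleftrightarrow> negligible {x \<in> I. \<not> P x}"
  proof
    assume "AE x in lebesgue. x \<in> I \<longrightarrow> P x"
    then obtain N where N: "N \<in> null_sets lebesgue" "{x \<in> space lebesgue. \<not> (x \<in> I \<longrightarrow> P x)} \<subseteq> N"
      unfolding eventually_ae_filter by (elim bexE)
    show "negligible {x \<in> I. \<not> P x}"
      by (rule negligible_subset[OF _ N(2)[unfolded *]]) (use N(1) in \<open>simp add: negligible_iff_null_sets\<close>)
  next
    assume "negligible {x \<in> I. \<not> P x}"
    then show "AE x in lebesgue. x \<in> I \<longrightarrow> P x"
      unfolding negligible_iff_null_sets * [symmetric] by (intro AE_I'[of "{x \<in> space lebesgue. \<not> (x \<in> I \<longrightarrow> P x)}"]) auto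
  qed
  finally show ?thesis .
qed

lemma ac_on_imp_continuous_on:
  assumes f: "ac_on {c..d} (f :: real \<Rightarrow> 'a::real_normed_vector)"
  shows "continuous_on {c..d} f"
proof (rule uniformly_continuous_imp_continuous)
  show "uniformly_continuous_on {c..d} f"
    unfolding uniformly_continuous_on_def
  proof (intro allI impI)
    fix e :: real assume "e > 0"
    from ac_onD[OF f this] obtain \<delta> where d: "\<delta> > 0 \<and> (\<forall>D U. D division_of U \<longrightarrow> U \<subseteq> {c..d} \<longrightarrow>
      tlen D < \<delta> \<longrightarrow> vsum f D < e)" ..
    have *: "norm (f y - f x) < e" if "x \<in> {c..d}" "y \<in> {c..d}" "x \<le> y" "y - x < \<delta>" for x y
    proof -
      have "{cbox x y} division_of {x..y}" using division_of_self[of x y] that by simp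
      moreover have "{x..y} \<subseteq> {c..d}" using that by auto
      moreover have "tlen {cbox x y} < \<delta>" using that by simp
      ultimately have "vsum f {cbox x y} < e" using d by blast
      then show ?thesis using that by simp
    qed
    have "dist (f x') (f x) < e" if "x \<in> {c..d}" "x' \<in> {c..d}" "dist x' x < \<delta>" for x x'
    proof (cases "x \<le> x'")
      case True then show ?thesis using *[OF that(1,2)] that(3) by (simp add: dist_norm)
    next
      case False then show ?thesis using *[OF that(2,1)] that(3) by (simp add: dist_norm norm_minus_commute)
    qed
    then show "\<exists>\<delta>>0. \<forall>x\<in>{c..d}. \<forall>x'\<in>{c..d}. dist x' x < \<delta> \<longrightarrow> dist (f x') (f x) < e" using d by blast
  qed
qed

text \<open>
  The Stieltjes measure of an increasing absolutely continuous function has a density. By inner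
  regularity it suffices to see that it annihilates the compact Lebesgue null sets; such a set is
  covered by finitely many intervals of small total length, over which \<open>F\<close> has a small total
  increment. Then Radon--Nikodym applies.
\<close>

lemma ac_mono_has_density:
  fixes F :: "real \<Rightarrow> real"
  assumes F: "ac_on {c..d} F" "mono_on {c..d} F" and cd: "c \<le> d"
  obtains g where "\<And>t. g t \<ge> 0" "\<And>x y. c \<le> x \<Longrightarrow> x \<le> y \<Longrightarrow> y \<le> d \<Longrightarrow> (g has_integral F y - F x) {x..y}"
proof -
  \<comment> \<open>The constant extension of \<open>F\<close> to the real line.\<close>
  define G where "G x = F (max c (min d x))" for x
  have GF: "G x = F x" if "c \<le> x" "x \<le> d" for x using that by (simp add: G_def)
  have mono: "G x \<le> G y" if "x \<le> y" for x y
    unfolding G_def by (rule mono_onD[OF F(2)]) (use that cd in auto)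
  have cont: "continuous_on UNIV G"
    unfolding G_def
    by (rule continuous_on_compose2[OF ac_on_imp_continuous_on[OF F(1)]]) (use cd in \<open>auto intro!: continuous_intros\<close>)
  have rc: "continuous (at_right a) G" for a
    using cont by (simp add: continuous_on_eq_continuous_within continuous_at_imp_continuous_at_within)
  define M where "M = interval_measure G"
  have setsM[simp]: "sets M = sets borel" by (simp add: M_def)
  have spaceM[simp]: "space M = UNIV" by (simp add: M_def)
  have Ioc: "emeasure M {x<..y} = ennreal (G y - G x)" if "x \<le> y" for x y
    unfolding M_def by (rule emeasure_interval_measure_Ioc[OF that mono rc])
  have Icc: "emeasure M {x..y} = ennreal (G y - G x)" if "x \<le> y" for x y
    unfolding M_def by (rule emeasure_interval_measure_Icc[OF that mono cont])
  define M' where "M' = density M (indicator {c<..d})"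
  have setsM'[simp]: "sets M' = sets borel" by (simp add: M'_def)
  have spaceM'[simp]: "space M' = UNIV" by (simp add: M'_def)
  have M': "emeasure M' A = emeasure M ({c<..d} \<inter> A)" if "A \<in> sets borel" for A
    unfolding M'_def by (rule emeasure_restricted) (use that in auto)
  have fin: "emeasure M' (space M') \<noteq> \<infinity>" using Ioc[OF cd] by (simp add: M')
  have compact_small: "emeasure M' K \<le> ennreal e" if K: "compact K" "K \<in> null_sets lborel" and e: "e > 0" for K e
  proof -
    from ac_onD[OF F(1) e] obtain \<delta> where d: "\<delta> > 0 \<and> (\<forall>D U. D division_of U \<longrightarrow> U \<subseteq> {c..d} \<longrightarrow>
      tlen D < \<delta> \<longrightarrow> vsum F D < e)" ..
    have Knull: "K \<in> null_sets lebesgue" using K(2) by (rule null_sets_completionI)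
    then have "K \<in> sets lebesgue" by auto
    then obtain T where T: "open T" "K \<subseteq> T" "(T - K) \<in> lmeasurable" "emeasure lebesgue (T - K) < ennreal \<delta>"
      using sets_lebesgue_outer_open d by blast
    have Tm: "T \<in> lmeasurable"
    proof -
      have "T = (T - K) \<union> K" using T by auto
      moreover have "K \<in> lmeasurable" using Knull by (simp add: negligible_iff_null_sets[symmetric] negligible_imp_measurable)
      ultimately show ?thesis using T(3) by (metis fmeasurable.Un)
    qed
    have "emeasure lebesgue T = emeasure lebesgue (T - K)"
      using emeasure_Diff_null_set[OF Knull, of T] Tm by simp
    then have "ennreal (measure lebesgue T) < ennreal \<delta>"
      using T(4) Tm by (simp add: emeasure_eq_measure2)
    then have mT: "measure lebesgue T < \<delta>" by (simp add: ennreal_less_iff)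
    have "\<exists>r>0. cball x r \<subseteq> T" if "x \<in> K" for x using T(1,2) that open_contains_cball by blast
    then obtain r where r: "\<And>x. x \<in> K \<Longrightarrow> r x > 0 \<and> cball x (r x) \<subseteq> T" by metis
    have "K \<subseteq> (\<Union>x\<in>K. ball x (r x))" using r by force
    then obtain X where X: "X \<subseteq> K" "finite X" "K \<subseteq> (\<Union>x\<in>X. ball x (r x))"
      using compactE_image[OF K(1), of K "\<lambda>x. ball x (r x)"] by auto
    define Fam where "Fam = (\<lambda>x. cball x (r x) \<inter> {c..d}) ` X"
    have FamI: "\<exists>a b. s = cbox a b" if "s \<in> Fam" for s
    proof -
      obtain x where "s = cball x (r x) \<inter> {c..d}" using \<open>s \<in> Fam\<close> by (auto simp: Fam_def)
      then have "s = cbox (max (x - r x) c) (min (x + r x) d)" by (auto simp: cball_eq_atLeastAtMost)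
      then show ?thesis by blast
    qed
    have "finite Fam" using X by (simp add: Fam_def)
    then obtain D where D: "D division_of \<Union>Fam" using elementary_unions_intervals[of Fam] FamI by blast
    have sub: "\<Union>Fam \<subseteq> {c..d}" "\<Union>Fam \<subseteq> T" using r X by (auto simp: Fam_def)
    have "measure lebesgue (\<Union>Fam) \<le> measure lebesgue T"
      by (rule measure_mono_fmeasurable[OF sub(2)]) (use lmeasurable_division[OF D] Tm in \<open>auto intro: fmeasurableD\<close>)
    then have "tlen D < \<delta>" unfolding division_real_measure[OF D] using mT by simp
    then have small: "vsum F D < e" using d D sub(1) by blast
    have Kb: "K \<in> sets borel" using K(1) by (simp add: borel_compact)
    have JM: "J \<in> sets M" if "J \<in> D" for J using division_ofD(4)[OF D that] by auto
    have "emeasure M' K = emeasure M ({c<..d} \<inter> K)" by (rule M'[OF Kb])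
    also have "\<dots> \<le> emeasure M (\<Union>J\<in>D. J)"
    proof (rule emeasure_mono)
      have "{c<..d} \<inter> K \<subseteq> \<Union>Fam"
      proof
        fix x assume x: "x \<in> {c<..d} \<inter> K"
        then obtain y where "y \<in> X" "x \<in> ball y (r y)" using X by blast
        then show "x \<in> \<Union>Fam" using x by (auto simp: Fam_def intro!: bexI[of _ y])
      qed
      then show "{c<..d} \<inter> K \<subseteq> (\<Union>J\<in>D. J)" using division_ofD(6)[OF D] by simp
      show "(\<Union>J\<in>D. J) \<in> sets M" using JM division_ofD(1)[OF D] by blast
    qed
    also have "\<dots> \<le> (\<Sum>J\<in>D. emeasure M J)"
      by (rule emeasure_subadditive_finite) (use JM division_ofD(1)[OF D] in auto)
    also have "\<dots> = (\<Sum>J\<in>D. ennreal (norm (F (Sup J) - F (Inf J))))"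
    proof (rule sum.cong[OF refl])
      fix J assume J: "J \<in> D"
      then obtain s t where st: "J = {s..t}" "s \<le> t" using division_real_memE[OF D] by blast
      have "J \<subseteq> {c..d}" using division_ofD(2)[OF D J] sub(1) by blast
      then have "c \<le> s" "t \<le> d" using st by auto
      then show "emeasure M J = ennreal (norm (F (Sup J) - F (Inf J)))"
        using st Icc[OF st(2)] mono[OF st(2)] GF by simp
    qed
    also have "\<dots> = ennreal (vsum F D)" by (rule sum_ennreal) simp
    also have "\<dots> \<le> ennreal e" using small by (intro ennreal_leI) simp
    finally show ?thesis .
  qed
  have ac: "absolutely_continuous lborel M'"
    unfolding absolutely_continuous_def
  proof
    fix N :: "real set" assume N: "N \<in> null_sets lborel"
    then have Nb: "N \<in> sets borel" by auto
    have "emeasure M' K \<le> 0" if "K \<subseteq> N" "compact K" for K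
    proof -
      have "K \<in> null_sets lborel" using null_sets_subset[OF N _ that(1)] that(2) by (simp add: borel_compact)
      then have "emeasure M' K \<le> ennreal e" if "e > 0" for e using compact_small \<open>compact K\<close> that by blast
      then show ?thesis by (metis ennreal_le_epsilon add.left_neutral)
    qed
    then have "emeasure M' N \<le> 0"
      unfolding inner_regular[OF setsM' fin Nb] by (intro SUP_least) auto
    then show "N \<in> null_sets M'" using Nb by (simp add: null_sets_def)
  qed
  obtain g0 where g0: "g0 \<in> borel_measurable lborel" "density lborel g0 = M'"
    using sigma_finite_measure.Radon_Nikodym[OF sigma_finite_lborel ac] by auto
  have gm[measurable]: "g0 \<in> borel_measurable borel" using g0(1) by simp
  define g where "g t = enn2real (g0 t * indicator {c<..d} t)" for t
  have gmeas[measurable]: "g \<in> borel_measurable borel" unfolding g_def by measurable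
  have dens: "(\<integral>\<^sup>+t. g0 t * indicator A t \<partial>lborel) = emeasure M' A" if "A \<in> sets borel" for A
    using emeasure_density[OF g0(1), of A] that g0(2) by simp
  have "AE t in lborel. g0 t * indicator {c<..d} t \<noteq> \<infinity>"
    by (rule nn_integral_noteq_infinite) (use dens[of "{c<..d}"] M'[of "{c<..d}"] Ioc[OF cd] in auto)
  then have gae: "AE t in lborel. ennreal (g t) = g0 t * indicator {c<..d} t"
    by eventually_elim (simp add: g_def less_top)
  have "(g has_integral F y - F x) {x..y}" if xy: "c \<le> x" "x \<le> y" "y \<le> d" for x y
  proof -
    have le: "F x \<le> F y" using mono[OF xy(2)] xy by (simp add: GF)
    have sub: "{c<..d} \<inter> {x<..y} = {x<..y}" using xy by auto
    have "(\<integral>\<^sup>+t. ennreal (g t * indicator {x<..y} t) \<partial>lborel) = (\<integral>\<^sup>+t. g0 t * indicator {x<..y} t \<partial>lborel)"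
    proof (rule nn_integral_cong_AE)
      show "AE t in lborel. ennreal (g t * indicator {x<..y} t) = g0 t * indicator {x<..y} t"
        using gae by eventually_elim (use xy in \<open>auto simp: indicator_def\<close>)
    qed
    also have "\<dots> = ennreal (F y - F x)"
      using dens[of "{x<..y}"] M'[of "{x<..y}"] Ioc[OF xy(2)] xy by (simp add: GF sub)
    finally have "((\<lambda>t. g t * indicator {x<..y} t) has_integral (F y - F x)) UNIV"
      by (intro nn_integral_has_integral) (use le in \<open>auto simp: g_def\<close>)
    then have 1: "(g has_integral (F y - F x)) {x<..y}"
      unfolding has_integral_restrict_UNIV[of "{x<..y}" g, symmetric] by (rule has_integral_eq[rotated]) auto
    have "{t \<in> {x<..y} - {x..y}. g t \<noteq> 0} = {}" "{t \<in> {x..y} - {x<..y}. g t \<noteq> 0} \<subseteq> {x}" by auto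
    then have "negligible {t \<in> {x<..y} - {x..y}. g t \<noteq> 0}" "negligible {t \<in> {x..y} - {x<..y}. g t \<noteq> 0}"
      by (simp_all only: negligible_empty negligible_subset[OF negligible_sing])
    from has_integral_spike_set_eq[OF this] show ?thesis using 1 by simp
  qed
  moreover have "g t \<ge> 0" for t by (simp add: g_def)
  ultimately show thesis using that by blast
qed

lemma ac_has_density_real:
  fixes f :: "real \<Rightarrow> real"
  assumes f: "ac_on {c..d} f" and cd: "c \<le> d"
  obtains g where "g absolutely_integrable_on {c..d}"
    "\<And>x y. c \<le> x \<Longrightarrow> x \<le> y \<Longrightarrow> y \<le> d \<Longrightarrow> (g has_integral f y - f x) {x..y}"
proof -
  obtain f1 f2 where F: "ac_on {c..d} f1" "ac_on {c..d} f2" "mono_on {c..d} f1" "mono_on {c..d} f2" "f = (\<lambda>x. f1 x - f2 x)"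
    by (rule ac_on_decompose[OF f])
  obtain g1 where g1: "\<And>t. g1 t \<ge> 0" "\<And>x y. c \<le> x \<Longrightarrow> x \<le> y \<Longrightarrow> y \<le> d \<Longrightarrow> (g1 has_integral f1 y - f1 x) {x..y}"
    using ac_mono_has_density[OF F(1,3) cd] by metis
  obtain g2 where g2: "\<And>t. g2 t \<ge> 0" "\<And>x y. c \<le> x \<Longrightarrow> x \<le> y \<Longrightarrow> y \<le> d \<Longrightarrow> (g2 has_integral f2 y - f2 x) {x..y}"
    using ac_mono_has_density[OF F(2,4) cd] by metis
  show thesis
  proof
    have "g1 absolutely_integrable_on {c..d}" "g2 absolutely_integrable_on {c..d}"
      using g1(1) g1(2)[of c d] g2(1) g2(2)[of c d] cd
      by (auto intro!: nonnegative_absolutely_integrable_1 has_integral_integrable)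
    then show "(\<lambda>x. g1 x - g2 x) absolutely_integrable_on {c..d}" by (rule set_integral_diff)
    show "((\<lambda>x. g1 x - g2 x) has_integral f y - f x) {x..y}" if "c \<le> x" "x \<le> y" "y \<le> d" for x y
      using has_integral_diff[OF g1(2)[OF that] g2(2)[OF that]] unfolding F(5) by (simp add: algebra_simps)
  qed
qed

lemma ac_has_density:
  fixes f :: "real \<Rightarrow> 'a::euclidean_space"
  assumes f: "ac_on {c..d} f" and cd: "c \<le> d"
  obtains g where "g absolutely_integrable_on {c..d}"
    "\<And>x y. c \<le> x \<Longrightarrow> x \<le> y \<Longrightarrow> y \<le> d \<Longrightarrow> (g has_integral f y - f x) {x..y}"
proof -
  have ac: "ac_on {c..d} (\<lambda>x. f x \<bullet> b)" if "b \<in> Basis" for b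
    unfolding ac_on_def
  proof (intro allI impI)
    fix e :: real assume "e > 0"
    from ac_onD[OF f this] obtain \<delta> where d: "\<delta> > 0 \<and> (\<forall>D U. D division_of U \<longrightarrow> U \<subseteq> {c..d} \<longrightarrow>
      tlen D < \<delta> \<longrightarrow> vsum f D < e)" ..
    have "(\<Sum>K\<in>D. norm (f (Sup K) \<bullet> b - f (Inf K) \<bullet> b)) \<le> vsum f D" for D
      by (intro sum_mono) (metis inner_diff_left Basis_le_norm[OF that] real_norm_def)
    then show "\<exists>\<delta>>0. \<forall>D U. D division_of U \<and> U \<subseteq> {c..d} \<and> tlen D < \<delta> \<longrightarrow>
        (\<Sum>K\<in>D. norm (f (Sup K) \<bullet> b - f (Inf K) \<bullet> b)) < e"
      using d by (meson le_less_trans)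
  qed
  define Q where "Q b g \<longleftrightarrow> g absolutely_integrable_on {c..d} \<and>
    (\<forall>x y. c \<le> x \<longrightarrow> x \<le> y \<longrightarrow> y \<le> d \<longrightarrow> (g has_integral (f y \<bullet> b - f x \<bullet> b)) {x..y})" for b g
  have "\<exists>g. Q b g" if b: "b \<in> Basis" for b
  proof -
    obtain g where "g absolutely_integrable_on {c..d}"
      "\<And>x y. c \<le> x \<Longrightarrow> x \<le> y \<Longrightarrow> y \<le> d \<Longrightarrow> (g has_integral f y \<bullet> b - f x \<bullet> b) {x..y}"
      using ac_has_density_real[OF ac[OF b] cd] by metis
    then show ?thesis unfolding Q_def by blast
  qed
  then obtain g where g: "\<And>b. b \<in> Basis \<Longrightarrow> Q b (g b)" by metis
  define G where "G t = (\<Sum>b\<in>Basis. g b t *\<^sub>R b)" for t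
  have Gb: "G t \<bullet> b = g b t" if "b \<in> Basis" for t b
    unfolding G_def using that by (simp add: inner_sum_left_Basis)
  show thesis
  proof (rule that[of G])
    show "G absolutely_integrable_on {c..d}"
    proof (rule absolutely_integrable_componentwise)
      fix b :: 'a assume "b \<in> Basis"
      then show "(\<lambda>x. G x \<bullet> b) absolutely_integrable_on {c..d}" using g by (simp add: Gb Q_def)
    qed
    show "(G has_integral f y - f x) {x..y}" if "c \<le> x" "x \<le> y" "y \<le> d" for x y
    proof (subst has_integral_componentwise_iff, intro ballI)
      fix b :: 'a assume "b \<in> Basis"
      then show "((\<lambda>x. G x \<bullet> b) has_integral (f y - f x) \<bullet> b) {x..y}" using g that by (simp add: Gb Q_def inner_diff_left)
    qed
  qed
qed


section \<open>Primitives of locally integrable functions\<close>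

text \<open>
  \<open>f\<close> is a primitive of the locally integrable function \<open>g\<close> on \<open>I\<close>. All statements about
  differential equations are phrased by this relation. On an open set it holds for some \<open>g\<close> if and
  only if \<open>f\<close> is locally absolutely continuous, and then \<open>g\<close> is the derivative of \<open>f\<close> almost
  everywhere.
\<close>

definition primitive :: "real set \<Rightarrow> (real \<Rightarrow> 'a::euclidean_space) \<Rightarrow> (real \<Rightarrow> 'a) \<Rightarrow> bool" where
  "primitive I f g \<longleftrightarrow> (\<forall>x y. x \<le> y \<longrightarrow> {x..y} \<subseteq> I \<longrightarrow>
     g absolutely_integrable_on {x..y} \<and> (g has_integral (f y - f x)) {x..y})"

lemma primitiveI:
  assumes "\<And>x y. x \<le> y \<Longrightarrow> {x..y} \<subseteq> I \<Longrightarrow> g absolutely_integrable_on {x..y}"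
    and "\<And>x y. x \<le> y \<Longrightarrow> {x..y} \<subseteq> I \<Longrightarrow> (g has_integral (f y - f x)) {x..y}"
  shows "primitive I f g"
  unfolding primitive_def by (intro allI impI conjI assms)

lemma primitiveD:
  assumes "primitive I f g" "x \<le> y" "{x..y} \<subseteq> I"
  shows "g absolutely_integrable_on {x..y}" "(g has_integral (f y - f x)) {x..y}"
proof -
  note * = assms(1)[unfolded primitive_def, THEN spec, THEN spec, THEN mp, THEN mp, OF assms(2,3)]
  show "g absolutely_integrable_on {x..y}" using * by (rule conjunct1)
  show "(g has_integral (f y - f x)) {x..y}" using * by (rule conjunct2)
qed

lemma open_covering_rationals:
  assumes "open I" "x \<in> (I :: real set)"
  obtains c d where "c \<in> \<rat>" "d \<in> \<rat>" "c < x" "x < d" "{c..d} \<subseteq> I"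
proof -
  obtain e where e: "e > 0" "cball x e \<subseteq> I" using assms open_contains_cball by blast
  obtain c where c: "c \<in> \<rat>" "x - e < c" "c < x" using Rats_dense_in_real[of "x - e" x] e by auto
  obtain d where d: "d \<in> \<rat>" "x < d" "d < x + e" using Rats_dense_in_real[of x "x + e"] e by auto
  have "{c..d} \<subseteq> cball x e" using c d by (auto simp: dist_real_def)
  then show thesis using that c d e by blast
qed

text \<open>
  An almost everywhere statement on an open set may be checked on the countably many compact
  subintervals with rational end points.
\<close>

lemma AE_on_open_localI:
  fixes I :: "real set"
  assumes I: "open I" and loc: "\<And>c d. c < d \<Longrightarrow> {c..d} \<subseteq> I \<Longrightarrow> negligible {x \<in> {c<..<d}. \<not> P x}"
  shows "AE x in lebesgue_on I. P x"
proof -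
  define Z where "Z = {(c, d). c \<in> \<rat> \<and> d \<in> \<rat> \<and> c < d \<and> {c..d} \<subseteq> I}"
  have "countable Z" by (rule countable_subset[of _ "\<rat> \<times> \<rat>"]) (auto simp: Z_def countable_rat)
  then have "negligible (\<Union>((\<lambda>(c, d). {x \<in> {c<..<d}. \<not> P x}) ` Z))"
    using loc by (intro negligible_countable_Union) (auto simp: Z_def)
  moreover have "{x \<in> I. \<not> P x} \<subseteq> \<Union>((\<lambda>(c, d). {x \<in> {c<..<d}. \<not> P x}) ` Z)"
  proof
    fix x assume x: "x \<in> {x \<in> I. \<not> P x}"
    then obtain c d where "c \<in> \<rat>" "d \<in> \<rat>" "c < x" "x < d" "{c..d} \<subseteq> I"
      using open_covering_rationals[OF I] by blast
    then have "(c, d) \<in> Z" "x \<in> {x \<in> {c<..<d}. \<not> P x}" using x by (auto simp: Z_def)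
    then show "x \<in> \<Union>((\<lambda>(c, d). {x \<in> {c<..<d}. \<not> P x}) ` Z)" by force
  qed
  ultimately have "negligible {x \<in> I. \<not> P x}" by (rule negligible_subset)
  moreover have "I \<in> sets lebesgue" using I by auto
  ultimately show ?thesis by (simp add: AE_lebesgue_on_iff_negligible)
qed

lemma primitive_has_vector_derivative:
  assumes I: "open I" and f: "primitive I f g"
  shows "AE x in lebesgue_on I. (f has_vector_derivative g x) (at x)"
proof (rule AE_on_open_localI[OF I])
  fix c d :: real assume cd: "c < d" "{c..d} \<subseteq> I"
  have int: "g integrable_on {c..d}" using primitiveD(2)[OF f _ cd(2)] cd(1) by (auto simp: has_integral_integrable)
  have fx: "f x = f c + integral {c..x} g" if "x \<in> {c<..<d}" for x
  proof -
    have "{c..x} \<subseteq> I" using that cd by auto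
    then have "(g has_integral (f x - f c)) {c..x}" using primitiveD(2)[OF f, of c x] that by auto
    then show ?thesis by (simp add: integral_unique)
  qed
  show "negligible {x \<in> {c<..<d}. \<not> (f has_vector_derivative g x) (at x)}"
  proof (rule negligible_subset[OF lebesgue_differentiation[OF int]], rule subsetI, rule ccontr)
    fix x assume x: "x \<in> {x \<in> {c<..<d}. \<not> (f has_vector_derivative g x) (at x)}"
      and "x \<notin> {x \<in> {c<..<d}. \<not> ((\<lambda>x. integral {c..x} g) has_vector_derivative g x) (at x)}"
    then have *: "x \<in> {c<..<d}" "((\<lambda>x. integral {c..x} g) has_vector_derivative g x) (at x)" by auto
    have "((\<lambda>x. f c + integral {c..x} g) has_vector_derivative g x) (at x)"
      using has_vector_derivative_add[OF has_vector_derivative_const *(2), of "f c"] by simp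
    then have "(f has_vector_derivative g x) (at x)"
      by (rule has_vector_derivative_transform_within_open[where S = "{c<..<d}"]) (use *(1) fx in auto)
    with x show False by simp
  qed
qed

text \<open>
  Absolute continuity of the integral. The integrand is bounded by the constant \<open>n\<close> up to a
  function \<open>\<phi>\<close> whose integral over the whole interval is small.
\<close>

lemma primitive_ac:
  fixes g :: "real \<Rightarrow> 'a::euclidean_space"
  assumes f: "primitive I f g" and cd: "{c..d} \<subseteq> I"
  shows "ac_on {c..d} f"
proof (cases "c \<le> d")
  case False
  then have "{c..d} = {}" by simp
  then have "\<And>D U. D division_of U \<and> U \<subseteq> {c..d} \<Longrightarrow> D = {}" using division_of_trivial by auto
  then show ?thesis unfolding ac_on_def by (metis sum.empty)
next
  case True
  have ai: "g absolutely_integrable_on {c..d}" by (rule primitiveD[OF f True cd])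
  define h where "h t = norm (g t)" for t
  have h: "h integrable_on {c..d}" using ai unfolding absolutely_integrable_on_def h_def by simp
  have hai: "h absolutely_integrable_on {c..d}" by (rule nonnegative_absolutely_integrable_1[OF h]) (simp add: h_def)
  have hn: "(\<lambda>t. min (h t) (real n)) integrable_on {c..d}" for n
  proof -
    have "(\<lambda>t. real n) absolutely_integrable_on {c..d}" using integrable_const_ivl[of "real n" c d] by (simp add: absolutely_integrable_on_def)
    from absolutely_integrable_min[OF hai this] have "(\<lambda>t. min (h t) (real n)) absolutely_integrable_on {c..d}" by simp
    then show ?thesis by (rule set_lebesgue_integral_eq_integral(1))
  qed
  show ?thesis unfolding ac_on_def
  proof (intro allI impI)
    fix e :: real assume e: "e > 0"
    have "(\<lambda>n. integral {c..d} (\<lambda>t. min (h t) (real n))) \<longlonglongrightarrow> integral {c..d} h"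
    proof (rule dominated_convergence(2)[OF hn h])
      show "norm (min (h t) (real n)) \<le> h t" if "t \<in> {c..d}" for n t by (simp add: h_def)
      show "(\<lambda>n. min (h t) (real n)) \<longlonglongrightarrow> h t" if "t \<in> {c..d}" for t
      proof (rule tendsto_eventually)
        obtain N :: nat where "h t \<le> real N" using real_arch_simple by blast
        then have "min (h t) (real n) = h t" if "n \<ge> N" for n using that by (simp add: min_def)
        then show "\<forall>\<^sub>F n in sequentially. min (h t) (real n) = h t" unfolding eventually_sequentially by blast
      qed
    qed
    then obtain n where "norm (integral {c..d} (\<lambda>t. min (h t) (real n)) - integral {c..d} h) < e / 2"
      using LIMSEQ_D[of _ _ "e / 2"] e by (metis half_gt_zero order_refl)
    then have n: "integral {c..d} h - integral {c..d} (\<lambda>t. min (h t) (real n)) < e / 2"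
      unfolding real_norm_def by linarith
    define \<phi> where "\<phi> t = h t - min (h t) (real n)" for t
    have \<phi>: "\<phi> integrable_on {c..d}" unfolding \<phi>_def by (rule integrable_diff[OF h hn])
    have \<phi>small: "integral {c..d} \<phi> < e / 2" using n unfolding \<phi>_def by (simp add: Henstock_Kurzweil_Integration.integral_diff[OF h hn])
    define \<delta> where "\<delta> = e / (2 * (real n + 1))"
    have "\<delta> > 0" using e by (simp add: \<delta>_def)
    moreover have "vsum f D < e"
      if D: "D division_of U" "U \<subseteq> {c..d}" "tlen D < \<delta>" for D U
    proof -
      have sub: "K \<subseteq> {c..d}" if "K \<in> D" for K using division_ofD(2)[OF D(1) that] D(2) by blast
      have on: "\<phi> integrable_on K" if K: "K \<in> D" for K
      proof -
        obtain s t where "K = {s..t}" using division_real_memE[OF D(1) K] by blast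
        then show ?thesis using integrable_subinterval_real[OF \<phi>] sub[OF K] by simp
      qed
      have "vsum f D \<le> (\<Sum>K\<in>D. integral K \<phi> + real n * (Sup K - Inf K))"
      proof (rule sum_mono)
        fix K assume K: "K \<in> D"
        obtain s t where st: "K = {s..t}" "s \<le> t" using division_real_memE[OF D(1) K] by blast
        have stI: "{s..t} \<subseteq> I" using sub[OF K] st cd by blast
        have gst: "g absolutely_integrable_on {s..t}" "(g has_integral (f t - f s)) {s..t}" using primitiveD[OF f st(2) stI] by auto
        have hst: "h integrable_on {s..t}" using gst(1) unfolding absolutely_integrable_on_def h_def by simp
        have "norm (f t - f s) = norm (integral {s..t} g)" using gst(2) by (simp add: integral_unique)
        also have "\<dots> \<le> integral {s..t} h"
          by (rule integral_norm_bound_integral) (use gst(1) hst in \<open>auto simp: h_def absolutely_integrable_on_def\<close>)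
        also have "\<dots> \<le> integral {s..t} (\<lambda>x. \<phi> x + real n)"
        proof (rule integral_le[OF hst])
          show "(\<lambda>x. \<phi> x + real n) integrable_on {s..t}"
            using on[OF K] st by (intro integrable_add integrable_const_ivl) simp
        qed (simp add: \<phi>_def)
        also have "\<dots> = integral {s..t} \<phi> + real n * (t - s)"
          using on[OF K] st by (subst Henstock_Kurzweil_Integration.integral_add) auto
        finally show "norm (f (Sup K) - f (Inf K)) \<le> integral K \<phi> + real n * (Sup K - Inf K)" using st by simp
      qed
      also have "\<dots> = integral U \<phi> + real n * tlen D"
        unfolding sum.distrib sum_distrib_left[symmetric]
        using integral_combine_division_bottomup[OF D(1) on] by simp
      also have "integral U \<phi> \<le> integral {c..d} \<phi>"
        by (rule integral_subset_le[OF D(2) _ \<phi>])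
          (use integrable_combine_division[OF D(1) on] in \<open>auto simp: \<phi>_def\<close>)
      also have "real n * tlen D \<le> real n * \<delta>" using D(3) by (intro mult_left_mono) auto
      also have "\<dots> \<le> (real n + 1) * \<delta>" using \<open>\<delta> > 0\<close> by simp
      also have "(real n + 1) * \<delta> = e / 2" unfolding \<delta>_def by (simp add: field_simps)
      finally show ?thesis using \<phi>small by simp
    qed
    ultimately show "\<exists>\<delta>>0. \<forall>D U. D division_of U \<and> U \<subseteq> {c..d} \<and> tlen D < \<delta> \<longrightarrow>
        vsum f D < e" by blast
  qed
qed

lemma primitive_continuous_on:
  assumes "open I" "primitive I f g"
  shows "continuous_on I f"
proof (rule continuous_at_imp_continuous_on, rule ballI)
  fix x assume "x \<in> I"
  then obtain c d where cd: "c < x" "x < d" "{c..d} \<subseteq> I" using open_covering_rationals[OF assms(1)] by metis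
  have "continuous_on {c<..<d} f"
    by (rule continuous_on_subset[OF ac_on_imp_continuous_on[OF primitive_ac[OF assms(2) cd(3)]]]) auto
  then show "isCont f x" using cd by (simp add: continuous_on_eq_continuous_at)
qed

text \<open>
  The fundamental theorem for absolutely continuous functions: the density is the derivative almost
  everywhere by Lebesgue's differentiation theorem.
\<close>

lemma ac_primitive:
  fixes f :: "real \<Rightarrow> 'a::euclidean_space"
  assumes I: "open I" and ac: "\<And>c d. {c..d} \<subseteq> I \<Longrightarrow> ac_on {c..d} f"
  shows "AE x in lebesgue_on I. (f has_vector_derivative vector_derivative f (at x)) (at x)"
    and "primitive I f (\<lambda>x. vector_derivative f (at x))"
proof -
  let ?f' = "\<lambda>x. vector_derivative f (at x)"
  have *: "negligible {x \<in> {c<..<d}. \<not> (f has_vector_derivative ?f' x) (at x)} \<and>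
       ?f' absolutely_integrable_on {c..d} \<and> (?f' has_integral (f d - f c)) {c..d}"
    if cd: "c \<le> d" "{c..d} \<subseteq> I" for c d
  proof -
    obtain g where g: "g absolutely_integrable_on {c..d}"
      "\<And>x y. c \<le> x \<Longrightarrow> x \<le> y \<Longrightarrow> y \<le> d \<Longrightarrow> (g has_integral f y - f x) {x..y}"
      using ac_has_density[OF ac[OF cd(2)] cd(1)] by metis
    have "primitive {c<..<d} f g"
    proof (rule primitiveI)
      fix x y assume xy: "x \<le> y" "{x..y} \<subseteq> {c<..<d}"
      then have "c \<le> x" "y \<le> d" by auto
      then show "(g has_integral f y - f x) {x..y}" using g(2) xy by blast
      show "g absolutely_integrable_on {x..y}"
        by (rule absolutely_integrable_on_subinterval[OF g(1)]) (use \<open>c \<le> x\<close> \<open>y \<le> d\<close> in auto)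
    qed
    from primitive_has_vector_derivative[OF _ this]
    have neg: "negligible {x \<in> {c<..<d}. \<not> (f has_vector_derivative g x) (at x)}" by (simp add: AE_lebesgue_on_iff_negligible)
    have eq: "?f' x = g x" if "(f has_vector_derivative g x) (at x)" for x
      using that by (rule vector_derivative_at)
    have 1: "negligible {x \<in> {c<..<d}. \<not> (f has_vector_derivative ?f' x) (at x)}"
      by (rule negligible_subset[OF neg]) (use eq in auto)
    define S where "S = {c, d} \<union> {x \<in> {c<..<d}. \<not> (f has_vector_derivative g x) (at x)}"
    have S: "negligible S" unfolding S_def using neg by (intro negligible_Un) auto
    have Seq: "?f' x = g x" if "x \<in> {c..d} - S" for x using that eq unfolding S_def by force
    have "?f' absolutely_integrable_on {c..d}"
      by (rule absolutely_integrable_spike[OF g(1) S Seq])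
    moreover have "(?f' has_integral (f d - f c)) {c..d}"
      by (rule has_integral_spike[OF S Seq g(2)]) (use cd in auto)
    ultimately show ?thesis using 1 by blast
  qed
  show "AE x in lebesgue_on I. (f has_vector_derivative ?f' x) (at x)"
    by (rule AE_on_open_localI[OF I]) (use * in auto)
  show "primitive I f ?f'" using * by (intro primitiveI) blast+
qed

lemma primitive_spike:
  assumes I: "open I" and f: "primitive I f g" and eq: "AE x in lebesgue_on I. g x = h x"
  shows "primitive I f h"
proof -
  define S where "S = {x \<in> I. g x \<noteq> h x}"
  have "I \<in> sets lebesgue" using I by auto
  then have S: "negligible S" using eq unfolding S_def by (simp add: AE_lebesgue_on_iff_negligible)
  show ?thesis
  proof (rule primitiveI)
    fix x y assume xy: "x \<le> y" "{x..y} \<subseteq> I"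
    have e: "h t = g t" if "t \<in> {x..y} - S" for t using that xy unfolding S_def by auto
    show "h absolutely_integrable_on {x..y}" by (rule absolutely_integrable_spike[OF primitiveD(1)[OF f xy] S e])
    show "(h has_integral f y - f x) {x..y}" by (rule has_integral_spike[OF S e primitiveD(2)[OF f xy]])
  qed
qed

lemma primitive_unique:
  assumes I: "open I" and "primitive I f g" "primitive I f h"
  shows "AE x in lebesgue_on I. g x = h x"
  using primitive_has_vector_derivative[OF I assms(2)] primitive_has_vector_derivative[OF I assms(3)]
  by eventually_elim (metis vector_derivative_at)

lemma primitive_vector_derivative:
  assumes "open I" "primitive I f g"
  shows "AE x in lebesgue_on I. vector_derivative f (at x) = g x"
  using primitive_has_vector_derivative[OF assms] by eventually_elim (rule vector_derivative_at)

lemma primitive_cong: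
  assumes "primitive I f g" "\<And>x. x \<in> I \<Longrightarrow> f x = f' x" "\<And>x. x \<in> I \<Longrightarrow> g x = g' x"
  shows "primitive I f' g'"
proof (rule primitiveI)
  fix x y assume xy: "x \<le> y" "{x..y} \<subseteq> I"
  have e: "g t = g' t" if "t \<in> {x..y}" for t using assms(3) that xy by auto
  show "g' absolutely_integrable_on {x..y}"
    using absolutely_integrable_spike[OF primitiveD(1)[OF assms(1) xy] negligible_empty, of g'] e by simp
  have "x \<in> I" "y \<in> I" using xy by auto
  then have "f y - f x = f' y - f' x" using assms(2) by simp
  then show "(g' has_integral f' y - f' x) {x..y}"
    using has_integral_eq[of "{x..y}" g g'] e primitiveD(2)[OF assms(1) xy] by simp
qed

lemma primitive_linear:
  fixes f1 f2 :: "real \<Rightarrow> 'a::{euclidean_space,real_normed_field}"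
  assumes "primitive I f1 g1" "primitive I f2 g2"
  shows "primitive I (\<lambda>x. a * f1 x + b * f2 x) (\<lambda>x. a * g1 x + b * g2 x)"
proof (rule primitiveI)
  fix x y assume xy: "x \<le> y" "{x..y} \<subseteq> I"
  note 1 = primitiveD[OF assms(1) xy] and 2 = primitiveD[OF assms(2) xy]
  show "(\<lambda>x. a * g1 x + b * g2 x) absolutely_integrable_on {x..y}"
    using 1 2 by (intro set_integral_add set_integrable_mult_right)
  have "((\<lambda>x. a * g1 x + b * g2 x) has_integral a * (f1 y - f1 x) + b * (f2 y - f2 x)) {x..y}"
    using 1 2 by (intro has_integral_add has_integral_mult_right)
  then show "((\<lambda>x. a * g1 x + b * g2 x) has_integral a * f1 y + b * f2 y - (a * f1 x + b * f2 x)) {x..y}"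
    by (simp add: algebra_simps)
qed

lemma ac_on_mult:
  fixes f g :: "real \<Rightarrow> 'a::real_normed_algebra"
  assumes f: "ac_on {c..d} f" and g: "ac_on {c..d} g"
  shows "ac_on {c..d} (\<lambda>x. f x * g x)"
proof -
  have "bounded (f ` {c..d})" "bounded (g ` {c..d})"
    using ac_on_imp_continuous_on[OF f] ac_on_imp_continuous_on[OF g]
    by (auto intro!: compact_imp_bounded compact_continuous_image)
  then obtain A B where "\<And>x. x \<in> {c..d} \<Longrightarrow> norm (f x) \<le> A" "\<And>x. x \<in> {c..d} \<Longrightarrow> norm (g x) \<le> B"
    unfolding bounded_iff by (metis image_eqI)
  then obtain C where C: "C > 0" "\<And>x. x \<in> {c..d} \<Longrightarrow> norm (f x) \<le> C" "\<And>x. x \<in> {c..d} \<Longrightarrow> norm (g x) \<le> C"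
    by (metis max.coboundedI1 max.coboundedI2 max.strict_coboundedI1 zero_less_one)
  show ?thesis unfolding ac_on_def
  proof (intro allI impI)
    fix e :: real assume "e > 0"
    then have e2: "e / (2 * C) > 0" using C by simp
    from ac_onD[OF f e2] obtain \<delta>1 where one: "\<delta>1 > 0 \<and> (\<forall>D U. D division_of U \<longrightarrow> U \<subseteq> {c..d} \<longrightarrow>
      tlen D < \<delta>1 \<longrightarrow> vsum f D < e / (2 * C))" ..
    from ac_onD[OF g e2] obtain \<delta>2 where two: "\<delta>2 > 0 \<and> (\<forall>D U. D division_of U \<longrightarrow> U \<subseteq> {c..d} \<longrightarrow>
      tlen D < \<delta>2 \<longrightarrow> vsum g D < e / (2 * C))" ..
    have "(\<Sum>K\<in>D. norm (f (Sup K) * g (Sup K) - f (Inf K) * g (Inf K))) < e"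
      if D: "D division_of U" "U \<subseteq> {c..d}" "tlen D < min \<delta>1 \<delta>2" for D U
    proof -
      have "(\<Sum>K\<in>D. norm (f (Sup K) * g (Sup K) - f (Inf K) * g (Inf K))) \<le>
          (\<Sum>K\<in>D. C * norm (g (Sup K) - g (Inf K)) + C * norm (f (Sup K) - f (Inf K)))"
      proof (rule sum_mono)
        fix K assume K: "K \<in> D"
        obtain s t where st: "K = {s..t}" "s \<le> t" using division_real_memE[OF D(1) K] by blast
        have "K \<subseteq> {c..d}" using division_ofD(2)[OF D(1) K] D(2) by blast
        then have cd: "s \<in> {c..d}" "t \<in> {c..d}" using st by auto
        have "f t * g t - f s * g s = f t * (g t - g s) + (f t - f s) * g s" by (simp add: algebra_simps)
        then have "norm (f t * g t - f s * g s) \<le> norm (f t) * norm (g t - g s) + norm (f t - f s) * norm (g s)"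
          by (metis norm_triangle_le add_mono norm_mult_ineq)
        also have "\<dots> \<le> C * norm (g t - g s) + norm (f t - f s) * C"
          using C cd by (intro add_mono mult_left_mono mult_right_mono) auto
        finally show "norm (f (Sup K) * g (Sup K) - f (Inf K) * g (Inf K)) \<le>
          C * norm (g (Sup K) - g (Inf K)) + C * norm (f (Sup K) - f (Inf K))" using st by (simp add: mult.commute)
      qed
      also have "\<dots> = C * vsum g D + C * vsum f D"
        by (simp add: sum.distrib sum_distrib_left)
      also have "\<dots> < C * (e / (2 * C)) + C * (e / (2 * C))"
        using one two D C by (intro add_strict_mono mult_strict_left_mono) auto
      also have "\<dots> = e" using C by (simp add: field_simps)
      finally show ?thesis .
    qed
    moreover have "min \<delta>1 \<delta>2 > 0" using one two by simp
    ultimately show "\<exists>\<delta>>0. \<forall>D U. D division_of U \<and> U \<subseteq> {c..d} \<and> tlen D < \<delta> \<longrightarrow>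
        (\<Sum>K\<in>D. norm (f (Sup K) * g (Sup K) - f (Inf K) * g (Inf K))) < e" by blast
  qed
qed

lemma primitive_mult:
  fixes f g :: "real \<Rightarrow> 'a::{euclidean_space,real_normed_field}"
  assumes I: "open I" and f: "primitive I f f'" and g: "primitive I g g'"
  shows "primitive I (\<lambda>x. f x * g x) (\<lambda>x. f x * g' x + f' x * g x)"
proof (rule primitive_spike[OF I])
  show "primitive I (\<lambda>x. f x * g x) (\<lambda>x. vector_derivative (\<lambda>x. f x * g x) (at x))"
    by (rule ac_primitive[OF I]) (intro ac_on_mult primitive_ac[OF f] primitive_ac[OF g])
  show "AE x in lebesgue_on I. vector_derivative (\<lambda>x. f x * g x) (at x) = f x * g' x + f' x * g x"
    using primitive_has_vector_derivative[OF I f] primitive_has_vector_derivative[OF I g]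
    by eventually_elim (intro vector_derivative_at has_vector_derivative_mult)
qed

section \<open>Linear systems with locally integrable coefficients\<close>

text \<open>
  Integrability over the compact subintervals of \<open>I\<close>.
\<close>

definition loc_int :: "real set \<Rightarrow> (real \<Rightarrow> 'a::euclidean_space) \<Rightarrow> bool" where
  "loc_int I g \<longleftrightarrow> (\<forall>x y. {x..y} \<subseteq> I \<longrightarrow> g absolutely_integrable_on {x..y})"

lemma loc_intD: "loc_int I g \<Longrightarrow> {x..y} \<subseteq> I \<Longrightarrow> g absolutely_integrable_on {x..y}"
  unfolding loc_int_def by blast

lemma loc_int_mult_continuous:
  fixes f g :: "real \<Rightarrow> 'a::{euclidean_space,real_normed_field}"
  assumes g: "loc_int I g" and f: "continuous_on I f"
  shows "loc_int I (\<lambda>x. g x * f x)"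
  unfolding loc_int_def
proof (intro allI impI)
  fix x y assume xy: "{x..y} \<subseteq> I"
  have c: "continuous_on {x..y} f" by (rule continuous_on_subset[OF f xy])
  show "(\<lambda>x. g x * f x) absolutely_integrable_on {x..y}"
  proof (subst mult.commute, rule absolutely_integrable_bounded_measurable_product[where h = "(*)"])
    show "bilinear ((*) :: 'a \<Rightarrow> 'a \<Rightarrow> 'a)" by (simp add: bilinear_conv_bounded_bilinear bounded_bilinear_mult)
    show "f \<in> borel_measurable (lebesgue_on {x..y})" by (rule continuous_imp_measurable_on_sets_lebesgue[OF c]) simp
    show "bounded (f ` {x..y})" by (intro compact_imp_bounded compact_continuous_image c) simp
  qed (use loc_intD[OF g xy] in auto)
qed

lemma is_interval_Icc_subset:
  fixes s t :: real
  assumes "is_interval I" "s \<in> I" "t \<in> I"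
  shows "{s..t} \<subseteq> I"
proof
  fix x assume "x \<in> {s..t}"
  then show "x \<in> I" using mem_is_interval_1_I[OF assms] by simp
qed

text \<open>
  The primitive that vanishes at \<open>c\<close>.
\<close>

definition base_integral :: "real \<Rightarrow> (real \<Rightarrow> 'a::euclidean_space) \<Rightarrow> real \<Rightarrow> 'a" where
  "base_integral c g x = (if c \<le> x then integral {c..x} g else - integral {x..c} g)"

lemma base_integral_self [simp]: "base_integral c g c = 0"
  by (simp add: base_integral_def)

lemma primitive_base_integral:
  fixes g :: "real \<Rightarrow> 'a::euclidean_space"
  assumes I: "is_interval I" "c \<in> I" and g: "loc_int I g"
  shows "primitive I (base_integral c g) g"
proof (rule primitiveI)
  fix x y assume xy: "x \<le> y" "{x..y} \<subseteq> I"
  show ai: "g absolutely_integrable_on {x..y}" by (rule loc_intD[OF g xy(2)])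
  have xI: "x \<in> I" "y \<in> I" using xy by auto
  have sub: "{s..t} \<subseteq> I" if "s \<in> I" "t \<in> I" for s t
    by (rule is_interval_Icc_subset[OF I(1) that])
  have int: "g integrable_on {s..t}" if "s \<in> I" "t \<in> I" for s t
    using loc_intD[OF g sub[OF that]] by (rule set_lebesgue_integral_eq_integral(1))
  have "base_integral c g y - base_integral c g x = integral {x..y} g"
  proof -
    consider "c \<le> x" | "x < c" "c \<le> y" | "y < c" using xy by linarith
    then show ?thesis
    proof cases
      case 1
      then have "integral {c..x} g + integral {x..y} g = integral {c..y} g"
        by (intro Henstock_Kurzweil_Integration.integral_combine int) (use xy I xI in auto)
      then show ?thesis using 1 xy by (simp add: base_integral_def algebra_simps)
    next
      case 2
      then have "integral {x..c} g + integral {c..y} g = integral {x..y} g"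
        by (intro Henstock_Kurzweil_Integration.integral_combine int) (use xy I xI in auto)
      then show ?thesis using 2 xy by (simp add: base_integral_def algebra_simps)
    next
      case 3
      then have "integral {x..y} g + integral {y..c} g = integral {x..c} g"
        by (intro Henstock_Kurzweil_Integration.integral_combine int) (use xy I xI in auto)
      then show ?thesis using 3 xy by (simp add: base_integral_def algebra_simps)
    qed
  qed
  then show "(g has_integral base_integral c g y - base_integral c g x) {x..y}"
    using integrable_integral[OF int[OF xI]] by simp
qed

lemma primitive_power:
  fixes m :: "real \<Rightarrow> real"
  assumes I: "open I" and m: "primitive I m r"
  shows "primitive I (\<lambda>x. m x ^ Suc n) (\<lambda>x. real (Suc n) * m x ^ n * r x)"
proof (induction n)
  case 0 then show ?case using m by simp
next
  case (Suc n)
  from primitive_mult[OF I m Suc] show ?case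
    by (rule primitive_cong) (simp_all add: algebra_simps)
qed

text \<open>
  Terms of the Picard series for \<open>u' = a1 h\<close>, \<open>h' = a2 u\<close> with initial values \<open>\<alpha>\<close> and \<open>\<beta>\<close> at \<open>c\<close>.
\<close>

fun picard :: "(real \<Rightarrow> complex) \<Rightarrow> (real \<Rightarrow> complex) \<Rightarrow> real \<Rightarrow> complex \<Rightarrow> complex \<Rightarrow> nat \<Rightarrow>
    (real \<Rightarrow> complex) \<times> (real \<Rightarrow> complex)" where
  "picard a1 a2 c \<alpha> \<beta> 0 = (\<lambda>x. \<alpha>, \<lambda>x. \<beta>)"
| "picard a1 a2 c \<alpha> \<beta> (Suc n) =
     (base_integral c (\<lambda>t. a1 t * snd (picard a1 a2 c \<alpha> \<beta> n) t),
      base_integral c (\<lambda>t. a2 t * fst (picard a1 a2 c \<alpha> \<beta> n) t))"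

text \<open>
  The estimate behind the convergence of the Picard series: \<open>m\<close> is the primitive of the bound \<open>r\<close>
  for the coefficients, so that \<open>m\<^sup>n r\<close> has the primitive \<open>m\<^sup>n\<^sup>+\<^sup>1 / (n + 1)\<close>. To the left of \<open>c\<close> the
  function \<open>m\<close> is negative, and the argument is applied to \<open>- m\<close>.
\<close>

lemma base_integral_bound:
  fixes g :: "real \<Rightarrow> complex" and r m :: "real \<Rightarrow> real"
  assumes I: "open I" "is_interval I" "c \<in> I" and g: "loc_int I g" and r: "loc_int I r" "\<And>t. r t \<ge> 0"
    and m: "m = base_integral c r"
    and le: "\<And>t. t \<in> I \<Longrightarrow> norm (g t) \<le> C * (\<bar>m t\<bar> ^ n * r t)" and x: "x \<in> I"
  shows "norm (base_integral c g x) \<le> C * \<bar>m x\<bar> ^ Suc n / real (Suc n)"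
proof -
  have pm: "primitive I m r" unfolding m by (rule primitive_base_integral[OF I(2,3) r(1)])
  have sub: "{s..t} \<subseteq> I" if "s \<in> I" "t \<in> I" for s t
    by (rule is_interval_Icc_subset[OF I(2) that])
  have gi: "g integrable_on {s..t}" if "s \<in> I" "t \<in> I" for s t
    using loc_intD[OF g sub[OF that]] by (rule set_lebesgue_integral_eq_integral(1))
  have m0: "m c = 0" by (simp add: m)
  have rpos: "integral {s..t} r \<ge> 0" for s t
    by (cases "r integrable_on {s..t}")
      (auto simp: not_integrable_integral r(2) intro!: Henstock_Kurzweil_Integration.integral_nonneg)
  have mpos: "m t \<ge> 0" if "t \<ge> c" for t unfolding m base_integral_def using that rpos by simp
  have mneg: "m t \<le> 0" if "t \<le> c" for t
  proof (cases "t = c")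
    case True then show ?thesis using m0 by simp
  next
    case False then show ?thesis unfolding m base_integral_def using that rpos by simp
  qed
  show ?thesis
  proof (cases "c \<le> x")
    case True
    have "((\<lambda>t. real (Suc n) * m t ^ n * r t) has_integral (m x ^ Suc n - m c ^ Suc n)) {c..x}"
      by (rule primitiveD(2)[OF primitive_power[OF I(1) pm] True sub[OF I(3) x]])
    then have h: "((\<lambda>t. C / real (Suc n) * (real (Suc n) * m t ^ n * r t)) has_integral C / real (Suc n) * (m x ^ Suc n - m c ^ Suc n)) {c..x}"
      by (rule has_integral_mult_right)
    have "norm (integral {c..x} g) \<le> integral {c..x} (\<lambda>t. C / real (Suc n) * (real (Suc n) * m t ^ n * r t))"
    proof (rule integral_norm_bound_integral[OF gi[OF I(3) x]])
      show "(\<lambda>t. C / real (Suc n) * (real (Suc n) * m t ^ n * r t)) integrable_on {c..x}" using h by blast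
      fix t assume t: "t \<in> {c..x}"
      then have "t \<in> I" using sub[OF I(3) x] by blast
      moreover have "\<bar>m t\<bar> = m t" using mpos[of t] t by simp
      moreover have "C / real (Suc n) * (real (Suc n) * m t ^ n * r t) = C * (m t ^ n * r t)" by simp
      ultimately show "norm (g t) \<le> C / real (Suc n) * (real (Suc n) * m t ^ n * r t)"
        using le by metis
    qed
    also have "\<dots> = C / real (Suc n) * m x ^ Suc n" using integral_unique[OF h] m0 by simp
    finally show ?thesis using True mpos[OF True] by (simp add: base_integral_def)
  next
    case False
    then have xc: "x \<le> c" by simp
    have "primitive I (\<lambda>t. (-1) * m t + 0 * m t) (\<lambda>t. (-1) * r t + 0 * r t)" by (rule primitive_linear[OF pm pm])
    then have pm': "primitive I (\<lambda>t. - m t) (\<lambda>t. - r t)" by simp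
    have "((\<lambda>t. real (Suc n) * (- m t) ^ n * (- r t)) has_integral ((- m c) ^ Suc n - (- m x) ^ Suc n)) {x..c}"
      by (rule primitiveD(2)[OF primitive_power[OF I(1) pm'] xc sub[OF x I(3)]])
    then have h: "((\<lambda>t. - C / real (Suc n) * (real (Suc n) * (- m t) ^ n * (- r t))) has_integral - C / real (Suc n) * ((- m c) ^ Suc n - (- m x) ^ Suc n)) {x..c}"
      by (rule has_integral_mult_right)
    have "norm (integral {x..c} g) \<le> integral {x..c} (\<lambda>t. - C / real (Suc n) * (real (Suc n) * (- m t) ^ n * (- r t)))"
    proof (rule integral_norm_bound_integral[OF gi[OF x I(3)]])
      show "(\<lambda>t. - C / real (Suc n) * (real (Suc n) * (- m t) ^ n * (- r t))) integrable_on {x..c}" using h by blast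
      fix t assume t: "t \<in> {x..c}"
      then have "t \<in> I" using sub[OF x I(3)] by blast
      moreover have "\<bar>m t\<bar> = - m t" using mneg[of t] t by simp
      moreover have "- C / real (Suc n) * (real (Suc n) * (- m t) ^ n * (- r t)) = C * ((- m t) ^ n * r t)" by simp
      ultimately show "norm (g t) \<le> - C / real (Suc n) * (real (Suc n) * (- m t) ^ n * (- r t))"
        using le by metis
    qed
    also have "\<dots> = C / real (Suc n) * (- m x) ^ Suc n" using integral_unique[OF h] m0 by simp
    finally show ?thesis using False mneg[OF xc] by (simp add: base_integral_def)
  qed
qed

text \<open>
  A first-order system with locally integrable coefficients has a solution on the whole interval with
  given initial values. The Picard series converges since its \<open>n\<close>-th term is at most
  \<open>M |m x|\<^sup>n / n!\<close>.
\<close>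

theorem linear_system_exists:
  fixes a1 a2 :: "real \<Rightarrow> complex"
  assumes I: "open I" "is_interval I" "c \<in> I" and a: "loc_int I a1" "loc_int I a2"
  obtains u h where "primitive I u (\<lambda>x. a1 x * h x)" "primitive I h (\<lambda>x. a2 x * u x)" "u c = \<alpha>" "h c = \<beta>"
proof -
  define U where "U n = fst (picard a1 a2 c \<alpha> \<beta> n)" for n
  define H where "H n = snd (picard a1 a2 c \<alpha> \<beta> n)" for n
  have U0: "U 0 = (\<lambda>x. \<alpha>)" "H 0 = (\<lambda>x. \<beta>)" by (simp_all add: U_def H_def)
  have US: "U (Suc n) = base_integral c (\<lambda>t. a1 t * H n t)" "H (Suc n) = base_integral c (\<lambda>t. a2 t * U n t)" for n
    by (simp_all add: U_def H_def)
  have cont: "continuous_on I (U n) \<and> continuous_on I (H n)" for n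
  proof (induction n)
    case 0 then show ?case by (simp add: U0)
  next
    case (Suc n)
    then have "loc_int I (\<lambda>t. a1 t * H n t)" "loc_int I (\<lambda>t. a2 t * U n t)"
      using loc_int_mult_continuous a by auto
    from primitive_base_integral[OF I(2,3) this(1)] primitive_base_integral[OF I(2,3) this(2)]
    show ?case unfolding US using primitive_continuous_on[OF I(1)] by blast
  qed
  have li: "loc_int I (\<lambda>t. a1 t * H n t)" "loc_int I (\<lambda>t. a2 t * U n t)" for n
    using loc_int_mult_continuous cont a by auto
  have pr: "primitive I (U (Suc n)) (\<lambda>t. a1 t * H n t)" "primitive I (H (Suc n)) (\<lambda>t. a2 t * U n t)" for n
    unfolding US by (intro primitive_base_integral[OF I(2,3)] li)+
  define r where "r t = norm (a1 t) + norm (a2 t)" for t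
  have r: "loc_int I r" "\<And>t. r t \<ge> 0"
  proof -
    show "loc_int I r" unfolding loc_int_def r_def
    proof (intro allI impI set_integral_add)
      fix x y assume "{x..y} \<subseteq> I"
      then show "(\<lambda>t. norm (a1 t)) absolutely_integrable_on {x..y}" "(\<lambda>t. norm (a2 t)) absolutely_integrable_on {x..y}"
        using loc_intD[OF a(1)] loc_intD[OF a(2)] by (auto intro: absolutely_integrable_norm[unfolded comp_def])
    qed
  qed (simp add: r_def)
  define m where "m = base_integral c r"
  define M where "M = norm \<alpha> + norm \<beta>"
  have M0: "M \<ge> 0" by (simp add: M_def)
  have bound: "norm (U n x) \<le> M * \<bar>m x\<bar> ^ n / fact n \<and> norm (H n x) \<le> M * \<bar>m x\<bar> ^ n / fact n" if "x \<in> I" for n x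
    using that
  proof (induction n arbitrary: x)
    case 0 then show ?case by (simp add: U0 M_def)
  next
    case (Suc n)
    have "norm (a1 t * H n t) \<le> M / fact n * (\<bar>m t\<bar> ^ n * r t)" if "t \<in> I" for t
    proof -
      have "norm (a1 t * H n t) \<le> r t * (M * \<bar>m t\<bar> ^ n / fact n)"
        unfolding norm_mult using Suc.IH[OF that] M0 by (intro mult_mono) (auto simp: r_def)
      then show ?thesis by (simp add: mult_ac)
    qed
    from base_integral_bound[OF I li(1) r m_def this Suc.prems]
    have 1: "norm (U (Suc n) x) \<le> M / fact n * \<bar>m x\<bar> ^ Suc n / real (Suc n)" unfolding US .
    have "norm (a2 t * U n t) \<le> M / fact n * (\<bar>m t\<bar> ^ n * r t)" if "t \<in> I" for t
    proof -
      have "norm (a2 t * U n t) \<le> r t * (M * \<bar>m t\<bar> ^ n / fact n)"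
        unfolding norm_mult using Suc.IH[OF that] M0 by (intro mult_mono) (auto simp: r_def)
      then show ?thesis by (simp add: mult_ac)
    qed
    from base_integral_bound[OF I li(2) r m_def this Suc.prems]
    have 2: "norm (H (Suc n) x) \<le> M / fact n * \<bar>m x\<bar> ^ Suc n / real (Suc n)" unfolding US .
    have eq: "M / fact n * \<bar>m x\<bar> ^ Suc n / real (Suc n) = M * \<bar>m x\<bar> ^ Suc n / fact (Suc n)"
      by (simp add: field_simps)
    from 1 2 show ?case unfolding eq by (rule conjI)
  qed
  have exps: "(\<lambda>n. M * B ^ n / fact n) sums (M * exp B)" for B :: real
    using sums_mult[OF exp_converges[of B], of M] by (simp add: field_simps)
  have sumU: "summable (\<lambda>n. U n x)" and sumH: "summable (\<lambda>n. H n x)" if "x \<in> I" for x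
    using bound[OF that] by (auto intro!: summable_comparison_test'[OF sums_summable[OF exps[of "\<bar>m x\<bar>"]]])
  define u where "u x = (\<Sum>n. U n x)" for x
  define h where "h x = (\<Sum>n. H n x)" for x
  \<comment> \<open>Passing to the limit in the integrated recursion, for either component of the system.\<close>
  have key: "primitive I u' (\<lambda>x. a x * h' x)"
    if a: "loc_int I a" and pr: "\<And>n. primitive I (U' (Suc n)) (\<lambda>t. a t * H' n t)" and U0: "U' 0 = (\<lambda>_. \<gamma>)"
      and su: "\<And>x. x \<in> I \<Longrightarrow> (\<lambda>n. U' n x) sums u' x" and sh: "\<And>x. x \<in> I \<Longrightarrow> (\<lambda>n. H' n x) sums h' x"
      and bnd: "\<And>n x. x \<in> I \<Longrightarrow> norm (H' n x) \<le> M * \<bar>m x\<bar> ^ n / fact n"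
    for a u' h' :: "real \<Rightarrow> complex" and U' H' :: "nat \<Rightarrow> real \<Rightarrow> complex" and \<gamma>
  proof (rule primitiveI)
    fix x y assume xy: "x \<le> y" "{x..y} \<subseteq> I"
    have "continuous_on {x..y} m"
      by (rule continuous_on_subset[OF primitive_continuous_on[OF I(1)] xy(2)])
        (unfold m_def, rule primitive_base_integral[OF I(2,3) r(1)])
    then have "bounded (m ` {x..y})" by (intro compact_imp_bounded compact_continuous_image) simp_all
    then obtain B where B: "\<And>t. t \<in> {x..y} \<Longrightarrow> \<bar>m t\<bar> \<le> B" unfolding bounded_iff real_norm_def by blast
    define SH where "SH N t = (\<Sum>n<N. H' n t)" for N t
    have SHb: "norm (SH N t) \<le> M * exp B" if t: "t \<in> {x..y}" for N t
    proof -
      have tI: "t \<in> I" using t xy by blast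
      have "norm (SH N t) \<le> (\<Sum>n<N. M * \<bar>m t\<bar> ^ n / fact n)"
        unfolding SH_def by (rule sum_norm_le) (rule bnd[OF tI])
      also have "\<dots> \<le> M * exp \<bar>m t\<bar>"
        using sum_le_suminf[OF sums_summable[OF exps], of "{..<N}" "\<bar>m t\<bar>"] sums_unique[OF exps[of "\<bar>m t\<bar>"]] M0 by simp
      also have "\<dots> \<le> M * exp B" using B[OF t] M0 by (intro mult_left_mono) auto
      finally show ?thesis .
    qed
    have has: "((\<lambda>t. a t * SH N t) has_integral ((\<Sum>n<Suc N. U' n y) - (\<Sum>n<Suc N. U' n x))) {x..y}" for N
    proof -
      have "((\<lambda>t. \<Sum>n<N. a t * H' n t) has_integral (\<Sum>n<N. U' (Suc n) y - U' (Suc n) x)) {x..y}"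
        by (intro has_integral_sum primitiveD(2)[OF pr xy]) simp
      moreover have "(\<Sum>n<Suc N. U' n y) - (\<Sum>n<Suc N. U' n x) = (\<Sum>n<N. U' (Suc n) y - U' (Suc n) x)"
        unfolding sum.lessThan_Suc_shift by (simp add: U0 sum_subtractf)
      ultimately show ?thesis unfolding SH_def by (simp add: sum_distrib_left)
    qed
    have ai: "(\<lambda>t. a t * SH N t) absolutely_integrable_on {x..y}" for N
    proof -
      have "(\<lambda>t. \<Sum>n<N. a t * H' n t) absolutely_integrable_on {x..y}"
        by (intro absolutely_integrable_sum primitiveD(1)[OF pr xy]) simp
      then show ?thesis unfolding SH_def by (simp add: sum_distrib_left)
    qed
    define G where "G t = norm (a t) * (M * exp B)" for t
    have G: "G integrable_on {x..y}"
      unfolding G_def using loc_intD[OF a xy(2)] unfolding absolutely_integrable_on_def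
      by (intro integrable_on_mult_left) blast
    have Gb: "norm (a t * SH N t) \<le> G t" if "t \<in> {x..y}" for N t
      unfolding G_def norm_mult by (intro mult_left_mono SHb that) simp
    have lim: "(\<lambda>N. a t * SH N t) \<longlonglongrightarrow> a t * h' t" if "t \<in> {x..y}" for t
    proof -
      have "t \<in> I" using that xy by blast
      from sh[OF this] show ?thesis unfolding SH_def sums_def by (rule tendsto_mult_left)
    qed
    show "(\<lambda>t. a t * h' t) absolutely_integrable_on {x..y}"
    proof (rule dominated_convergence_absolutely_integrable[OF ai G _ lim])
      show "norm (a t * h' t) \<le> G t" if "t \<in> {x..y}" for t
        by (rule Lim_bounded[OF tendsto_norm[OF lim[OF that]], of 0]) (use Gb that in auto)
    qed
    have "(\<lambda>N. (\<Sum>n<Suc N. U' n y) - (\<Sum>n<Suc N. U' n x)) \<longlonglongrightarrow> u' y - u' x"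
    proof -
      have "x \<in> I" "y \<in> I" using xy by auto
      then show ?thesis
        using su unfolding sums_def by (intro tendsto_diff LIMSEQ_Suc) auto
    qed
    then show "((\<lambda>t. a t * h' t) has_integral u' y - u' x) {x..y}"
      by (intro has_integral_dominated_convergence[OF has G]) (use Gb lim in auto)
  qed
  have su: "(\<lambda>n. U n x) sums u x" "(\<lambda>n. H n x) sums h x" if "x \<in> I" for x
    unfolding u_def h_def using sumU[OF that] sumH[OF that] by (auto intro: summable_sums)
  show thesis
  proof (rule that)
    show "primitive I u (\<lambda>x. a1 x * h x)" by (rule key[OF a(1) pr(1) U0(1) su]) (use bound in auto)
    show "primitive I h (\<lambda>x. a2 x * u x)" by (rule key[OF a(2) pr(2) U0(2) su(2,1)]) (use bound in auto)
    have "U n c = (if n = 0 then \<alpha> else 0)" "H n c = (if n = 0 then \<beta> else 0)" for n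
      by (cases n; simp add: U0 US)+
    then have "(\<lambda>n. U n c) sums \<alpha>" "(\<lambda>n. H n c) sums \<beta>"
      using sums_single[of 0 "\<lambda>_. \<alpha>"] sums_single[of 0 "\<lambda>_. \<beta>"] by simp_all
    then show "u c = \<alpha>" "h c = \<beta>" unfolding u_def h_def by (simp_all add: sums_unique[symmetric])
  qed
qed

section \<open>Sturm--Liouville expressions\<close>

text \<open>
  Nonempty open sets are not negligible.
\<close>

lemma continuous_AE_eq_imp_eq:
  fixes f g :: "real \<Rightarrow> 'a::real_normed_vector"
  assumes I: "open I" and f: "continuous_on I f" and g: "continuous_on I g"
    and ae: "AE x in lebesgue_on I. f x = g x" and x: "x \<in> I"
  shows "f x = g x"
proof (rule ccontr)
  assume ne: "f x \<noteq> g x"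
  have "continuous_on I (\<lambda>x. f x - g x)" by (intro continuous_intros f g)
  then have "open (I \<inter> (\<lambda>x. f x - g x) -` (- {0}))"
    by (rule continuous_open_preimage[OF _ I]) auto
  moreover have "I \<inter> (\<lambda>x. f x - g x) -` (- {0}) = {x \<in> I. f x \<noteq> g x}" by auto
  ultimately have o: "open {x \<in> I. f x \<noteq> g x}" by simp
  have "I \<in> sets lebesgue" using I by auto
  then have "negligible {x \<in> I. f x \<noteq> g x}" using ae by (simp add: AE_lebesgue_on_iff_negligible)
  then have "{x \<in> I. f x \<noteq> g x} = {}" using open_not_negligible[OF o] by blast
  with ne x show False by blast
qed

lemma loc_int_of_real:
  assumes "L1_loc I f"
  shows "loc_int I (\<lambda>x. complex_of_real (f x))"
  unfolding loc_int_def
proof (intro allI impI)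
  fix x y assume "{x..y} \<subseteq> I"
  then have "integrable (lebesgue_on {x..y}) f" using assms unfolding L1_loc_def by (metis compact_Icc)
  then have "integrable (lebesgue_on {x..y}) (\<lambda>x. complex_of_real (f x))" by (rule integrable_of_real)
  then show "(\<lambda>x. complex_of_real (f x)) absolutely_integrable_on {x..y}"
    unfolding set_integrable_def by (subst (asm) integrable_restrict_space) simp_all
qed

lemma loc_int_cmult_diff:
  fixes f g :: "real \<Rightarrow> complex"
  assumes "loc_int I f" "loc_int I g"
  shows "loc_int I (\<lambda>x. f x - z * g x)"
  unfolding loc_int_def
proof (intro allI impI set_integral_diff set_integrable_mult_right)
  fix x y assume xy: "{x..y} \<subseteq> I"
  show "f absolutely_integrable_on {x..y}" by (rule loc_intD[OF assms(1) xy])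
  show "g absolutely_integrable_on {x..y}" by (rule loc_intD[OF assms(2) xy])
qed

lemma primitive_cnj:
  assumes "primitive I f g"
  shows "primitive I (\<lambda>x. cnj (f x)) (\<lambda>x. cnj (g x))"
proof (rule primitiveI)
  fix x y assume xy: "x \<le> y" "{x..y} \<subseteq> I"
  have "(cnj \<circ> g) absolutely_integrable_on {x..y}"
    by (rule absolutely_integrable_linear[OF primitiveD(1)[OF assms xy] bounded_linear_cnj])
  then show "(\<lambda>x. cnj (g x)) absolutely_integrable_on {x..y}" by (simp add: comp_def)
  have "((cnj \<circ> g) has_integral cnj (f y - f x)) {x..y}"
    by (rule has_integral_linear[OF primitiveD(2)[OF assms xy] bounded_linear_cnj])
  then show "((\<lambda>x. cnj (g x)) has_integral cnj (f y) - cnj (f x)) {x..y}" by (simp add: comp_def)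
qed

text \<open>
  Admissible coefficients. All functions are considered on the interval \<open>I\<close> only; their values
  elsewhere are arbitrary.
\<close>

locale sl =
  fixes S :: sl_data
  assumes adm: "sl_admissible S"
begin

abbreviation "I \<equiv> sl_int S"
abbreviation "\<mu> \<equiv> sl_measure S"

lemma open_I: "open I" by (simp add: sl_int_def)
lemma interval_I: "is_interval I"
  unfolding is_interval_1 sl_int_def
proof (intro ballI allI impI)
  fix s t x assume st: "s \<in> einterval (sl_a S) (sl_b S)" "t \<in> einterval (sl_a S) (sl_b S)" and x: "s \<le> x \<and> x \<le> t"
  have "sl_a S < ereal x" by (rule less_le_trans[of _ "ereal s"]) (use st x in \<open>auto simp: einterval_iff\<close>)
  moreover have "ereal x < sl_b S" by (rule le_less_trans[of _ "ereal t"]) (use st x in \<open>auto simp: einterval_iff\<close>)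
  ultimately show "x \<in> einterval (sl_a S) (sl_b S)" by (simp add: einterval_iff)
qed
lemma I_lebesgue: "I \<in> sets lebesgue" using open_I by auto
lemma nonempty_I: "\<exists>c. c \<in> I"
  using adm unfolding sl_admissible_def sl_int_def by (intro einterval_nonempty) blast
lemma end_less: "sl_a S < sl_b S" using adm unfolding sl_admissible_def by blast
lemma Icc_sub: "s \<in> I \<Longrightarrow> t \<in> I \<Longrightarrow> {s..t} \<subseteq> I" by (rule is_interval_Icc_subset[OF interval_I])

lemma p_pos: "AE x in lebesgue_on I. sl_p S x > 0"
  and r_pos: "AE x in lebesgue_on I. sl_r S x > 0"
  and r_meas: "sl_r S \<in> borel_measurable (lebesgue_on I)"
  using adm unfolding sl_admissible_def by blast+

lemma loc_int_coeffs:
  "loc_int I (\<lambda>x. complex_of_real (1 / sl_p S x))" "loc_int I (\<lambda>x. complex_of_real (sl_q S x))"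
  "loc_int I (\<lambda>x. complex_of_real (sl_r S x))"
proof -
  have "L1_loc I (\<lambda>x. 1 / sl_p S x)" "L1_loc I (sl_q S)" "L1_loc I (sl_r S)"
    using adm unfolding sl_admissible_def by blast+
  then show "loc_int I (\<lambda>x. complex_of_real (1 / sl_p S x))" "loc_int I (\<lambda>x. complex_of_real (sl_q S x))"
    "loc_int I (\<lambda>x. complex_of_real (sl_r S x))" by (simp_all only: loc_int_of_real)
qed

lemma AC_loc_iff: "AC_loc I f \<longleftrightarrow> (\<forall>c d. {c..d} \<subseteq> I \<longrightarrow> ac_on {c..d} f)"
  by (simp add: AC_loc_def abs_cont_on_eq_ac_on)

lemma primitive_AC_loc: "primitive I f g \<Longrightarrow> AC_loc I f"
  unfolding AC_loc_iff by (intro allI impI primitive_ac)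

lemma AC_loc_primitive: "AC_loc I f \<Longrightarrow> primitive I f (\<lambda>x. vector_derivative f (at x))"
  unfolding AC_loc_iff by (rule ac_primitive(2)[OF open_I]) blast

text \<open>
  The first-order system expressing that \<open>h\<close> is the quasi-derivative of \<open>f\<close> and \<open>g\<close> the image of \<open>f\<close>
  under the differential expression. Unlike \<^const>\<open>qderiv\<close> and \<^const>\<open>sl_tau\<close>, which rest on a choice
  and on pointwise derivatives, it is visibly linear; the lemmas \<open>sl_system_regular\<close> and
  \<open>sl_system_imp_regular\<close> translate between the two.
\<close>

definition sl_system :: "(real \<Rightarrow> complex) \<Rightarrow> (real \<Rightarrow> complex) \<Rightarrow> (real \<Rightarrow> complex) \<Rightarrow> bool" where
  "sl_system f h g \<longleftrightarrow> primitive I f (\<lambda>x. of_real (1 / sl_p S x) * h x) \<and>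
     primitive I h (\<lambda>x. of_real (sl_q S x) * f x - of_real (sl_r S x) * g x)"

lemma is_qderiv_primitive:
  assumes "AC_loc I f" "is_qderiv S f h"
  shows "primitive I f (\<lambda>x. of_real (1 / sl_p S x) * h x)" "continuous_on I h"
proof -
  have h: "AC_loc I h" "AE x in lebesgue_on I. h x = of_real (sl_p S x) * vector_derivative f (at x)"
    using assms(2) unfolding is_qderiv_def ae_eq_def by blast+
  show "continuous_on I h" by (rule primitive_continuous_on[OF open_I AC_loc_primitive[OF h(1)]])
  show "primitive I f (\<lambda>x. of_real (1 / sl_p S x) * h x)"
  proof (rule primitive_spike[OF open_I AC_loc_primitive[OF assms(1)]])
    show "AE x in lebesgue_on I. vector_derivative f (at x) = of_real (1 / sl_p S x) * h x"
      using h(2) p_pos by eventually_elim simp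
  qed
qed

lemma is_qderiv_unique:
  assumes "AC_loc I f" "is_qderiv S f h" "is_qderiv S f k" "x \<in> I"
  shows "h x = k x"
proof (rule continuous_AE_eq_imp_eq[OF open_I _ _ _ assms(4)])
  show "continuous_on I h" "continuous_on I k" using is_qderiv_primitive assms by blast+
  have "AE x in lebesgue_on I. h x = of_real (sl_p S x) * vector_derivative f (at x)"
    "AE x in lebesgue_on I. k x = of_real (sl_p S x) * vector_derivative f (at x)"
    using assms unfolding is_qderiv_def ae_eq_def by blast+
  then show "AE x in lebesgue_on I. h x = k x" by eventually_elim simp
qed

lemma is_qderiv_qderiv: "sl_regular S f \<Longrightarrow> is_qderiv S f (qderiv S f)"
  unfolding sl_regular_def qderiv_def by (rule someI_ex[of "is_qderiv S f"], rule conjunct2)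

lemma sl_system_regular:
  assumes "sl_regular S f"
  shows "sl_system f (qderiv S f) (sl_tau S f)"
  unfolding sl_system_def
proof
  have q: "is_qderiv S f (qderiv S f)" by (rule is_qderiv_qderiv[OF assms])
  show "primitive I f (\<lambda>x. of_real (1 / sl_p S x) * qderiv S f x)"
    by (rule is_qderiv_primitive(1)[OF _ q]) (use assms in \<open>simp add: sl_regular_def\<close>)
  have "primitive I (qderiv S f) (\<lambda>x. vector_derivative (qderiv S f) (at x))"
    by (rule AC_loc_primitive) (use q in \<open>simp add: is_qderiv_def\<close>)
  then show "primitive I (qderiv S f) (\<lambda>x. of_real (sl_q S x) * f x - of_real (sl_r S x) * sl_tau S f x)"
  proof (rule primitive_spike[OF open_I])
    show "AE x in lebesgue_on I. vector_derivative (qderiv S f) (at x) =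
        of_real (sl_q S x) * f x - of_real (sl_r S x) * sl_tau S f x"
      using r_pos by eventually_elim (simp add: sl_tau_def)
  qed
qed

lemma sl_system_imp_regular:
  assumes "sl_system f h g"
  shows "sl_regular S f" "\<And>x. x \<in> I \<Longrightarrow> qderiv S f x = h x" "AE x in lebesgue_on I. sl_tau S f x = g x"
proof -
  have s: "primitive I f (\<lambda>x. of_real (1 / sl_p S x) * h x)"
     "primitive I h (\<lambda>x. of_real (sl_q S x) * f x - of_real (sl_r S x) * g x)"
    using assms unfolding sl_system_def by blast+
  have "AE x in lebesgue_on I. h x = of_real (sl_p S x) * vector_derivative f (at x)"
    using primitive_vector_derivative[OF open_I s(1)] p_pos by eventually_elim simp
  then have q: "is_qderiv S f h" unfolding is_qderiv_def ae_eq_def using primitive_AC_loc[OF s(2)] by blast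
  then show reg: "sl_regular S f" unfolding sl_regular_def using primitive_AC_loc[OF s(1)] by blast
  show eq: "qderiv S f x = h x" if "x \<in> I" for x
    by (rule is_qderiv_unique[OF _ is_qderiv_qderiv[OF reg] q that]) (use reg in \<open>simp add: sl_regular_def\<close>)
  have "primitive I (qderiv S f) (\<lambda>x. of_real (sl_q S x) * f x - of_real (sl_r S x) * g x)"
    by (rule primitive_cong[OF s(2)]) (simp_all add: eq)
  moreover have "primitive I (qderiv S f) (\<lambda>x. of_real (sl_q S x) * f x - of_real (sl_r S x) * sl_tau S f x)"
    using sl_system_regular[OF reg] unfolding sl_system_def by blast
  ultimately have "AE x in lebesgue_on I. of_real (sl_q S x) * f x - of_real (sl_r S x) * g x =
      of_real (sl_q S x) * f x - of_real (sl_r S x) * sl_tau S f x"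
    by (rule primitive_unique[OF open_I])
  then show "AE x in lebesgue_on I. sl_tau S f x = g x" using r_pos by eventually_elim simp
qed

lemma sl_system_linear:
  assumes "sl_system f1 h1 g1" "sl_system f2 h2 g2"
  shows "sl_system (\<lambda>x. a * f1 x + b * f2 x) (\<lambda>x. a * h1 x + b * h2 x) (\<lambda>x. a * g1 x + b * g2 x)"
  unfolding sl_system_def
proof
  show "primitive I (\<lambda>x. a * f1 x + b * f2 x) (\<lambda>x. of_real (1 / sl_p S x) * (a * h1 x + b * h2 x))"
    by (rule primitive_cong[OF primitive_linear[of I f1 "\<lambda>x. of_real (1 / sl_p S x) * h1 x" f2 "\<lambda>x. of_real (1 / sl_p S x) * h2 x" a b]])
      (use assms in \<open>simp_all add: sl_system_def algebra_simps\<close>)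
  show "primitive I (\<lambda>x. a * h1 x + b * h2 x) (\<lambda>x. of_real (sl_q S x) * (a * f1 x + b * f2 x) - of_real (sl_r S x) * (a * g1 x + b * g2 x))"
    by (rule primitive_cong[OF primitive_linear[of I h1 "\<lambda>x. of_real (sl_q S x) * f1 x - of_real (sl_r S x) * g1 x"
         h2 "\<lambda>x. of_real (sl_q S x) * f2 x - of_real (sl_r S x) * g2 x" a b]])
      (use assms in \<open>simp_all add: sl_system_def algebra_simps\<close>)
qed

lemma sl_system_cnj:
  assumes "sl_system f h g"
  shows "sl_system (\<lambda>x. cnj (f x)) (\<lambda>x. cnj (h x)) (\<lambda>x. cnj (g x))"
proof -
  note s = assms[unfolded sl_system_def]
  from primitive_cnj[OF conjunct1[OF s]] primitive_cnj[OF conjunct2[OF s]] show ?thesis unfolding sl_system_def by simp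
qed

lemma sl_system_cong:
  assumes "sl_system f h g" "\<And>x. x \<in> I \<Longrightarrow> f x = f' x"
  shows "sl_system f' h g"
  unfolding sl_system_def
proof
  show "primitive I f' (\<lambda>x. of_real (1 / sl_p S x) * h x)"
    by (rule primitive_cong[of I f]) (use assms in \<open>simp_all add: sl_system_def\<close>)
  show "primitive I h (\<lambda>x. of_real (sl_q S x) * f' x - of_real (sl_r S x) * g x)"
    by (rule primitive_cong[of I h "\<lambda>x. of_real (sl_q S x) * f x - of_real (sl_r S x) * g x"])
      (use assms in \<open>simp_all add: sl_system_def\<close>)
qed

lemma regular_continuous: "sl_regular S f \<Longrightarrow> continuous_on I f"
  by (rule primitive_continuous_on[OF open_I conjunct1[OF sl_system_regular[unfolded sl_system_def]]])

lemma regular_linear: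
  assumes "sl_regular S f" "sl_regular S g"
  shows "sl_regular S (\<lambda>x. a * f x + b * g x)"
    "\<And>x. x \<in> I \<Longrightarrow> qderiv S (\<lambda>x. a * f x + b * g x) x = a * qderiv S f x + b * qderiv S g x"
    "AE x in lebesgue_on I. sl_tau S (\<lambda>x. a * f x + b * g x) x = a * sl_tau S f x + b * sl_tau S g x"
proof -
  note s = sl_system_linear[OF sl_system_regular[OF assms(1)] sl_system_regular[OF assms(2)], of a b]
  show "sl_regular S (\<lambda>x. a * f x + b * g x)" by (rule sl_system_imp_regular(1)[OF s])
  show "\<And>x. x \<in> I \<Longrightarrow> qderiv S (\<lambda>x. a * f x + b * g x) x = a * qderiv S f x + b * qderiv S g x"
    by (rule sl_system_imp_regular(2)[OF s])
  show "AE x in lebesgue_on I. sl_tau S (\<lambda>x. a * f x + b * g x) x = a * sl_tau S f x + b * sl_tau S g x"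
    by (rule sl_system_imp_regular(3)[OF s])
qed

lemma regular_cnj:
  assumes "sl_regular S f"
  shows "sl_regular S (\<lambda>x. cnj (f x))"
    "\<And>x. x \<in> I \<Longrightarrow> qderiv S (\<lambda>x. cnj (f x)) x = cnj (qderiv S f x)"
    "AE x in lebesgue_on I. sl_tau S (\<lambda>x. cnj (f x)) x = cnj (sl_tau S f x)"
proof -
  note s = sl_system_cnj[OF sl_system_regular[OF assms]]
  show "sl_regular S (\<lambda>x. cnj (f x))" by (rule sl_system_imp_regular(1)[OF s])
  show "\<And>x. x \<in> I \<Longrightarrow> qderiv S (\<lambda>x. cnj (f x)) x = cnj (qderiv S f x)" by (rule sl_system_imp_regular(2)[OF s])
  show "AE x in lebesgue_on I. sl_tau S (\<lambda>x. cnj (f x)) x = cnj (sl_tau S f x)" by (rule sl_system_imp_regular(3)[OF s])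
qed

lemma regular_cong:
  assumes "sl_regular S f" "\<And>x. x \<in> I \<Longrightarrow> f x = f' x"
  shows "sl_regular S f'" "\<And>x. x \<in> I \<Longrightarrow> qderiv S f' x = qderiv S f x"
    "AE x in lebesgue_on I. sl_tau S f' x = sl_tau S f x"
proof -
  have s: "sl_system f' (qderiv S f) (sl_tau S f)" by (rule sl_system_cong[OF sl_system_regular[OF assms(1)]]) (rule assms(2))
  show "sl_regular S f'" by (rule sl_system_imp_regular(1)[OF s])
  show "\<And>x. x \<in> I \<Longrightarrow> qderiv S f' x = qderiv S f x" by (rule sl_system_imp_regular(2)[OF s])
  show "AE x in lebesgue_on I. sl_tau S f' x = sl_tau S f x" by (rule sl_system_imp_regular(3)[OF s])
qed

text \<open>
  The Lagrange identity in integrated form.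
\<close>

lemma primitive_wronsk:
  assumes "sl_regular S f" "sl_regular S g"
  shows "primitive I (wronsk S f g) (\<lambda>x. of_real (sl_r S x) * (sl_tau S f x * g x - f x * sl_tau S g x))"
proof -
  have f: "primitive I f (\<lambda>x. of_real (1 / sl_p S x) * qderiv S f x)"
     "primitive I (qderiv S f) (\<lambda>x. of_real (sl_q S x) * f x - of_real (sl_r S x) * sl_tau S f x)"
    using sl_system_regular[OF assms(1)] unfolding sl_system_def by blast+
  have g: "primitive I g (\<lambda>x. of_real (1 / sl_p S x) * qderiv S g x)"
     "primitive I (qderiv S g) (\<lambda>x. of_real (sl_q S x) * g x - of_real (sl_r S x) * sl_tau S g x)"
    using sl_system_regular[OF assms(2)] unfolding sl_system_def by blast+
  from primitive_linear[OF primitive_mult[OF open_I f(1) g(2)] primitive_mult[OF open_I f(2) g(1)], of 1 "-1"]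
  show ?thesis
    by (rule primitive_cong) (simp_all add: wronsk_def algebra_simps)
qed

section \<open>Square-integrable functions\<close>

lemma measurable_mu: "f \<in> borel_measurable \<mu> \<longleftrightarrow> f \<in> borel_measurable (lebesgue_on I)"
  unfolding sl_measure_def by simp

lemma AE_mu:
  assumes "AE x in lebesgue_on I. P x"
  shows "AE x in \<mu>. P x"
  unfolding sl_measure_def by (subst AE_density) (use r_meas assms in \<open>auto elim: eventually_mono\<close>)

lemma AE_mu_D:
  assumes "AE x in \<mu>. P x"
  shows "AE x in lebesgue_on I. P x"
proof -
  have "AE x in lebesgue_on I. 0 < ennreal (sl_r S x) \<longrightarrow> P x"
    using assms unfolding sl_measure_def by (subst (asm) AE_density) (use r_meas in auto)
  then show ?thesis using r_pos by eventually_elim simp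
qed

lemma integrable_mu_iff:
  fixes f :: "real \<Rightarrow> 'a::{banach, second_countable_topology}"
  assumes "f \<in> borel_measurable (lebesgue_on I)"
  shows "integrable \<mu> f \<longleftrightarrow> integrable (lebesgue_on I) (\<lambda>x. sl_r S x *\<^sub>R f x)"
    and "integral\<^sup>L \<mu> f = integral\<^sup>L (lebesgue_on I) (\<lambda>x. sl_r S x *\<^sub>R f x)"
proof -
  have r0: "AE x in lebesgue_on I. 0 \<le> sl_r S x" using r_pos by eventually_elim simp
  show "integrable \<mu> f \<longleftrightarrow> integrable (lebesgue_on I) (\<lambda>x. sl_r S x *\<^sub>R f x)"
    unfolding sl_measure_def by (rule integrable_density[OF assms r_meas r0])
  show "integral\<^sup>L \<mu> f = integral\<^sup>L (lebesgue_on I) (\<lambda>x. sl_r S x *\<^sub>R f x)"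
    unfolding sl_measure_def by (rule integral_density[OF assms r_meas r0])
qed

lemma regular_measurable: "sl_regular S f \<Longrightarrow> f \<in> borel_measurable (lebesgue_on I)"
  by (rule continuous_imp_measurable_on_sets_lebesgue[OF regular_continuous I_lebesgue])

lemma measurable_AE_cong:
  fixes f g :: "real \<Rightarrow> complex"
  assumes f: "f \<in> borel_measurable (lebesgue_on I)" and ae: "AE x in lebesgue_on I. f x = g x"
  shows "g \<in> borel_measurable (lebesgue_on I)"
proof -
  have I: "I \<inter> space lebesgue \<in> sets lebesgue" using I_lebesgue by simp
  have "(\<lambda>x. indicator I x *\<^sub>R f x) \<in> borel_measurable lebesgue"
    using f borel_measurable_restrict_space_iff[OF I, of f] by simp
  moreover have "AE x in lebesgue. indicator I x *\<^sub>R f x = indicator I x *\<^sub>R g x"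
    using ae AE_restrict_space_iff[OF I, of "\<lambda>x. f x = g x"] by (auto elim!: eventually_mono simp: indicator_def)
  ultimately have "(\<lambda>x. indicator I x *\<^sub>R g x) \<in> borel_measurable lebesgue" by (rule borel_measurable_AE)
  then show ?thesis using borel_measurable_restrict_space_iff[OF I, of g] by simp
qed

lemma L2r_AE_cong:
  assumes f: "f \<in> L2r S" and ae: "AE x in lebesgue_on I. f x = g x"
  shows "g \<in> L2r S"
proof -
  have fm: "f \<in> borel_measurable (lebesgue_on I)" using f by (simp add: L2r_def)
  have gm: "g \<in> borel_measurable (lebesgue_on I)" by (rule measurable_AE_cong[OF fm ae])
  have "integrable \<mu> (\<lambda>x. (cmod (f x))\<^sup>2) \<longleftrightarrow> integrable \<mu> (\<lambda>x. (cmod (g x))\<^sup>2)"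
    using fm gm AE_mu[OF ae] by (intro integrable_cong_AE) (auto simp: measurable_mu elim: eventually_mono)
  then show ?thesis using f gm by (simp add: L2r_def)
qed

lemma L2r_measurable: "f \<in> L2r S \<Longrightarrow> f \<in> borel_measurable \<mu>"
  by (simp add: L2r_def measurable_mu)

lemma L2r_mult_integrable:
  assumes "f \<in> L2r S" "g \<in> L2r S"
  shows "integrable \<mu> (\<lambda>x. f x * g x)"
proof (rule Bochner_Integration.integrable_bound)
  show "integrable \<mu> (\<lambda>x. (cmod (f x))\<^sup>2 + (cmod (g x))\<^sup>2)" using assms by (simp add: L2r_def)
  show "(\<lambda>x. f x * g x) \<in> borel_measurable \<mu>"
    using assms by (intro borel_measurable_times L2r_measurable)
  show "AE x in \<mu>. norm (f x * g x) \<le> norm ((cmod (f x))\<^sup>2 + (cmod (g x))\<^sup>2)"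
  proof (rule AE_I2)
    fix x
    have "0 \<le> (cmod (f x) - cmod (g x))\<^sup>2" by simp
    then have "2 * (cmod (f x) * cmod (g x)) \<le> (cmod (f x))\<^sup>2 + (cmod (g x))\<^sup>2"
      by (simp add: power2_diff)
    moreover have "0 \<le> cmod (f x) * cmod (g x)" by simp
    ultimately show "norm (f x * g x) \<le> norm ((cmod (f x))\<^sup>2 + (cmod (g x))\<^sup>2)"
      unfolding norm_mult real_norm_def by linarith
  qed
qed

lemma L2r_linear:
  assumes "f \<in> L2r S" "g \<in> L2r S"
  shows "(\<lambda>x. a * f x + b * g x) \<in> L2r S"
proof -
  have m: "(\<lambda>x. a * f x + b * g x) \<in> borel_measurable \<mu>"
    using assms by (intro borel_measurable_add borel_measurable_times borel_measurable_const L2r_measurable)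
  have "integrable \<mu> (\<lambda>x. (cmod (a * f x + b * g x))\<^sup>2)"
  proof (rule Bochner_Integration.integrable_bound)
    show "integrable \<mu> (\<lambda>x. 2 * (cmod a)\<^sup>2 * (cmod (f x))\<^sup>2 + 2 * (cmod b)\<^sup>2 * (cmod (g x))\<^sup>2)"
      using assms by (simp add: L2r_def)
    show "(\<lambda>x. (cmod (a * f x + b * g x))\<^sup>2) \<in> borel_measurable \<mu>" using m by measurable
    show "AE x in \<mu>. norm ((cmod (a * f x + b * g x))\<^sup>2) \<le>
        norm (2 * (cmod a)\<^sup>2 * (cmod (f x))\<^sup>2 + 2 * (cmod b)\<^sup>2 * (cmod (g x))\<^sup>2)"
    proof (rule AE_I2)
      fix x
      have "(cmod (a * f x + b * g x))\<^sup>2 \<le> (cmod (a * f x) + cmod (b * g x))\<^sup>2"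
        by (intro power_mono norm_triangle_ineq) simp
      also have "\<dots> \<le> 2 * (cmod (a * f x))\<^sup>2 + 2 * (cmod (b * g x))\<^sup>2"
      proof -
        have "0 \<le> (cmod (a * f x) - cmod (b * g x))\<^sup>2" by simp
        then show ?thesis unfolding power2_diff power2_sum by linarith
      qed
      finally show "norm ((cmod (a * f x + b * g x))\<^sup>2) \<le>
        norm (2 * (cmod a)\<^sup>2 * (cmod (f x))\<^sup>2 + 2 * (cmod b)\<^sup>2 * (cmod (g x))\<^sup>2)"
        by (simp add: norm_mult power_mult_distrib)
    qed
  qed
  then show ?thesis using m by (simp add: L2r_def measurable_mu)
qed

lemma L2r_cnj: "f \<in> L2r S \<Longrightarrow> (\<lambda>x. cnj (f x)) \<in> L2r S"
  unfolding L2r_def by (auto intro!: borel_measurable_continuous_onI[of cnj, THEN measurable_compose[rotated]] continuous_intros)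

lemma dom_maxD:
  assumes "f \<in> dom_max S"
  shows "f \<in> L2r S" "sl_regular S f" "sl_tau S f \<in> L2r S"
  using assms by (simp_all add: dom_max_def)

lemma dom_max_linear:
  assumes "f \<in> dom_max S" "g \<in> dom_max S"
  shows "(\<lambda>x. a * f x + b * g x) \<in> dom_max S"
proof -
  note f = dom_maxD[OF assms(1)] and g = dom_maxD[OF assms(2)]
  note reg = regular_linear[OF f(2) g(2), where a = a and b = b]
  have "sl_tau S (\<lambda>x. a * f x + b * g x) \<in> L2r S"
    by (rule L2r_AE_cong[OF L2r_linear[OF f(3) g(3), of a b]]) (use reg(3) in eventually_elim, simp)
  then show ?thesis using reg(1) L2r_linear[OF f(1) g(1)] by (simp add: dom_max_def)
qed

lemma dom_max_cnj:
  assumes "f \<in> dom_max S"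
  shows "(\<lambda>x. cnj (f x)) \<in> dom_max S"
proof -
  note f = dom_maxD[OF assms]
  have "sl_tau S (\<lambda>x. cnj (f x)) \<in> L2r S"
    by (rule L2r_AE_cong[OF L2r_cnj[OF f(3)]]) (use regular_cnj(3)[OF f(2)] in eventually_elim, simp)
  then show ?thesis using regular_cnj(1)[OF f(2)] L2r_cnj[OF f(1)] by (simp add: dom_max_def)
qed

section \<open>Green's formula at the end points\<close>

lemma eventually_end_a: "eventually (\<lambda>x. x \<in> I) (end_a S)"
  unfolding end_a_def eventually_filtermap eventually_at_right[OF end_less]
proof (intro exI[of _ "sl_b S"] conjI allI impI end_less)
  fix y assume "sl_a S < y" "y < sl_b S"
  then show "real_of_ereal y \<in> I" by (cases y) (auto simp: sl_int_def einterval_iff)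
qed

lemma eventually_end_b: "eventually (\<lambda>x. x \<in> I) (end_b S)"
  unfolding end_b_def eventually_filtermap eventually_at_left[OF end_less]
proof (intro exI[of _ "sl_a S"] conjI allI impI end_less)
  fix y assume "y < sl_b S" "sl_a S < y"
  then show "real_of_ereal y \<in> I" by (cases y) (auto simp: sl_int_def einterval_iff)
qed

lemma end_a_neq_bot: "end_a S \<noteq> bot"
proof
  assume "end_a S = bot"
  then have "eventually (\<lambda>_. False) (at_right (sl_a S))" by (simp add: end_a_def filtermap_bot_iff)
  then show False unfolding eventually_at_right[OF end_less] using dense by blast
qed

lemma end_b_neq_bot: "end_b S \<noteq> bot"
proof
  assume "end_b S = bot"
  then have "eventually (\<lambda>_. False) (at_left (sl_b S))" by (simp add: end_b_def filtermap_bot_iff)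
  then show False unfolding eventually_at_left[OF end_less] using dense by blast
qed

text \<open>
  A primitive of a function that is integrable over all of \<open>I\<close> has limits at both end points. The
  end points may be infinite; the one-sided filters in the extended reals are tested on sequences.
\<close>

lemma primitive_end_limits:
  fixes f g :: "real \<Rightarrow> complex"
  assumes f: "primitive I f g" and g: "g absolutely_integrable_on I"
  obtains A B where "(f \<longlongrightarrow> A) (end_a S)" "(f \<longlongrightarrow> B) (end_b S)" "B - A = integral I g"
proof -
  obtain c where c: "c \<in> I" using nonempty_I by blast
  have gn: "(\<lambda>x. norm (g x)) integrable_on I" using g unfolding absolutely_integrable_on_def by blast
  have fx: "(g has_integral f y - f x) {x..y}" if "x \<in> I" "y \<in> I" "x \<le> y" for x y
    using primitiveD(2)[OF f that(3) Icc_sub] that by blast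
  let ?r = "\<lambda>A t. if t \<in> A then g t else 0"
  have restr: "(?r {x..y} has_integral f y - f x) I" if "x \<in> I" "y \<in> I" "x \<le> y" for x y
    using has_integral_restrict[OF Icc_sub[OF that(1,2)], of g "f y - f x"] fx[OF that] by simp
  let ?Gb = "integral I (?r {c..})" and ?Ga = "integral I (?r {..c})"
  have b: "(f \<longlongrightarrow> f c + ?Gb) (end_b S) \<and> ?r {c..} integrable_on I"
  proof -
    have main: "(\<lambda>n. f (x n)) \<longlonglongrightarrow> f c + ?Gb \<and> ?r {c..} integrable_on I"
      if x: "\<And>n. x n \<in> I" "\<And>n. c \<le> x n" and cof: "\<And>t. t \<in> I \<Longrightarrow> eventually (\<lambda>n. t \<le> x n) sequentially" for x
    proof -
      have 1: "(\<lambda>n. integral I (?r {c..x n})) \<longlonglongrightarrow> ?Gb \<and> ?r {c..} integrable_on I"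
      proof -
        have h1: "?r {c..x n} integrable_on I" for n using restr[OF c x(1) x(2)] by blast
        have h2: "norm (?r {c..x n} t) \<le> norm (g t)" for n t by simp
        have h3: "(\<lambda>n. ?r {c..x n} t) \<longlonglongrightarrow> ?r {c..} t" if "t \<in> I" for t
          by (rule tendsto_eventually) (use cof[OF that] in eventually_elim, auto)
        show ?thesis
          using dominated_convergence(1)[OF h1 gn h2 h3] dominated_convergence(2)[OF h1 gn h2 h3] by blast
      qed
      have "f (x n) = f c + integral I (?r {c..x n})" for n
        using integral_unique[OF restr[OF c x(1) x(2)]] by simp
      then show ?thesis using 1 tendsto_add[OF tendsto_const, of _ _ sequentially "f c"] by simp
    qed
    have cb: "ereal c < sl_b S" using c by (simp add: sl_int_def einterval_iff)
    have seq: "(\<lambda>n. f (real_of_ereal (X n))) \<longlonglongrightarrow> f c + ?Gb \<and> ?r {c..} integrable_on I"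
      if X: "\<And>n. X n < sl_b S" "\<And>n. ereal c < X n" "X \<longlonglongrightarrow> sl_b S" for X
    proof (rule main)
      have Xr: "ereal (real_of_ereal (X n)) = X n" for n
        using X(1,2)[of n] by (cases "X n") auto
      show "real_of_ereal (X n) \<in> I" for n
        unfolding sl_int_def einterval_iff Xr using X(1,2)[of n] c
        by (auto simp: sl_int_def einterval_iff intro: less_trans)
      show "c \<le> real_of_ereal (X n)" for n using X(2)[of n] Xr[of n] by (metis ereal_less_eq(3) less_imp_le)
      show "eventually (\<lambda>n. t \<le> real_of_ereal (X n)) sequentially" if "t \<in> I" for t
      proof -
        have "ereal t < sl_b S" using that by (simp add: sl_int_def einterval_iff)
        from order_tendstoD(1)[OF X(3) this] show ?thesis
          by eventually_elim (metis Xr ereal_less_eq(3) less_imp_le)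
      qed
    qed
    have lim: "(f \<longlongrightarrow> f c + ?Gb) (end_b S)"
      unfolding end_b_def filterlim_filtermap
    proof (rule tendsto_at_left_sequentially[OF cb])
      fix X assume "\<And>n. X n < sl_b S" "\<And>n. ereal c < X n" "X \<longlonglongrightarrow> sl_b S"
      from seq[OF this] show "(\<lambda>n. f (real_of_ereal (X n))) \<longlonglongrightarrow> f c + ?Gb" by blast
    qed
    show ?thesis
    proof (rule einterval_Icc_approximation[OF cb])
      fix u l :: "nat \<Rightarrow> real"
      assume ul: "\<And>i. l i < u i" "\<And>i. ereal c < l i" "\<And>i. u i < sl_b S" "u \<longlonglongrightarrow> sl_b S"
      have "ereal c < ereal (u i)" for i using less_trans[OF ul(2)[of i], of "ereal (u i)"] ul(1)[of i] by simp
      from seq[OF ul(3) this ul(4)] lim show ?thesis by blast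
    qed
  qed
  have a: "(f \<longlongrightarrow> f c - ?Ga) (end_a S) \<and> ?r {..c} integrable_on I"
  proof -
    have main: "(\<lambda>n. f (x n)) \<longlonglongrightarrow> f c - ?Ga \<and> ?r {..c} integrable_on I"
      if x: "\<And>n. x n \<in> I" "\<And>n. x n \<le> c" and cof: "\<And>t. t \<in> I \<Longrightarrow> eventually (\<lambda>n. x n \<le> t) sequentially" for x
    proof -
      have 1: "(\<lambda>n. integral I (?r {x n..c})) \<longlonglongrightarrow> ?Ga \<and> ?r {..c} integrable_on I"
      proof -
        have h1: "?r {x n..c} integrable_on I" for n using restr[OF x(1) c x(2)] by blast
        have h2: "norm (?r {x n..c} t) \<le> norm (g t)" for n t by simp
        have h3: "(\<lambda>n. ?r {x n..c} t) \<longlonglongrightarrow> ?r {..c} t" if "t \<in> I" for t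
          by (rule tendsto_eventually) (use cof[OF that] in eventually_elim, auto)
        show ?thesis
          using dominated_convergence(1)[OF h1 gn h2 h3] dominated_convergence(2)[OF h1 gn h2 h3] by blast
      qed
      have "f (x n) = f c - integral I (?r {x n..c})" for n
        using integral_unique[OF restr[OF x(1) c x(2)]] by simp
      then show ?thesis using 1 tendsto_diff[OF tendsto_const, of _ _ sequentially "f c"] by simp
    qed
    have ca: "sl_a S < ereal c" using c by (simp add: sl_int_def einterval_iff)
    have seq: "(\<lambda>n. f (real_of_ereal (X n))) \<longlonglongrightarrow> f c - ?Ga \<and> ?r {..c} integrable_on I"
      if X: "\<And>n. sl_a S < X n" "\<And>n. X n < ereal c" "X \<longlonglongrightarrow> sl_a S" for X
    proof (rule main)
      have Xr: "ereal (real_of_ereal (X n)) = X n" for n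
        using X(1,2)[of n] by (cases "X n") auto
      show "real_of_ereal (X n) \<in> I" for n
        unfolding sl_int_def einterval_iff Xr using X(1,2)[of n] c
        by (auto simp: sl_int_def einterval_iff intro: less_trans)
      show "real_of_ereal (X n) \<le> c" for n using X(2)[of n] Xr[of n] by (metis ereal_less_eq(3) less_imp_le)
      show "eventually (\<lambda>n. real_of_ereal (X n) \<le> t) sequentially" if "t \<in> I" for t
      proof -
        have "sl_a S < ereal t" using that by (simp add: sl_int_def einterval_iff)
        from order_tendstoD(2)[OF X(3) this] show ?thesis
          by eventually_elim (metis Xr ereal_less_eq(3) less_imp_le)
      qed
    qed
    have lim: "(f \<longlongrightarrow> f c - ?Ga) (end_a S)"
      unfolding end_a_def filterlim_filtermap
    proof (rule tendsto_at_right_sequentially[OF ca])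
      fix X assume "\<And>n. sl_a S < X n" "\<And>n. X n < ereal c" "X \<longlonglongrightarrow> sl_a S"
      from seq[OF this] show "(\<lambda>n. f (real_of_ereal (X n))) \<longlonglongrightarrow> f c - ?Ga" by blast
    qed
    show ?thesis
    proof (rule einterval_Icc_approximation[OF ca])
      fix u l :: "nat \<Rightarrow> real"
      assume ul: "\<And>i. l i < u i" "\<And>i. sl_a S < l i" "\<And>i. u i < ereal c" "l \<longlonglongrightarrow> sl_a S"
      have "ereal (l i) < ereal c" for i using less_trans[OF _ ul(3)[of i], of "ereal (l i)"] ul(1)[of i] by simp
      from seq[OF ul(2) this ul(4)] lim show ?thesis by blast
    qed
  qed
  have "(f c + ?Gb) - (f c - ?Ga) = integral I (\<lambda>t. ?r {..c} t + ?r {c..} t)"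
    using a b by (simp add: Henstock_Kurzweil_Integration.integral_add)
  also have "\<dots> = integral I g"
    by (rule integral_spike[of "{c}"]) auto
  finally show thesis using that a b by blast
qed

text \<open>
  The limits of the Wronskian exist on the maximal domain, and their difference is given by Green's
  formula.
\<close>

lemma green:
  assumes f: "f \<in> dom_max S" and g: "g \<in> dom_max S"
  shows "(wronsk S f g \<longlongrightarrow> wronsk_at S f g (end_a S)) (end_a S)"
    "(wronsk S f g \<longlongrightarrow> wronsk_at S f g (end_b S)) (end_b S)"
    "wronsk_at S f g (end_b S) - wronsk_at S f g (end_a S) =
       (LINT x|\<mu>. sl_tau S f x * g x - f x * sl_tau S g x)"
proof -
  note F = dom_maxD[OF f] and G = dom_maxD[OF g]
  let ?w = "\<lambda>x. sl_tau S f x * g x - f x * sl_tau S g x"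
  have int: "integrable \<mu> ?w"
    by (intro Bochner_Integration.integrable_diff L2r_mult_integrable F G)
  then have m: "?w \<in> borel_measurable (lebesgue_on I)" using borel_measurable_integrable measurable_mu by blast
  have eq: "(\<lambda>x. sl_r S x *\<^sub>R ?w x) = (\<lambda>x. of_real (sl_r S x) * ?w x)" by (simp add: scaleR_conv_of_real)
  have int': "integrable (lebesgue_on I) (\<lambda>x. of_real (sl_r S x) * ?w x)"
    using int unfolding integrable_mu_iff(1)[OF m] eq .
  then have ai: "(\<lambda>x. of_real (sl_r S x) * ?w x) absolutely_integrable_on I"
    unfolding set_integrable_def by (subst (asm) integrable_restrict_space) (use I_lebesgue in simp_all)
  obtain A B where AB: "(wronsk S f g \<longlongrightarrow> A) (end_a S)" "(wronsk S f g \<longlongrightarrow> B) (end_b S)"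
    "B - A = integral I (\<lambda>x. of_real (sl_r S x) * ?w x)"
    by (rule primitive_end_limits[OF primitive_wronsk[OF F(2) G(2)] ai])
  have A: "wronsk_at S f g (end_a S) = A" unfolding wronsk_at_def by (rule tendsto_Lim[OF end_a_neq_bot AB(1)])
  have B: "wronsk_at S f g (end_b S) = B" unfolding wronsk_at_def by (rule tendsto_Lim[OF end_b_neq_bot AB(2)])
  show "(wronsk S f g \<longlongrightarrow> wronsk_at S f g (end_a S)) (end_a S)" unfolding A by (rule AB)
  show "(wronsk S f g \<longlongrightarrow> wronsk_at S f g (end_b S)) (end_b S)" unfolding B by (rule AB)
  have "B - A = integral\<^sup>L \<mu> ?w"
    unfolding integrable_mu_iff(2)[OF m] eq AB(3) by (rule lebesgue_integral_eq_integral[OF int' I_lebesgue, symmetric])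
  then show "wronsk_at S f g (end_b S) - wronsk_at S f g (end_a S) = (LINT x|\<mu>. ?w x)" unfolding A B .
qed

section \<open>Solutions of the homogeneous equation\<close>

lemma sl_system_solution: "sl_system u h (\<lambda>x. z * u x) \<Longrightarrow> sl_solution S z u"
  unfolding sl_solution_def ae_eq_def using sl_system_imp_regular by blast

lemma solution_exists:
  assumes "c \<in> I"
  obtains u where "sl_solution S z u" "u c = \<alpha>" "qderiv S u c = \<beta>"
proof -
  have li: "loc_int I (\<lambda>x. complex_of_real (sl_q S x) - z * complex_of_real (sl_r S x))"
    by (rule loc_int_cmult_diff[OF loc_int_coeffs(2,3)])
  obtain u h where uh: "primitive I u (\<lambda>x. complex_of_real (1 / sl_p S x) * h x)"
    "primitive I h (\<lambda>x. (complex_of_real (sl_q S x) - z * complex_of_real (sl_r S x)) * u x)" "u c = \<alpha>" "h c = \<beta>"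
    by (rule linear_system_exists[OF open_I interval_I assms loc_int_coeffs(1) li])
  have "primitive I h (\<lambda>x. of_real (sl_q S x) * u x - of_real (sl_r S x) * (z * u x))"
    by (rule primitive_cong[OF uh(2)]) (simp_all add: algebra_simps)
  then have s: "sl_system u h (\<lambda>x. z * u x)" using uh(1) unfolding sl_system_def by blast
  show thesis
    using that[OF sl_system_solution[OF s]] uh(3,4) sl_system_imp_regular(2)[OF s assms] by simp
qed

end

text \<open>
  In the limit circle case every solution is square integrable: near the end points by assumption,
  in between by continuity.
\<close>

locale sl_limit_circle = sl +
  assumes lca: "limit_circle_a S" and lcb: "limit_circle_b S"
begin

lemma solution_L2r:
  assumes u: "sl_solution S z u"
  shows "u \<in> L2r S"
proof -
  have reg: "sl_regular S u" using u unfolding sl_solution_def by blast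
  have um: "u \<in> borel_measurable (lebesgue_on I)" by (rule regular_measurable[OF reg])
  obtain c where c: "c \<in> I" "set_integrable \<mu> {..<c} (\<lambda>x. (cmod (u x))\<^sup>2)"
    using lca u unfolding limit_circle_a_def by blast
  obtain d where d: "d \<in> I" "set_integrable \<mu> {d<..} (\<lambda>x. (cmod (u x))\<^sup>2)"
    using lcb u unfolding limit_circle_b_def by blast
  have mid: "set_integrable \<mu> {c..d} (\<lambda>x. (cmod (u x))\<^sup>2)"
  proof -
    have sub: "{c..d} \<subseteq> I" by (rule Icc_sub[OF c(1) d(1)])
    have "continuous_on I (\<lambda>x. complex_of_real ((cmod (u x))\<^sup>2))"
      by (intro continuous_intros regular_continuous[OF reg])
    from loc_intD[OF loc_int_mult_continuous[OF loc_int_coeffs(3) this] sub]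
    have "(\<lambda>x. complex_of_real (sl_r S x) * complex_of_real ((cmod (u x))\<^sup>2)) absolutely_integrable_on {c..d}" .
    moreover have "(\<lambda>x. indicat_real {c..d} x *\<^sub>R (complex_of_real (sl_r S x) * complex_of_real ((cmod (u x))\<^sup>2))) =
        (\<lambda>x. complex_of_real (indicator I x *\<^sub>R (sl_r S x *\<^sub>R (indicator {c..d} x *\<^sub>R (cmod (u x))\<^sup>2))))"
      using sub by (intro ext) (auto simp: indicator_def)
    ultimately have "integrable lebesgue (\<lambda>x. complex_of_real (indicator I x *\<^sub>R (sl_r S x *\<^sub>R (indicator {c..d} x *\<^sub>R (cmod (u x))\<^sup>2))))"
      unfolding set_integrable_def by simp
    then have "integrable lebesgue (\<lambda>x. indicator I x *\<^sub>R (sl_r S x *\<^sub>R (indicator {c..d} x *\<^sub>R (cmod (u x))\<^sup>2)))"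
      by (subst (asm) complex_of_real_integrable_eq)
    then have *: "integrable (lebesgue_on I) (\<lambda>x. sl_r S x *\<^sub>R (indicator {c..d} x *\<^sub>R (cmod (u x))\<^sup>2))"
      by (subst integrable_restrict_space) (use I_lebesgue in auto)
    have cd: "{c..d} \<inter> I \<in> sets (lebesgue_on I)" using sub by (auto simp: sets_restrict_space_iff I_lebesgue Int_absorb2)
    have m: "(\<lambda>x. indicator {c..d} x *\<^sub>R (cmod (u x))\<^sup>2) \<in> borel_measurable (lebesgue_on I)"
      using um cd by (intro borel_measurable_scaleR borel_measurable_indicator') (auto simp: Int_def conj_ac)
    show ?thesis unfolding set_integrable_def integrable_mu_iff(1)[OF m] by (rule *)
  qed
  have "integrable \<mu> (\<lambda>x. (cmod (u x))\<^sup>2)"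
  proof (rule Bochner_Integration.integrable_bound)
    show "integrable \<mu> (\<lambda>x. indicator {..<c} x *\<^sub>R (cmod (u x))\<^sup>2 + indicator {c..d} x *\<^sub>R (cmod (u x))\<^sup>2 + indicator {d<..} x *\<^sub>R (cmod (u x))\<^sup>2)"
      using c(2) d(2) mid unfolding set_integrable_def by (intro Bochner_Integration.integrable_add)
    show "(\<lambda>x. (cmod (u x))\<^sup>2) \<in> borel_measurable \<mu>" using um unfolding measurable_mu by measurable
    show "AE x in \<mu>. norm ((cmod (u x))\<^sup>2) \<le>
      norm (indicator {..<c} x *\<^sub>R (cmod (u x))\<^sup>2 + indicator {c..d} x *\<^sub>R (cmod (u x))\<^sup>2 + indicator {d<..} x *\<^sub>R (cmod (u x))\<^sup>2)"
      by (rule AE_I2) (auto simp: indicator_def)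
  qed
  then show ?thesis using um by (simp add: L2r_def)
qed

lemma solution_in_N: "sl_solution S z u \<Longrightarrow> u \<in> sl_N S z"
proof -
  assume u: "sl_solution S z u"
  have L: "u \<in> L2r S" by (rule solution_L2r[OF u])
  have ae: "AE x in lebesgue_on I. sl_tau S u x = z * u x" using u unfolding sl_solution_def ae_eq_def by blast
  have "(\<lambda>x. z * u x + 0 * u x) \<in> L2r S" by (rule L2r_linear[OF L L])
  then have "sl_tau S u \<in> L2r S" by (rule L2r_AE_cong) (use ae in eventually_elim, simp)
  then show ?thesis using u L unfolding sl_N_def dom_max_def sl_solution_def by blast
qed

end

section \<open>Wronskians at the end points and eigenspaces\<close>

context sl
begin

lemma ae_eq_onI: "(\<And>x. x \<in> I \<Longrightarrow> f x = g x) \<Longrightarrow> ae_eq S f g"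
  unfolding ae_eq_def by (rule AE_I2) simp

lemma ae_eq_on: "f \<in> dom_max S \<Longrightarrow> g \<in> dom_max S \<Longrightarrow> ae_eq S f g \<Longrightarrow> x \<in> I \<Longrightarrow> f x = g x"
  unfolding ae_eq_def
  by (rule continuous_AE_eq_imp_eq[OF open_I regular_continuous[OF dom_maxD(2)] regular_continuous[OF dom_maxD(2)]])

lemma wronsk_tendsto:
  assumes "F \<in> {end_a S, end_b S}" "f \<in> dom_max S" "g \<in> dom_max S"
  shows "(wronsk S f g \<longlongrightarrow> wronsk_at S f g F) F"
  using green(1,2)[OF assms(2,3)] assms(1) by auto

lemma end_neq_bot: "F \<in> {end_a S, end_b S} \<Longrightarrow> F \<noteq> bot"
  using end_a_neq_bot end_b_neq_bot by auto

lemma eventually_end: "F \<in> {end_a S, end_b S} \<Longrightarrow> eventually (\<lambda>x. x \<in> I) F"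
  using eventually_end_a eventually_end_b by auto

text \<open>
  The workhorse for boundary values: a Wronskian may be replaced by any function that agrees with
  it on \<open>I\<close>.
\<close>

lemma wronsk_atI:
  assumes F: "F \<in> {end_a S, end_b S}" and lim: "(w \<longlongrightarrow> L) F" and eq: "\<And>x. x \<in> I \<Longrightarrow> w x = wronsk S f g x"
  shows "wronsk_at S f g F = L"
proof -
  have "eventually (\<lambda>x. w x = wronsk S f g x) F"
    using eventually_end[OF F] by eventually_elim (rule eq)
  then have "(wronsk S f g \<longlongrightarrow> L) F" using lim tendsto_cong by blast
  then show ?thesis unfolding wronsk_at_def by (rule tendsto_Lim[OF end_neq_bot[OF F]])
qed

lemma wronsk_at_linear:
  assumes F: "F \<in> {end_a S, end_b S}" and w: "w \<in> dom_max S" and f: "f \<in> dom_max S" and g: "g \<in> dom_max S"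
  shows "wronsk_at S w (\<lambda>x. a * f x + b * g x) F = a * wronsk_at S w f F + b * wronsk_at S w g F"
proof (rule wronsk_atI[OF F])
  show "((\<lambda>x. a * wronsk S w f x + b * wronsk S w g x) \<longlongrightarrow> a * wronsk_at S w f F + b * wronsk_at S w g F) F"
    by (intro tendsto_intros wronsk_tendsto[OF F w f] wronsk_tendsto[OF F w g])
  fix x assume "x \<in> I"
  from regular_linear(2)[OF dom_maxD(2)[OF f] dom_maxD(2)[OF g] this, of a b]
  show "a * wronsk S w f x + b * wronsk S w g x = wronsk S w (\<lambda>x. a * f x + b * g x) x"
    by (simp add: wronsk_def algebra_simps)
qed

lemma wronsk_at_cnj:
  assumes F: "F \<in> {end_a S, end_b S}" and f: "f \<in> dom_max S" and g: "g \<in> dom_max S"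
  shows "wronsk_at S (\<lambda>x. cnj (f x)) (\<lambda>x. cnj (g x)) F = cnj (wronsk_at S f g F)"
proof (rule wronsk_atI[OF F])
  show "((\<lambda>x. cnj (wronsk S f g x)) \<longlongrightarrow> cnj (wronsk_at S f g F)) F"
    by (intro tendsto_intros wronsk_tendsto[OF F f g])
  fix x assume "x \<in> I"
  then show "cnj (wronsk S f g x) = wronsk S (\<lambda>x. cnj (f x)) (\<lambda>x. cnj (g x)) x"
    using regular_cnj(2)[OF dom_maxD(2)[OF f]] regular_cnj(2)[OF dom_maxD(2)[OF g]] by (simp add: wronsk_def)
qed

lemma wronsk_at_cong:
  assumes F: "F \<in> {end_a S, end_b S}" and f: "f \<in> dom_max S" and g: "g \<in> dom_max S"
    and eq: "\<And>x. x \<in> I \<Longrightarrow> f x = f' x" "\<And>x. x \<in> I \<Longrightarrow> g x = g' x"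
  shows "wronsk_at S f' g' F = wronsk_at S f g F"
proof (rule wronsk_atI[OF F wronsk_tendsto[OF F f g]])
  fix x assume x: "x \<in> I"
  have "qderiv S f' x = qderiv S f x" by (rule regular_cong(2)[OF dom_maxD(2)[OF f] _ x]) (rule eq(1))
  moreover have "qderiv S g' x = qderiv S g x" by (rule regular_cong(2)[OF dom_maxD(2)[OF g] _ x]) (rule eq(2))
  ultimately show "wronsk S f g x = wronsk S f' g' x" using eq x by (simp add: wronsk_def)
qed

lemma sl_N_dom: "f \<in> sl_N S z \<Longrightarrow> f \<in> dom_max S" by (simp add: sl_N_def)
lemma sl_N_tau: "f \<in> sl_N S z \<Longrightarrow> AE x in lebesgue_on I. sl_tau S f x = z * f x"
  by (simp add: sl_N_def ae_eq_def)

lemma sl_N_linear: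
  assumes f: "f \<in> sl_N S z" and g: "g \<in> sl_N S z"
  shows "(\<lambda>x. a * f x + b * g x) \<in> sl_N S z"
proof -
  note F = sl_N_dom[OF f] and G = sl_N_dom[OF g]
  have "AE x in lebesgue_on I. sl_tau S (\<lambda>x. a * f x + b * g x) x = z * (a * f x + b * g x)"
    using regular_linear(3)[OF dom_maxD(2)[OF F] dom_maxD(2)[OF G], of a b] sl_N_tau[OF f] sl_N_tau[OF g]
    by eventually_elim (simp add: algebra_simps)
  then show ?thesis using dom_max_linear[OF F G] by (simp add: sl_N_def ae_eq_def)
qed

lemma sl_N_cnj:
  assumes f: "f \<in> sl_N S z"
  shows "(\<lambda>x. cnj (f x)) \<in> sl_N S (cnj z)"
proof -
  note F = sl_N_dom[OF f]
  have "AE x in lebesgue_on I. sl_tau S (\<lambda>x. cnj (f x)) x = cnj z * cnj (f x)"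
    using regular_cnj(3)[OF dom_maxD(2)[OF F]] sl_N_tau[OF f] by eventually_elim simp
  then show ?thesis using dom_max_cnj[OF F] by (simp add: sl_N_def ae_eq_def)
qed

lemma lint_cong:
  fixes f g :: "real \<Rightarrow> complex"
  assumes "f \<in> borel_measurable \<mu>" "AE x in lebesgue_on I. f x = g x"
  shows "(LINT x|\<mu>. f x) = (LINT x|\<mu>. g x)"
proof (rule integral_cong_AE[OF assms(1) _ AE_mu[OF assms(2)]])
  show "g \<in> borel_measurable \<mu>" using measurable_AE_cong[OF _ assms(2)] assms(1) unfolding measurable_mu .
qed

lemma green_N:
  assumes f: "f \<in> sl_N S z" and g: "g \<in> sl_N S w"
  shows "(z - w) * (LINT x|\<mu>. f x * g x) = wronsk_at S f g (end_b S) - wronsk_at S f g (end_a S)"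
proof -
  note F = sl_N_dom[OF f] and G = sl_N_dom[OF g]
  have m: "integrable \<mu> (\<lambda>x. sl_tau S f x * g x - f x * sl_tau S g x)"
    by (intro Bochner_Integration.integrable_diff L2r_mult_integrable dom_maxD[OF F] dom_maxD[OF G])
  have "(LINT x|\<mu>. sl_tau S f x * g x - f x * sl_tau S g x) = (LINT x|\<mu>. (z - w) * (f x * g x))"
    by (rule lint_cong[OF borel_measurable_integrable[OF m]])
      (use sl_N_tau[OF f] sl_N_tau[OF g] in eventually_elim, simp add: algebra_simps)
  then show ?thesis using green(3)[OF F G] by simp
qed

section \<open>The weighted inner product\<close>

lemma inner_linear_right:
  assumes "f \<in> L2r S" "g \<in> L2r S" "h \<in> L2r S"
  shows "L2r_inner S h (\<lambda>x. a * f x + b * g x) = a * L2r_inner S h f + b * L2r_inner S h g"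
proof -
  have i: "integrable \<mu> (\<lambda>x. cnj (h x) * f x)" "integrable \<mu> (\<lambda>x. cnj (h x) * g x)"
    by (intro L2r_mult_integrable L2r_cnj assms)+
  have "L2r_inner S h (\<lambda>x. a * f x + b * g x) = (LINT x|\<mu>. a * (cnj (h x) * f x) + b * (cnj (h x) * g x))"
    unfolding L2r_inner_def by (simp add: algebra_simps)
  also have "\<dots> = a * (LINT x|\<mu>. cnj (h x) * f x) + b * (LINT x|\<mu>. cnj (h x) * g x)"
    using i by (subst Bochner_Integration.integral_add) auto
  finally show ?thesis unfolding L2r_inner_def .
qed

lemma inner_cnj: "L2r_inner S g f = cnj (L2r_inner S f g)"
proof -
  have "cnj (L2r_inner S f g) = (LINT x|\<mu>. cnj (cnj (f x) * g x))"
    unfolding L2r_inner_def by (rule Bochner_Integration.integral_cnj[symmetric])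
  then show ?thesis unfolding L2r_inner_def by (simp add: mult.commute)
qed

lemma inner_linear_left:
  assumes "f \<in> L2r S" "g \<in> L2r S" "h \<in> L2r S"
  shows "L2r_inner S (\<lambda>x. a * f x + b * g x) h = cnj a * L2r_inner S f h + cnj b * L2r_inner S g h"
proof -
  have "L2r_inner S (\<lambda>x. a * f x + b * g x) h = cnj (L2r_inner S h (\<lambda>x. a * f x + b * g x))" by (rule inner_cnj)
  also have "\<dots> = cnj a * cnj (L2r_inner S h f) + cnj b * cnj (L2r_inner S h g)"
    by (simp add: inner_linear_right[OF assms])
  finally show ?thesis using inner_cnj[of f h] inner_cnj[of g h] by simp
qed

lemma inner_cong_right:
  assumes "h \<in> L2r S" "f \<in> L2r S" "\<And>x. x \<in> I \<Longrightarrow> f x = g x"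
  shows "L2r_inner S h g = L2r_inner S h f"
  unfolding L2r_inner_def
proof (rule lint_cong[symmetric])
  show "(\<lambda>x. cnj (h x) * f x) \<in> borel_measurable \<mu>"
    by (rule borel_measurable_integrable[OF L2r_mult_integrable[OF L2r_cnj[OF assms(1)] assms(2)]])
  show "AE x in lebesgue_on I. cnj (h x) * f x = cnj (h x) * g x" by (rule AE_I2) (use assms(3) in simp)
qed

lemma inner_cong_left:
  assumes "h \<in> L2r S" "f \<in> L2r S" "\<And>x. x \<in> I \<Longrightarrow> f x = g x"
  shows "L2r_inner S g h = L2r_inner S f h"
proof -
  have "L2r_inner S h g = L2r_inner S h f" by (rule inner_cong_right[OF assms(1,2)]) (rule assms(3))
  then show ?thesis using inner_cnj[of g h] inner_cnj[of f h] by simp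
qed

lemma inner_self: "L2r_inner S f f = of_real ((L2r_norm S f)\<^sup>2)"
proof -
  have nn: "0 \<le> (LINT x|\<mu>. (cmod (f x))\<^sup>2)" by (rule integral_nonneg_AE) simp
  have "L2r_inner S f f = (LINT x|\<mu>. complex_of_real ((cmod (f x))\<^sup>2))"
    unfolding L2r_inner_def by (rule Bochner_Integration.integral_cong, simp, subst complex_norm_square, rule mult.commute)
  also have "\<dots> = of_real (LINT x|\<mu>. (cmod (f x))\<^sup>2)" by (rule integral_complex_of_real)
  finally show ?thesis unfolding L2r_norm_def using nn by simp
qed

lemma inner_self_zero:
  assumes f: "f \<in> dom_max S" and z: "L2r_inner S f f = 0" and x: "x \<in> I"
  shows "f x = 0"
proof -
  have "L2r_norm S f = 0" using z unfolding inner_self by simp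
  then have "(LINT x|\<mu>. (cmod (f x))\<^sup>2) = 0" unfolding L2r_norm_def by simp
  moreover have "integrable \<mu> (\<lambda>x. (cmod (f x))\<^sup>2)" using dom_maxD(1)[OF f] by (simp add: L2r_def)
  ultimately have "AE x in \<mu>. (cmod (f x))\<^sup>2 = 0" by (subst integral_nonneg_eq_0_iff_AE[symmetric]) auto
  then have "AE x in lebesgue_on I. f x = 0" using AE_mu_D[of "\<lambda>x. (cmod (f x))\<^sup>2 = 0"] by simp
  then show ?thesis
    by (intro continuous_AE_eq_imp_eq[OF open_I regular_continuous[OF dom_maxD(2)[OF f]] continuous_on_const _ x])
qed

end

section \<open>Generalized boundary values\<close>

locale sl_frame = sl_limit_circle +
  fixes v :: "(real \<Rightarrow> complex) \<times> (real \<Rightarrow> complex)"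
  assumes frame: "boundary_frame S v"
begin

lemma v_dom: "fst v \<in> dom_max S" "snd v \<in> dom_max S"
  using frame unfolding boundary_frame_def by blast+

lemma v_real: "x \<in> I \<Longrightarrow> cnj (fst v x) = fst v x" "x \<in> I \<Longrightarrow> cnj (snd v x) = snd v x"
  using frame unfolding boundary_frame_def by (auto simp: Reals_cnj_iff)

lemma v_wronsk: "F \<in> {end_a S, end_b S} \<Longrightarrow> wronsk_at S (fst v) (snd v) F = 1"
  using frame unfolding boundary_frame_def by auto

lemma gbv_linear:
  assumes "F \<in> {end_a S, end_b S}" "f \<in> dom_max S" "g \<in> dom_max S"
  shows "gbv S v (\<lambda>x. a * f x + b * g x) F = a * gbv S v f F + b * gbv S v g F"
    "gbv' S v (\<lambda>x. a * f x + b * g x) F = a * gbv' S v f F + b * gbv' S v g F"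
  using wronsk_at_linear[OF assms(1) v_dom(1) assms(2,3)] wronsk_at_linear[OF assms(1) v_dom(2) assms(2,3)]
  by (simp_all add: gbv_def gbv'_def)

lemma gbv_cong:
  assumes "F \<in> {end_a S, end_b S}" "f \<in> dom_max S" "\<And>x. x \<in> I \<Longrightarrow> f x = g x"
  shows "gbv S v g F = gbv S v f F" "gbv' S v g F = gbv' S v f F"
proof -
  have "wronsk_at S (fst v) g F = wronsk_at S (fst v) f F"
    by (rule wronsk_at_cong[OF assms(1) v_dom(1) assms(2)]) (simp_all add: assms(3))
  moreover have "wronsk_at S (snd v) g F = wronsk_at S (snd v) f F"
    by (rule wronsk_at_cong[OF assms(1) v_dom(2) assms(2)]) (simp_all add: assms(3))
  ultimately show "gbv S v g F = gbv S v f F" "gbv' S v g F = gbv' S v f F" by (simp_all add: gbv_def gbv'_def)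
qed

lemma gbv_cnj:
  assumes F: "F \<in> {end_a S, end_b S}" and f: "f \<in> dom_max S"
  shows "gbv S v (\<lambda>x. cnj (f x)) F = cnj (gbv S v f F)" "gbv' S v (\<lambda>x. cnj (f x)) F = cnj (gbv' S v f F)"
proof -
  have "wronsk_at S (fst v) (\<lambda>x. cnj (f x)) F = wronsk_at S (\<lambda>x. cnj (fst v x)) (\<lambda>x. cnj (f x)) F"
    by (rule wronsk_at_cong[OF F dom_max_cnj[OF v_dom(1)] dom_max_cnj[OF f]]) (simp_all add: v_real)
  moreover have "wronsk_at S (snd v) (\<lambda>x. cnj (f x)) F = wronsk_at S (\<lambda>x. cnj (snd v x)) (\<lambda>x. cnj (f x)) F"
    by (rule wronsk_at_cong[OF F dom_max_cnj[OF v_dom(2)] dom_max_cnj[OF f]]) (simp_all add: v_real)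
  ultimately show "gbv S v (\<lambda>x. cnj (f x)) F = cnj (gbv S v f F)" "gbv' S v (\<lambda>x. cnj (f x)) F = cnj (gbv' S v f F)"
    using wronsk_at_cnj[OF F v_dom(1) f] wronsk_at_cnj[OF F v_dom(2) f] by (simp_all add: gbv_def gbv'_def)
qed

text \<open>
  At an end point the Wronskian of two functions is the symplectic form of their generalized
  boundary values. This is the Pluecker identity for the \<open>2 \<times> 2\<close> minors of four vectors, applied
  to \<open>v\<^sub>1\<close>, \<open>v\<^sub>2\<close>, \<open>f\<close>, \<open>g\<close> and passed to the limit.
\<close>

lemma pluecker:
  assumes F: "F \<in> {end_a S, end_b S}" and f: "f \<in> dom_max S" and g: "g \<in> dom_max S"
  shows "wronsk_at S f g F = gbv S v f F * gbv' S v g F - gbv' S v f F * gbv S v g F"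
proof -
  let ?W = "wronsk S"
  have "((\<lambda>x. ?W f g x * ?W (fst v) (snd v) x) \<longlongrightarrow> wronsk_at S f g F * wronsk_at S (fst v) (snd v) F) F"
    by (intro tendsto_mult wronsk_tendsto[OF F] v_dom f g)
  moreover have "((\<lambda>x. ?W (fst v) f x * ?W (snd v) g x - ?W (snd v) f x * ?W (fst v) g x) \<longlongrightarrow>
      wronsk_at S (fst v) f F * wronsk_at S (snd v) g F - wronsk_at S (snd v) f F * wronsk_at S (fst v) g F) F"
    by (intro tendsto_intros wronsk_tendsto[OF F] v_dom f g)
  moreover have "(\<lambda>x. ?W f g x * ?W (fst v) (snd v) x) =
      (\<lambda>x. ?W (fst v) f x * ?W (snd v) g x - ?W (snd v) f x * ?W (fst v) g x)"
    by (simp add: fun_eq_iff wronsk_def algebra_simps)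
  ultimately have "wronsk_at S f g F * wronsk_at S (fst v) (snd v) F =
     wronsk_at S (fst v) f F * wronsk_at S (snd v) g F - wronsk_at S (snd v) f F * wronsk_at S (fst v) g F"
    using tendsto_unique[OF end_neq_bot[OF F]] by simp
  then show ?thesis unfolding v_wronsk[OF F] by (simp add: gbv_def gbv'_def algebra_simps)
qed

abbreviation "ga f \<equiv> gbv S v f (end_a S)"
abbreviation "gb f \<equiv> gbv S v f (end_b S)"
abbreviation "ga' f \<equiv> gbv' S v f (end_a S)"
abbreviation "gb' f \<equiv> gbv' S v f (end_b S)"

lemma g_linear:
  assumes "f \<in> dom_max S" "g \<in> dom_max S"
  shows "ga (\<lambda>x. a * f x + b * g x) = a * ga f + b * ga g" "gb (\<lambda>x. a * f x + b * g x) = a * gb f + b * gb g"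
    "ga' (\<lambda>x. a * f x + b * g x) = a * ga' f + b * ga' g" "gb' (\<lambda>x. a * f x + b * g x) = a * gb' f + b * gb' g"
  by (simp_all add: gbv_linear assms)

lemma g_cong:
  assumes "f \<in> dom_max S" "\<And>x. x \<in> I \<Longrightarrow> f x = g x"
  shows "ga g = ga f" "gb g = gb f" "ga' g = ga' f" "gb' g = gb' f"
  using gbv_cong[of "end_a S" f g] gbv_cong[of "end_b S" f g] assms by simp_all

text \<open>
  The difference of the boundary terms at \<open>b\<close> and at \<open>a\<close> in Green's formula.
\<close>

definition boundary_form :: "(real \<Rightarrow> complex) \<Rightarrow> (real \<Rightarrow> complex) \<Rightarrow> complex" where
  "boundary_form f g = (gb f * gb' g - gb' f * gb g) - (ga f * ga' g - ga' f * ga g)"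

lemma green_boundary_form:
  assumes "f \<in> sl_N S z" "g \<in> sl_N S w"
  shows "(z - w) * (LINT x|\<mu>. f x * g x) = boundary_form f g"
  unfolding boundary_form_def green_N[OF assms]
  by (simp add: pluecker sl_N_dom[OF assms(1)] sl_N_dom[OF assms(2)])

text \<open>
  An eigenfunction for a nonreal eigenvalue vanishes as soon as the boundary form of its conjugate
  with it does, since the boundary form is a nonzero multiple of the square of its norm.
\<close>

lemma sl_N_zero:
  assumes u: "u \<in> sl_N S z" and z: "z \<notin> \<real>" and b: "boundary_form (\<lambda>x. cnj (u x)) u = 0" and x: "x \<in> I"
  shows "u x = 0"
proof (rule inner_self_zero[OF sl_N_dom[OF u] _ x])
  have "cnj z - z \<noteq> 0" using z by (simp add: Reals_cnj_iff)
  then show "L2r_inner S u u = 0"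
    using green_boundary_form[OF sl_N_cnj[OF u] u] b unfolding L2r_inner_def by simp
qed

lemma sl_N_zero_dirichlet:
  assumes u: "u \<in> sl_N S z" and z: "z \<notin> \<real>" and b: "ga u = 0" "gb u = 0" and x: "x \<in> I"
  shows "u x = 0"
  by (rule sl_N_zero[OF u z _ x]) (simp add: boundary_form_def gbv_cnj sl_N_dom[OF u] b)

text \<open>
  Two solutions with independent initial data span a two-dimensional space, on which the pair of
  boundary values is injective by uniqueness, hence bijective.
\<close>

lemma dirichlet_exists:
  assumes z: "z \<notin> \<real>"
  shows "\<exists>u. sl_solution S z u \<and> ga u = \<alpha> \<and> gb u = \<beta>"
proof -
  obtain c where c: "c \<in> I" using nonempty_I by blast
  obtain s where s: "sl_solution S z s" "s c = 1" "qderiv S s c = 0" by (rule solution_exists[OF c])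
  obtain t where t: "sl_solution S z t" "t c = 0" "qderiv S t c = 1" by (rule solution_exists[OF c])
  have sN: "s \<in> sl_N S z" and tN: "t \<in> sl_N S z" using s(1) t(1) by (auto intro: solution_in_N)
  note sd = sl_N_dom[OF sN] and td = sl_N_dom[OF tN]
  have indep: "x = 0 \<and> y = 0" if "x * ga s + y * ga t = 0" "x * gb s + y * gb t = 0" for x y
  proof -
    have N: "(\<lambda>r. x * s r + y * t r) \<in> sl_N S z" by (rule sl_N_linear[OF sN tN])
    have zero: "x * s r + y * t r = 0" if "r \<in> I" for r
      by (rule sl_N_zero_dirichlet[OF N z _ _ that]) (simp_all add: g_linear[OF sd td] \<open>x * ga s + y * ga t = 0\<close> \<open>x * gb s + y * gb t = 0\<close>)
    have "qderiv S (\<lambda>r. 0 * s r + 0 * s r) c = qderiv S (\<lambda>r. x * s r + y * t r) c"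
      by (rule regular_cong(2)[OF dom_maxD(2)[OF sl_N_dom[OF N]] _ c]) (simp add: zero)
    then have "x * qderiv S s c + y * qderiv S t c = 0"
      using regular_linear(2)[OF dom_maxD(2)[OF sd] dom_maxD(2)[OF td] c, of x y]
        regular_linear(2)[OF dom_maxD(2)[OF sd] dom_maxD(2)[OF sd] c, of 0 0] by simp
    then show ?thesis using zero[OF c] s t by simp
  qed
  define d where "d = ga s * gb t - ga t * gb s"
  have "d \<noteq> 0"
  proof
    assume d: "d = 0"
    have "gb t = 0 \<and> - gb s = 0" by (rule indep) (use d in \<open>simp_all add: d_def algebra_simps\<close>)
    moreover have "ga t = 0 \<and> - ga s = 0" by (rule indep) (use d in \<open>simp_all add: d_def algebra_simps\<close>)
    ultimately have "(1::complex) = 0 \<and> (0::complex) = 0" by (intro indep) simp_all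
    then show False by simp
  qed
  define u where "u = (\<lambda>r. ((\<alpha> * gb t - \<beta> * ga t) / d) * s r + ((\<beta> * ga s - \<alpha> * gb s) / d) * t r)"
  have "u \<in> sl_N S z" unfolding u_def by (rule sl_N_linear[OF sN tN])
  then have "sl_solution S z u" unfolding sl_N_def sl_solution_def dom_max_def by blast
  moreover have "ga u = \<alpha>"
  proof -
    have "\<alpha> * d = (\<alpha> * gb t - \<beta> * ga t) * ga s + (\<beta> * ga s - \<alpha> * gb s) * ga t"
      by (simp add: d_def algebra_simps)
    then have "ga u = (\<alpha> * d) / d" unfolding u_def g_linear[OF sd td] by (simp add: add_divide_distrib)
    then show ?thesis using \<open>d \<noteq> 0\<close> by simp
  qed
  moreover have "gb u = \<beta>"
  proof -
    have "\<beta> * d = (\<alpha> * gb t - \<beta> * ga t) * gb s + (\<beta> * ga s - \<alpha> * gb s) * gb t"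
      by (simp add: d_def algebra_simps)
    then have "gb u = (\<beta> * d) / d" unfolding u_def g_linear[OF sd td] by (simp add: add_divide_distrib)
    then show ?thesis using \<open>d \<noteq> 0\<close> by simp
  qed
  ultimately show ?thesis by blast
qed

abbreviation "u1 z \<equiv> sl_u S v 1 z"
abbreviation "u2 z \<equiv> sl_u S v 2 z"

lemma two_neq_one: "(2::2) \<noteq> 1" by simp

lemma sl_u_props:
  assumes z: "z \<notin> \<real>"
  shows "sl_solution S z (sl_u S v j z)" "ga (sl_u S v j z) = (if j = 1 then 0 else 1)"
    "gb (sl_u S v j z) = (if j = 1 then 1 else 0)"
proof -
  let ?P = "\<lambda>u. sl_solution S z u \<and> ga u = (if j = 1 then 0 else 1) \<and> gb u = (if j = 1 then 1 else 0)"
  have "?P (SOME u. ?P u)" by (rule someI_ex[OF dirichlet_exists[OF z]])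
  then have "?P (sl_u S v j z)" unfolding sl_u_def .
  then show "sl_solution S z (sl_u S v j z)" "ga (sl_u S v j z) = (if j = 1 then 0 else 1)"
    "gb (sl_u S v j z) = (if j = 1 then 1 else 0)" by blast+
qed

lemma u_N: "z \<notin> \<real> \<Longrightarrow> sl_u S v j z \<in> sl_N S z"
  by (rule solution_in_N[OF sl_u_props(1)])

lemma u_dom: "z \<notin> \<real> \<Longrightarrow> sl_u S v j z \<in> dom_max S"
  by (rule sl_N_dom[OF u_N])

lemma u_bv:
  assumes "z \<notin> \<real>"
  shows "ga (u1 z) = 0" "gb (u1 z) = 1" "ga (u2 z) = 1" "gb (u2 z) = 0"
    "ga' (u1 z) = u'_a S v 1 z" "gb' (u1 z) = u'_b S v 1 z" "ga' (u2 z) = u'_a S v 2 z" "gb' (u2 z) = u'_b S v 2 z"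
  using sl_u_props(2,3)[OF assms, of 1] sl_u_props(2,3)[OF assms, of 2] by (simp_all add: u'_a_def u'_b_def)

lemma N_expand:
  assumes z: "z \<notin> \<real>" and f: "f \<in> sl_N S z" and x: "x \<in> I"
  shows "f x = gb f * u1 z x + ga f * u2 z x"
proof -
  let ?h = "\<lambda>x. gb f * u1 z x + ga f * u2 z x"
  have h: "?h \<in> sl_N S z" by (rule sl_N_linear[OF u_N[OF z] u_N[OF z]])
  have d: "(\<lambda>x. 1 * f x + (-1) * ?h x) \<in> sl_N S z" by (rule sl_N_linear[OF f h])
  have "1 * f x + (-1) * ?h x = 0"
    by (rule sl_N_zero_dirichlet[OF d z _ _ x])
      (simp_all only: g_linear[OF sl_N_dom[OF f] sl_N_dom[OF h]] g_linear[OF u_dom[OF z] u_dom[OF z]] u_bv[OF z], simp_all)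
  then have "f x - ?h x = 0" by (simp add: algebra_simps)
  then show ?thesis by simp
qed

lemma cnj_not_real: "z \<notin> \<real> \<Longrightarrow> cnj z \<notin> \<real>"
  by (metis Reals_cnj_iff complex_cnj_cnj)

lemma u_cnj:
  assumes z: "z \<notin> \<real>" and x: "x \<in> I"
  shows "cnj (sl_u S v j z x) = sl_u S v j (cnj z) x"
proof -
  have "cnj (sl_u S v j z x) = gb (\<lambda>x. cnj (sl_u S v j z x)) * u1 (cnj z) x + ga (\<lambda>x. cnj (sl_u S v j z x)) * u2 (cnj z) x"
    by (rule N_expand[OF cnj_not_real[OF z] sl_N_cnj[OF u_N[OF z]] x])
  then show ?thesis
    using exhaust_2[of j] by (auto simp: gbv_cnj u_dom[OF z] u_bv[OF z])
qed

lemma u'_cnj: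
  assumes z: "z \<notin> \<real>"
  shows "u'_a S v j (cnj z) = cnj (u'_a S v j z)" "u'_b S v j (cnj z) = cnj (u'_b S v j z)"
proof -
  have "ga' (sl_u S v j (cnj z)) = ga' (\<lambda>x. cnj (sl_u S v j z x))"
    by (rule g_cong(3)[OF dom_max_cnj[OF u_dom[OF z]]]) (rule u_cnj[OF z])
  then show "u'_a S v j (cnj z) = cnj (u'_a S v j z)" by (simp add: u'_a_def gbv_cnj u_dom[OF z])
  have "gb' (sl_u S v j (cnj z)) = gb' (\<lambda>x. cnj (sl_u S v j z x))"
    by (rule g_cong(4)[OF dom_max_cnj[OF u_dom[OF z]]]) (rule u_cnj[OF z])
  then show "u'_b S v j (cnj z) = cnj (u'_b S v j z)" by (simp add: u'_b_def gbv_cnj u_dom[OF z])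
qed

text \<open>
  The Wronskian of \<open>u\<^sub>1(z,\<cdot>)\<close> and \<open>u\<^sub>2(z,\<cdot>)\<close> has the same value at both end points.
\<close>

lemma u'_symmetric:
  assumes z: "z \<notin> \<real>"
  shows "u'_b S v 2 z = - u'_a S v 1 z"
proof -
  have "boundary_form (u1 z) (u2 z) = 0" using green_boundary_form[OF u_N[OF z, of 1] u_N[OF z, of 2]] by simp
  then show ?thesis by (simp add: boundary_form_def u_bv[OF z] add_eq_0_iff)
qed


section \<open>The orthonormal basis and the orthogonal projection\<close>

lemma i_not_real: "\<i> \<notin> \<real>" "- \<i> \<notin> \<real>"
  by (auto simp: complex_is_Real_iff)

lemma u_L2r: "z \<notin> \<real> \<Longrightarrow> sl_u S v j z \<in> L2r S"
  by (rule dom_maxD(1)[OF u_dom])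

lemma inner_u_left:
  assumes z: "z \<notin> \<real>" and f: "f \<in> L2r S"
  shows "L2r_inner S (sl_u S v j z) f = (LINT x|\<mu>. sl_u S v j (cnj z) x * f x)"
  unfolding L2r_inner_def
proof (rule lint_cong)
  show "(\<lambda>x. cnj (sl_u S v j z x) * f x) \<in> borel_measurable \<mu>"
    by (rule borel_measurable_integrable[OF L2r_mult_integrable[OF L2r_cnj[OF u_L2r[OF z]] f]])
  show "AE x in lebesgue_on I. cnj (sl_u S v j z x) * f x = sl_u S v j (cnj z) x * f x"
    by (rule AE_I2) (simp add: u_cnj[OF z])
qed

lemma inner_u_eq:
  assumes z: "z \<notin> \<real>" and f: "f \<in> sl_N S w"
  shows "(cnj z - w) * L2r_inner S (sl_u S v j z) f = boundary_form (sl_u S v j (cnj z)) f"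
  unfolding inner_u_left[OF z dom_maxD(1)[OF sl_N_dom[OF f]]]
  by (rule green_boundary_form[OF u_N[OF cnj_not_real[OF z]] f])

text \<open>
  The inner products that make up the matrix \<^const>\<open>W_Kr\<close>.
\<close>

lemma inner_u_i:
  assumes z: "z \<notin> \<real>"
  shows "(- \<i> - z) * L2r_inner S (u1 \<i>) (u1 z) = u'_b S v 1 z - u'_b S v 1 (- \<i>)"
    "(- \<i> - z) * L2r_inner S (u1 \<i>) (u2 z) = u'_b S v 2 z + u'_a S v 1 (- \<i>)"
    "(- \<i> - z) * L2r_inner S (u2 \<i>) (u1 z) = - u'_b S v 2 (- \<i>) - u'_a S v 1 z"
    "(- \<i> - z) * L2r_inner S (u2 \<i>) (u2 z) = - u'_a S v 2 z + u'_a S v 2 (- \<i>)"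
  using inner_u_eq[OF i_not_real(1) u_N[OF z]]
  by (simp_all add: boundary_form_def u_bv[OF z] u_bv[OF i_not_real(2)])

lemma im_identity: "w - cnj w = 2 * \<i> * of_real (Im w)"
  by (simp add: complex_eq_iff)

lemma basis_ip:
  shows "L2r_inner S (u1 \<i>) (u1 \<i>) = - of_real (Im (u'_b S v 1 \<i>))"
    "L2r_inner S (u1 \<i>) (u2 \<i>) = - of_real (Im (u'_b S v 2 \<i>))"
proof -
  have c: "u'_b S v 1 (- \<i>) = cnj (u'_b S v 1 \<i>)" "u'_a S v 1 (- \<i>) = cnj (u'_a S v 1 \<i>)"
    using u'_cnj[OF i_not_real(1), of 1] by simp_all
  have "(- \<i> - \<i>) * L2r_inner S (u1 \<i>) (u1 \<i>) = 2 * \<i> * of_real (Im (u'_b S v 1 \<i>))"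
    using inner_u_i(1)[OF i_not_real(1)] im_identity[of "u'_b S v 1 \<i>"] by (simp add: c)
  then show "L2r_inner S (u1 \<i>) (u1 \<i>) = - of_real (Im (u'_b S v 1 \<i>))" by (simp add: complex_eq_iff)
  have "cnj (u'_a S v 1 \<i>) = - cnj (u'_b S v 2 \<i>)" using u'_symmetric[OF i_not_real(1)] by simp
  then have "(- \<i> - \<i>) * L2r_inner S (u1 \<i>) (u2 \<i>) = 2 * \<i> * of_real (Im (u'_b S v 2 \<i>))"
    using inner_u_i(2)[OF i_not_real(1)] im_identity[of "u'_b S v 2 \<i>"] by (simp add: c)
  then show "L2r_inner S (u1 \<i>) (u2 \<i>) = - of_real (Im (u'_b S v 2 \<i>))" by (simp add: complex_eq_iff)
qed

text \<open>
  The part of \<open>u\<^sub>2(\<i>,\<cdot>)\<close> orthogonal to \<open>u\<^sub>1(\<i>,\<cdot>)\<close>.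
\<close>

definition u2_perp :: "real \<Rightarrow> complex" where
  "u2_perp = (\<lambda>x. u2 \<i> x - of_real (kappa S v) * u1 \<i> x)"

lemma u2_perp_alt: "u2_perp = (\<lambda>x. 1 * u2 \<i> x + (- of_real (kappa S v)) * u1 \<i> x)"
  by (simp add: u2_perp_def fun_eq_iff)

lemma u2_perp_N: "u2_perp \<in> sl_N S \<i>"
  unfolding u2_perp_alt by (rule sl_N_linear[OF u_N[OF i_not_real(1)] u_N[OF i_not_real(1)]])

lemma u2_perp_L2r: "u2_perp \<in> L2r S" by (rule dom_maxD(1)[OF sl_N_dom[OF u2_perp_N]])

lemma N_nontrivial:
  assumes f: "f \<in> sl_N S \<i>" and "ga f \<noteq> 0 \<or> gb f \<noteq> 0"
  shows "L2r_norm S f \<noteq> 0"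
proof
  assume "L2r_norm S f = 0"
  then have ip: "L2r_inner S f f = 0" unfolding inner_self by simp
  have "f x = 0" if "x \<in> I" for x by (rule inner_self_zero[OF sl_N_dom[OF f] ip that])
  then have "f x = 0 * f x + 0 * f x" if "x \<in> I" for x using that by simp
  from g_cong(1,2)[OF sl_N_dom[OF f] this] have "ga f = 0 \<and> gb f = 0"
    using g_linear(1,2)[OF sl_N_dom[OF f] sl_N_dom[OF f], of 0 0] by simp
  with assms show False by blast
qed

lemma u2_perp_bv: "ga u2_perp = 1"
  unfolding u2_perp_alt g_linear[OF u_dom[OF i_not_real(1)] u_dom[OF i_not_real(1)]] by (simp add: u_bv[OF i_not_real(1)])

lemma norms_nz: "L2r_norm S (u1 \<i>) \<noteq> 0" "L2r_norm S u2_perp \<noteq> 0"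
  using N_nontrivial[OF u_N[OF i_not_real(1), of 1]] N_nontrivial[OF u2_perp_N] u2_perp_bv u_bv(2)[OF i_not_real(1)] by simp_all

lemma u1_u2_perp_orth: "L2r_inner S (u1 \<i>) u2_perp = 0" "L2r_inner S u2_perp (u1 \<i>) = 0"
proof -
  have nz: "Im (u'_b S v 1 \<i>) \<noteq> 0"
  proof
    assume "Im (u'_b S v 1 \<i>) = 0"
    then have "L2r_inner S (u1 \<i>) (u1 \<i>) = 0" using basis_ip(1) by simp
    then show False using norms_nz(1) unfolding inner_self by simp
  qed
  have "L2r_inner S (u1 \<i>) u2_perp = 1 * L2r_inner S (u1 \<i>) (u2 \<i>) + (- of_real (kappa S v)) * L2r_inner S (u1 \<i>) (u1 \<i>)"
    unfolding u2_perp_alt by (intro inner_linear_right u_L2r i_not_real)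
  also have "\<dots> = 0" unfolding basis_ip kappa_def using nz by simp
  finally show *: "L2r_inner S (u1 \<i>) u2_perp = 0" .
  show "L2r_inner S u2_perp (u1 \<i>) = 0" using * inner_cnj[of u2_perp "u1 \<i>"] by simp
qed

abbreviation "vb j \<equiv> v_basis S v j"

lemma vb_alt: "vb 1 = (\<lambda>x. of_real (c1 S v) * u1 \<i> x + 0 * u2_perp x)" "vb 2 = (\<lambda>x. 0 * u1 \<i> x + of_real (c2 S v) * u2_perp x)"
  by (simp_all add: v_basis_def u2_perp_def fun_eq_iff)

lemma c_eq: "c1 S v = 1 / L2r_norm S (u1 \<i>)" "c2 S v = 1 / L2r_norm S u2_perp"
  by (simp_all add: c1_def c2_def u2_perp_def)

lemma c_nz: "c1 S v \<noteq> 0" "c2 S v \<noteq> 0"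
  using norms_nz by (simp_all add: c_eq)

lemma vb_N: "vb j \<in> sl_N S \<i>"
proof -
  have "vb 1 \<in> sl_N S \<i>" "vb 2 \<in> sl_N S \<i>"
    unfolding vb_alt by (intro sl_N_linear u_N[OF i_not_real(1)] u2_perp_N)+
  then show ?thesis using exhaust_2[of j] by metis
qed

lemma vb_L2r: "vb j \<in> L2r S" by (rule dom_maxD(1)[OF sl_N_dom[OF vb_N]])

lemma vb_inner:
  assumes f: "f \<in> L2r S"
  shows "L2r_inner S (vb 1) f = of_real (c1 S v) * L2r_inner S (u1 \<i>) f"
    "L2r_inner S (vb 2) f = of_real (c2 S v) * (L2r_inner S (u2 \<i>) f - of_real (kappa S v) * L2r_inner S (u1 \<i>) f)"
    "L2r_inner S (vb 2) f = of_real (c2 S v) * L2r_inner S u2_perp f"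
proof -
  note u = u_L2r[OF i_not_real(1)]
  show "L2r_inner S (vb 1) f = of_real (c1 S v) * L2r_inner S (u1 \<i>) f"
    unfolding vb_alt inner_linear_left[OF u u2_perp_L2r f] by simp
  show 2: "L2r_inner S (vb 2) f = of_real (c2 S v) * L2r_inner S u2_perp f"
    unfolding vb_alt inner_linear_left[OF u u2_perp_L2r f] by simp
  have "L2r_inner S u2_perp f = L2r_inner S (u2 \<i>) f - of_real (kappa S v) * L2r_inner S (u1 \<i>) f"
    unfolding u2_perp_alt inner_linear_left[OF u u f] by simp
  with 2 show "L2r_inner S (vb 2) f = of_real (c2 S v) * (L2r_inner S (u2 \<i>) f - of_real (kappa S v) * L2r_inner S (u1 \<i>) f)" by simp
qed

lemma vb_orthonormal: "L2r_inner S (vb j) (vb k) = (if j = k then 1 else 0)"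
proof -
  note u = u_L2r[OF i_not_real(1)]
  have 1: "L2r_inner S (u1 \<i>) (vb 1) = of_real (c1 S v) * L2r_inner S (u1 \<i>) (u1 \<i>)"
    "L2r_inner S (u1 \<i>) (vb 2) = 0" "L2r_inner S u2_perp (vb 1) = 0"
    "L2r_inner S u2_perp (vb 2) = of_real (c2 S v) * L2r_inner S u2_perp u2_perp"
    unfolding vb_alt by (subst inner_linear_right, intro u, rule u2_perp_L2r, (intro u u2_perp_L2r)?, simp add: u1_u2_perp_orth)+
  have "L2r_inner S (vb 1) (vb 1) = 1" "L2r_inner S (vb 1) (vb 2) = 0"
    "L2r_inner S (vb 2) (vb 1) = 0" "L2r_inner S (vb 2) (vb 2) = 1"
    unfolding vb_inner(1,3)[OF vb_L2r] 1 unfolding inner_self c_eq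
    using norms_nz by (simp_all add: power2_eq_square)
  then show ?thesis using exhaust_2[of j] exhaust_2[of k] by (auto simp: two_neq_one)
qed

lemma N_expand_basis:
  assumes f: "f \<in> sl_N S \<i>" and x: "x \<in> I"
  shows "f x = (\<Sum>l\<in>UNIV. L2r_inner S (vb l) f * vb l x)"
proof -
  define a where "a = (gb f + of_real (kappa S v) * ga f) / of_real (c1 S v)"
  define b where "b = ga f / of_real (c2 S v)"
  have fx: "f y = a * vb 1 y + b * vb 2 y" if "y \<in> I" for y
  proof -
    have "f y = gb f * u1 \<i> y + ga f * u2 \<i> y" by (rule N_expand[OF i_not_real(1) f that])
    also have "\<dots> = (gb f + of_real (kappa S v) * ga f) * u1 \<i> y + ga f * u2_perp y"
      by (simp add: u2_perp_def algebra_simps)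
    also have "\<dots> = a * vb 1 y + b * vb 2 y" unfolding vb_alt a_def b_def using c_nz by simp
    finally show ?thesis .
  qed
  have "L2r_inner S (vb l) f = a * L2r_inner S (vb l) (vb 1) + b * L2r_inner S (vb l) (vb 2)" for l
  proof -
    have "L2r_inner S (vb l) f = L2r_inner S (vb l) (\<lambda>y. a * vb 1 y + b * vb 2 y)"
      by (rule inner_cong_right[OF vb_L2r L2r_linear[OF vb_L2r vb_L2r]]) (simp add: fx)
    then show ?thesis by (simp add: inner_linear_right vb_L2r)
  qed
  then have "L2r_inner S (vb 1) f = a" "L2r_inner S (vb 2) f = b" by (simp_all add: vb_orthonormal)
  then show ?thesis using fx[OF x] by (simp add: sum_2)
qed

lemma orth_proj_on:
  assumes f: "f \<in> L2r S"
  shows "orth_proj S (sl_N S \<i>) f \<in> sl_N S \<i>"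
    "x \<in> I \<Longrightarrow> orth_proj S (sl_N S \<i>) f x = (\<Sum>l\<in>UNIV. L2r_inner S (vb l) f * vb l x)"
proof -
  let ?P = "\<lambda>g. g \<in> sl_N S \<i> \<and> (\<forall>h\<in>sl_N S \<i>. L2r_inner S h (\<lambda>x. f x - g x) = 0)"
  have diff: "L2r_inner S h (\<lambda>x. f x - g x) = L2r_inner S h f - L2r_inner S h g" if "g \<in> L2r S" "h \<in> L2r S" for g h
    using inner_linear_right[OF f that, of 1 "-1"] by simp
  define g where "g = (\<lambda>x. L2r_inner S (vb 1) f * vb 1 x + L2r_inner S (vb 2) f * vb 2 x)"
  have gN: "g \<in> sl_N S \<i>" unfolding g_def by (rule sl_N_linear[OF vb_N vb_N])
  have gL: "g \<in> L2r S" by (rule dom_maxD(1)[OF sl_N_dom[OF gN]])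
  have vg: "L2r_inner S (vb l) g = L2r_inner S (vb l) f" for l
    unfolding g_def inner_linear_right[OF vb_L2r vb_L2r vb_L2r] using exhaust_2[of l] by (auto simp: vb_orthonormal)
  have "?P g"
  proof (intro conjI ballI gN)
    fix h assume h: "h \<in> sl_N S \<i>"
    have hL: "h \<in> L2r S" by (rule dom_maxD(1)[OF sl_N_dom[OF h]])
    have fgL: "(\<lambda>x. f x - g x) \<in> L2r S" using L2r_linear[OF f gL, of 1 "-1"] by simp
    let ?h = "\<lambda>x. L2r_inner S (vb 1) h * vb 1 x + L2r_inner S (vb 2) h * vb 2 x"
    have "L2r_inner S h (\<lambda>x. f x - g x) = L2r_inner S ?h (\<lambda>x. f x - g x)"
      by (rule inner_cong_left[OF fgL L2r_linear[OF vb_L2r vb_L2r]]) (simp add: N_expand_basis[OF h] sum_2)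
    also have "\<dots> = 0"
      unfolding inner_linear_left[OF vb_L2r vb_L2r fgL] diff[OF gL vb_L2r] vg by simp
    finally show "L2r_inner S h (\<lambda>x. f x - g x) = 0" .
  qed
  then have "?P (SOME g. ?P g)" by (rule someI[of ?P])
  then have P: "?P (orth_proj S (sl_N S \<i>) f)" unfolding orth_proj_def .
  then show pN: "orth_proj S (sl_N S \<i>) f \<in> sl_N S \<i>" by blast
  have "L2r_inner S (vb l) (orth_proj S (sl_N S \<i>) f) = L2r_inner S (vb l) f" for l
  proof -
    have "L2r_inner S (vb l) (\<lambda>x. f x - orth_proj S (sl_N S \<i>) f x) = 0" using P vb_N[of l] by blast
    then show ?thesis using diff[OF dom_maxD(1)[OF sl_N_dom[OF pN]] vb_L2r] by simp
  qed
  then show "x \<in> I \<Longrightarrow> orth_proj S (sl_N S \<i>) f x = (\<Sum>l\<in>UNIV. L2r_inner S (vb l) f * vb l x)"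
    using N_expand_basis[OF pN] by simp
qed

end

context sl_frame
begin

section \<open>Donoghue functions of symmetric restrictions\<close>

text \<open>
  Domains of symmetric restrictions of the maximal operator: subspaces such that the boundary form
  of the conjugate of each element with the element vanishes.
\<close>

definition sym_dom :: "(real \<Rightarrow> complex) set \<Rightarrow> bool" where
  "sym_dom D \<longleftrightarrow> D \<subseteq> dom_max S \<and>
     (\<forall>f\<in>D. \<forall>g\<in>D. \<forall>a b. (\<lambda>x. a * f x + b * g x) \<in> D) \<and>
     (\<forall>u\<in>D. boundary_form (\<lambda>x. cnj (u x)) u = 0)"

lemma sym_domD:
  assumes "sym_dom D"
  shows "f \<in> D \<Longrightarrow> f \<in> dom_max S" "f \<in> D \<Longrightarrow> g \<in> D \<Longrightarrow> (\<lambda>x. a * f x + b * g x) \<in> D"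
    "f \<in> D \<Longrightarrow> boundary_form (\<lambda>x. cnj (f x)) f = 0"
  using assms unfolding sym_dom_def by blast+

lemma resolvent_on:
  assumes D: "sym_dom D" and z: "z \<notin> \<real>" and g: "g \<in> D"
    and eq: "AE x in lebesgue_on I. sl_tau S g x - z * g x = f x"
  shows "sl_resolvent S D z f \<in> D" "x \<in> I \<Longrightarrow> sl_resolvent S D z f x = g x"
proof -
  let ?P = "\<lambda>g. g \<in> D \<and> ae_eq S (\<lambda>x. sl_tau S g x - z * g x) f"
  have "?P g" using g eq by (simp add: ae_eq_def)
  then have "?P (SOME g. ?P g)" by (rule someI[of ?P])
  then have P: "?P (sl_resolvent S D z f)" unfolding sl_resolvent_def .
  define h where "h = sl_resolvent S D z f"
  have h: "h \<in> D" and heq: "AE x in lebesgue_on I. sl_tau S h x - z * h x = f x"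
    using P unfolding h_def ae_eq_def by blast+
  show "sl_resolvent S D z f \<in> D" using h by (simp add: h_def)
  define d where "d = (\<lambda>x. 1 * h x + (-1) * g x)"
  have dD: "d \<in> D" unfolding d_def by (rule sym_domD(2)[OF D h g])
  have "AE x in lebesgue_on I. sl_tau S d x = z * d x"
    using regular_linear(3)[OF dom_maxD(2)[OF sym_domD(1)[OF D h]] dom_maxD(2)[OF sym_domD(1)[OF D g]], of 1 "-1"] heq eq
    unfolding d_def by eventually_elim (simp add: algebra_simps)
  then have dN: "d \<in> sl_N S z" using sym_domD(1)[OF D dD] by (simp add: sl_N_def ae_eq_def)
  show "x \<in> I \<Longrightarrow> sl_resolvent S D z f x = g x"
    using sl_N_zero[OF dN z sym_domD(3)[OF D dD]] by (simp add: d_def h_def)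
qed

text \<open>
  Both projections and the resolvent in the definition of \<^const>\<open>donoghue\<close> are choices. Their
  values on \<open>I\<close> are determined, and any \<open>g\<close> in the domain that solves the inhomogeneous equation may serve as
  the value of the resolvent.
\<close>

lemma donoghue_on:
  assumes D: "sym_dom D" and z: "z \<notin> \<real>" and f: "f \<in> sl_N S \<i>" and g: "g \<in> D"
    and eq: "AE x in lebesgue_on I. sl_tau S g x - z * g x = f x"
  shows "donoghue S D z f \<in> sl_N S \<i>"
    "x \<in> I \<Longrightarrow> donoghue S D z f x = z * f x + (z\<^sup>2 + 1) * (\<Sum>l\<in>UNIV. L2r_inner S (vb l) g * vb l x)"
proof -
  define Pf where "Pf = orth_proj S (sl_N S \<i>) f"
  have Pf: "Pf x = f x" if "x \<in> I" for x
    unfolding Pf_def using orth_proj_on(2)[OF dom_maxD(1)[OF sl_N_dom[OF f]] that] N_expand_basis[OF f that] by simp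
  have "AE x in lebesgue_on I. Pf x = f x" by (rule AE_I2) (simp add: Pf)
  with eq have eq': "AE x in lebesgue_on I. sl_tau S g x - z * g x = Pf x" by eventually_elim simp
  define R where "R = sl_resolvent S D z Pf"
  have R: "R \<in> D" "\<And>x. x \<in> I \<Longrightarrow> R x = g x" unfolding R_def using resolvent_on[OF D z g eq'] by blast+
  have RL: "R \<in> L2r S" by (rule dom_maxD(1)[OF sym_domD(1)[OF D R(1)]])
  have don: "donoghue S D z f = (\<lambda>x. z * f x + (z\<^sup>2 + 1) * orth_proj S (sl_N S \<i>) R x)"
    unfolding donoghue_def R_def Pf_def ..
  show "donoghue S D z f \<in> sl_N S \<i>" unfolding don by (rule sl_N_linear[OF f orth_proj_on(1)[OF RL]])
  have ip: "L2r_inner S (vb l) g = L2r_inner S (vb l) R" for l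
    by (rule inner_cong_right[OF vb_L2r RL]) (rule R(2))
  show "x \<in> I \<Longrightarrow> donoghue S D z f x = z * f x + (z\<^sup>2 + 1) * (\<Sum>l\<in>UNIV. L2r_inner S (vb l) g * vb l x)"
    unfolding don using orth_proj_on(2)[OF RL] by (simp add: ip)
qed

lemma norm_expand:
  assumes f: "f \<in> sl_N S \<i>"
  shows "(L2r_norm S f)\<^sup>2 = (\<Sum>l\<in>UNIV. (cmod (L2r_inner S (vb l) f))\<^sup>2)"
proof -
  let ?a = "L2r_inner S (vb 1) f" and ?b = "L2r_inner S (vb 2) f"
  have fL: "f \<in> L2r S" by (rule dom_maxD(1)[OF sl_N_dom[OF f]])
  have "L2r_inner S f f = L2r_inner S f (\<lambda>x. ?a * vb 1 x + ?b * vb 2 x)"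
    by (rule inner_cong_right[OF fL L2r_linear[OF vb_L2r vb_L2r]]) (simp add: N_expand_basis[OF f] sum_2)
  also have "\<dots> = ?a * L2r_inner S f (vb 1) + ?b * L2r_inner S f (vb 2)"
    by (rule inner_linear_right[OF vb_L2r vb_L2r fL])
  also have "\<dots> = ?a * cnj ?a + ?b * cnj ?b" using inner_cnj[of f "vb 1"] inner_cnj[of f "vb 2"] by simp
  also have "\<dots> = of_real ((cmod ?a)\<^sup>2 + (cmod ?b)\<^sup>2)" unfolding of_real_add complex_norm_square ..
  finally have "complex_of_real ((L2r_norm S f)\<^sup>2) = of_real ((cmod ?a)\<^sup>2 + (cmod ?b)\<^sup>2)" unfolding inner_self .
  then have "(L2r_norm S f)\<^sup>2 = (cmod ?a)\<^sup>2 + (cmod ?b)\<^sup>2" by (simp only: of_real_eq_iff)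
  then show ?thesis by (simp add: sum_2)
qed

lemma norm_nonneg: "0 \<le> L2r_norm S f"
  unfolding L2r_norm_def by (simp add: integral_nonneg_AE)

text \<open>
  On the two-dimensional space \<open>sl_N S \<i>\<close> linearity implies boundedness; the constant is the sum of the
  moduli of the matrix entries with respect to the orthonormal basis.
\<close>

lemma bounded_operator_onI:
  assumes N: "\<And>f. f \<in> sl_N S \<i> \<Longrightarrow> A f \<in> sl_N S \<i>"
    and cong: "\<And>f g. f \<in> sl_N S \<i> \<Longrightarrow> g \<in> sl_N S \<i> \<Longrightarrow> (\<And>x. x \<in> I \<Longrightarrow> f x = g x) \<Longrightarrow> (\<And>x. x \<in> I \<Longrightarrow> A f x = A g x)"
    and lin: "\<And>f g c d x. f \<in> sl_N S \<i> \<Longrightarrow> g \<in> sl_N S \<i> \<Longrightarrow> x \<in> I \<Longrightarrow> A (\<lambda>x. c * f x + d * g x) x = c * A f x + d * A g x"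
  shows "bounded_operator_on S (sl_N S \<i>) A"
  unfolding bounded_operator_on_def
proof (intro conjI ballI impI allI)
  show "A f \<in> sl_N S \<i>" if "f \<in> sl_N S \<i>" for f using N that .
  show "ae_eq S (A f) (A g)" if f: "f \<in> sl_N S \<i>" and g: "g \<in> sl_N S \<i>" and fg: "ae_eq S f g" for f g
    by (rule ae_eq_onI, rule cong[OF f g]) (rule ae_eq_on[OF sl_N_dom[OF f] sl_N_dom[OF g] fg])
  show "ae_eq S (A (\<lambda>x. c * f x + d * g x)) (\<lambda>x. c * A f x + d * A g x)"
    if f: "f \<in> sl_N S \<i>" and g: "g \<in> sl_N S \<i>" for f g c d by (rule ae_eq_onI) (rule lin[OF f g])
  define C where "C = (\<Sum>l\<in>UNIV. \<Sum>m\<in>UNIV. cmod (L2r_inner S (vb l) (A (vb m))))"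
  have "L2r_norm S (A f) \<le> C * L2r_norm S f" if f: "f \<in> sl_N S \<i>" for f
  proof -
    let ?a = "L2r_inner S (vb 1) f" and ?b = "L2r_inner S (vb 2) f"
    have AL: "A (vb m) \<in> L2r S" for m by (rule dom_maxD(1)[OF sl_N_dom[OF N[OF vb_N]]])
    have Af: "A f x = ?a * A (vb 1) x + ?b * A (vb 2) x" if x: "x \<in> I" for x
    proof -
      have "A f x = A (\<lambda>x. ?a * vb 1 x + ?b * vb 2 x) x"
        by (rule cong[OF f sl_N_linear[OF vb_N vb_N] _ x]) (simp add: N_expand_basis[OF f] sum_2)
      then show ?thesis by (simp add: lin[OF vb_N vb_N x])
    qed
    have coeff: "cmod (L2r_inner S (vb m) f) \<le> L2r_norm S f" for m
    proof -
      have "(cmod (L2r_inner S (vb m) f))\<^sup>2 \<le> (L2r_norm S f)\<^sup>2"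
        unfolding norm_expand[OF f] by (rule member_le_sum) auto
      then show ?thesis by (rule power2_le_imp_le[OF _ norm_nonneg])
    qed
    have ipA: "cmod (L2r_inner S (vb l) (A f)) \<le> (\<Sum>m\<in>UNIV. cmod (L2r_inner S (vb l) (A (vb m)))) * L2r_norm S f" for l
    proof -
      have "L2r_inner S (vb l) (A f) = L2r_inner S (vb l) (\<lambda>x. ?a * A (vb 1) x + ?b * A (vb 2) x)"
        by (rule inner_cong_right[OF vb_L2r L2r_linear[OF AL AL]]) (simp add: Af)
      also have "\<dots> = ?a * L2r_inner S (vb l) (A (vb 1)) + ?b * L2r_inner S (vb l) (A (vb 2))"
        by (rule inner_linear_right[OF AL AL vb_L2r])
      also have "cmod \<dots> \<le> cmod ?a * cmod (L2r_inner S (vb l) (A (vb 1))) + cmod ?b * cmod (L2r_inner S (vb l) (A (vb 2)))"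
        by (rule order_trans[OF norm_triangle_ineq]) (simp add: norm_mult)
      also have "\<dots> \<le> L2r_norm S f * cmod (L2r_inner S (vb l) (A (vb 1))) + L2r_norm S f * cmod (L2r_inner S (vb l) (A (vb 2)))"
        by (intro add_mono mult_right_mono coeff) auto
      finally show ?thesis by (simp add: sum_2 algebra_simps)
    qed
    let ?p = "cmod (L2r_inner S (vb 1) (A f))" and ?q = "cmod (L2r_inner S (vb 2) (A f))"
    have "(L2r_norm S (A f))\<^sup>2 = ?p\<^sup>2 + ?q\<^sup>2" unfolding norm_expand[OF N[OF f]] by (simp add: sum_2)
    also have "\<dots> \<le> (?p + ?q)\<^sup>2" by (simp add: power2_sum)
    finally have "L2r_norm S (A f) \<le> ?p + ?q" by (rule power2_le_imp_le) simp
    also have "\<dots> \<le> C * L2r_norm S f" using ipA[of 1] ipA[of 2] unfolding C_def by (simp add: sum_2 algebra_simps)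
    finally show ?thesis .
  qed
  then show "\<exists>C. \<forall>f\<in>sl_N S \<i>. L2r_norm S (A f) \<le> C * L2r_norm S f" by blast
qed

text \<open>
  The factor \<open>z\<^sup>2 + 1\<close> removes the resolvent at \<open>\<plusminus>\<i>\<close>.
\<close>

lemma donoghue_at_i:
  "donoghue S D \<i> f = (\<lambda>x. \<i> * f x)" "donoghue S D (- \<i>) f = (\<lambda>x. - \<i> * f x)"
  by (simp_all add: donoghue_def fun_eq_iff)

lemma bounded_donoghue:
  assumes D: "sym_dom D" and z: "z \<notin> \<real>"
    and ex: "z \<noteq> \<i> \<Longrightarrow> z \<noteq> - \<i> \<Longrightarrow> (\<And>f. f \<in> sl_N S \<i> \<Longrightarrow> \<exists>g\<in>D. AE x in lebesgue_on I. sl_tau S g x - z * g x = f x)"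
  shows "bounded_operator_on S (sl_N S \<i>) (donoghue S D z)"
proof (cases "z = \<i> \<or> z = - \<i>")
  case True
  then have eq: "donoghue S D z = (\<lambda>f x. z * f x)" by (auto simp: donoghue_at_i)
  show ?thesis
  proof (rule bounded_operator_onI)
    show "donoghue S D z f \<in> sl_N S \<i>" if f: "f \<in> sl_N S \<i>" for f
      unfolding eq using sl_N_linear[OF f f, of z 0] by simp
  qed (simp_all add: eq algebra_simps)
next
  case False
  then have "\<exists>g. g \<in> D \<and> (AE x in lebesgue_on I. sl_tau S g x - z * g x = f x)" if "f \<in> sl_N S \<i>" for f
    using ex[OF _ _ that] by blast
  then obtain R where RD: "\<And>f. f \<in> sl_N S \<i> \<Longrightarrow> R f \<in> D"
    and Req: "\<And>f. f \<in> sl_N S \<i> \<Longrightarrow> AE x in lebesgue_on I. sl_tau S (R f) x - z * R f x = f x"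
    by metis
  have RL: "R f \<in> L2r S" if "f \<in> sl_N S \<i>" for f by (rule dom_maxD(1)[OF sym_domD(1)[OF D RD[OF that]]])
  show ?thesis
  proof (rule bounded_operator_onI)
    show "donoghue S D z f \<in> sl_N S \<i>" if f: "f \<in> sl_N S \<i>" for f
      by (rule donoghue_on(1)[OF D z f RD[OF f] Req[OF f]])
    show "donoghue S D z f x = donoghue S D z g x"
      if f: "f \<in> sl_N S \<i>" and g: "g \<in> sl_N S \<i>" and fg: "\<And>x. x \<in> I \<Longrightarrow> f x = g x" and x: "x \<in> I" for f g x
    proof -
      have "AE x in lebesgue_on I. f x = g x" by (rule AE_I2) (simp add: fg)
      with Req[OF f] have "AE x in lebesgue_on I. sl_tau S (R f) x - z * R f x = g x" by eventually_elim simp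
      from donoghue_on(2)[OF D z g RD[OF f] this x] donoghue_on(2)[OF D z f RD[OF f] Req[OF f] x]
      show ?thesis using fg[OF x] by simp
    qed
    show "donoghue S D z (\<lambda>x. c * f x + d * g x) x = c * donoghue S D z f x + d * donoghue S D z g x"
      if f: "f \<in> sl_N S \<i>" and g: "g \<in> sl_N S \<i>" and x: "x \<in> I" for f g c d x
    proof -
      have h: "(\<lambda>x. c * R f x + d * R g x) \<in> D" by (rule sym_domD(2)[OF D RD[OF f] RD[OF g]])
      have "AE x in lebesgue_on I. sl_tau S (\<lambda>x. c * R f x + d * R g x) x - z * (c * R f x + d * R g x) = c * f x + d * g x"
        using regular_linear(3)[OF dom_maxD(2)[OF sym_domD(1)[OF D RD[OF f]]] dom_maxD(2)[OF sym_domD(1)[OF D RD[OF g]]], of c d]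
          Req[OF f] Req[OF g] by eventually_elim (simp add: algebra_simps)
      from donoghue_on(2)[OF D z sl_N_linear[OF f g] h this x]
        donoghue_on(2)[OF D z f RD[OF f] Req[OF f] x] donoghue_on(2)[OF D z g RD[OF g] Req[OF g] x]
      show ?thesis by (simp add: inner_linear_right RL f g vb_L2r sum_2 algebra_simps)
    qed
  qed
qed

section \<open>Resolvents under Hermitian boundary conditions\<close>

text \<open>
  The domain of \<open>T\<^sub>0\<^sub>,\<^sub>0\<close>.
\<close>

definition dom_dirichlet :: "(real \<Rightarrow> complex) set" where
  "dom_dirichlet = {g \<in> dom_max S. ga g = 0 \<and> gb g = 0}"

text \<open>
  Boundary conditions that express the two derivative boundary values linearly by the boundary
  values, with coefficient matrix \<open>A\<close>; the signs and the transposition are chosen so that the matrix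
  of Krein's formula is \<open>A\<close> plus a matrix that does not depend on the boundary conditions. The
  separated conditions with \<open>\<alpha>, \<beta> \<in> (0, \<pi>)\<close> and the coupled ones with \<open>R\<^sub>1\<^sub>,\<^sub>2 \<noteq> 0\<close> are of this kind, with Hermitian \<open>A\<close>.
\<close>

definition dom_herm :: "complex^2^2 \<Rightarrow> (real \<Rightarrow> complex) set" where
  "dom_herm A = {g \<in> dom_max S. gb' g = - A$1$1 * gb g - A$2$1 * ga g \<and> ga' g = A$1$2 * gb g + A$2$2 * ga g}"

text \<open>
  The matrix \<open>A\<close> is Hermitian, written out in entries.
\<close>

definition hermitian :: "complex^2^2 \<Rightarrow> bool" where
  "hermitian A \<longleftrightarrow> cnj (A$1$1) = A$1$1 \<and> cnj (A$2$2) = A$2$2 \<and> cnj (A$1$2) = A$2$1"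

text \<open>
  The common form of \<^const>\<open>K_sep\<close> and \<^const>\<open>K_coupled\<close>.
\<close>

definition K_herm :: "complex^2^2 \<Rightarrow> complex \<Rightarrow> complex^2^2" where
  "K_herm A z = vector [vector [A$1$1 + u'_b S v 1 z, A$1$2 - u'_a S v 1 z],
     vector [A$2$1 + u'_b S v 2 z, A$2$2 - u'_a S v 2 z]]"

lemma sym_dom_dirichlet: "sym_dom dom_dirichlet"
  unfolding sym_dom_def
proof (intro conjI ballI allI)
  show "dom_dirichlet \<subseteq> dom_max S" by (auto simp: dom_dirichlet_def)
  show "(\<lambda>x. a * f x + b * g x) \<in> dom_dirichlet" if "f \<in> dom_dirichlet" "g \<in> dom_dirichlet" for f g a b
    using that by (simp add: dom_dirichlet_def dom_max_linear g_linear)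
  show "boundary_form (\<lambda>x. cnj (u x)) u = 0" if "u \<in> dom_dirichlet" for u
    using that by (simp add: dom_dirichlet_def boundary_form_def gbv_cnj)
qed

lemma sym_dom_herm:
  assumes A: "hermitian A"
  shows "sym_dom (dom_herm A)"
  unfolding sym_dom_def
proof (intro conjI ballI allI)
  show "dom_herm A \<subseteq> dom_max S" by (auto simp: dom_herm_def)
  show "(\<lambda>x. a * f x + b * g x) \<in> dom_herm A" if fg: "f \<in> dom_herm A" "g \<in> dom_herm A" for f g a b
  proof -
    have f: "f \<in> dom_max S" "gb' f = - A$1$1 * gb f - A$2$1 * ga f" "ga' f = A$1$2 * gb f + A$2$2 * ga f"
      and g: "g \<in> dom_max S" "gb' g = - A$1$1 * gb g - A$2$1 * ga g" "ga' g = A$1$2 * gb g + A$2$2 * ga g"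
      using fg by (simp_all add: dom_herm_def)
    show ?thesis
      unfolding dom_herm_def mem_Collect_eq g_linear[OF f(1) g(1)] f(2,3) g(2,3)
      by (simp add: dom_max_linear f(1) g(1) algebra_simps)
  qed
  show "boundary_form (\<lambda>x. cnj (u x)) u = 0" if "u \<in> dom_herm A" for u
  proof -
    have h: "cnj (A$1$1) = A$1$1" "cnj (A$2$2) = A$2$2" "cnj (A$1$2) = A$2$1"
      using A unfolding hermitian_def by auto
    have h': "cnj (A$2$1) = A$1$2" using arg_cong[OF h(3), of cnj] by simp
    have u: "u \<in> dom_max S" "gb' u = - A$1$1 * gb u - A$2$1 * ga u" "ga' u = A$1$2 * gb u + A$2$2 * ga u"
      using that by (simp_all add: dom_herm_def)
    show ?thesis
      unfolding boundary_form_def by (simp add: gbv_cnj u h h', simp add: algebra_simps)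
  qed
qed

lemma K_herm_entries [simp]:
  "K_herm A z $ 1 $ 1 = A$1$1 + u'_b S v 1 z" "K_herm A z $ 1 $ 2 = A$1$2 - u'_a S v 1 z"
  "K_herm A z $ 2 $ 1 = A$2$1 + u'_b S v 2 z" "K_herm A z $ 2 $ 2 = A$2$2 - u'_a S v 2 z"
  by (simp_all add: K_herm_def)

text \<open>
  A vector in the kernel of the transpose consists of the coefficients of an eigenfunction that
  satisfies the boundary conditions.
\<close>

lemma K_herm_invertible:
  assumes A: "hermitian A" and z: "z \<notin> \<real>"
  shows "invertible (K_herm A z)"
proof -
  have "d = 0" if d: "transpose (K_herm A z) *v d = 0" for d
  proof -
    have e: "(A$1$1 + u'_b S v 1 z) * d$1 + (A$2$1 + u'_b S v 2 z) * d$2 = 0"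
      "(A$1$2 - u'_a S v 1 z) * d$1 + (A$2$2 - u'_a S v 2 z) * d$2 = 0"
      using d by (simp_all add: vec_eq_iff forall_2 matrix_vector_mult_def transpose_def sum_2)
    define u where "u = (\<lambda>x. d$1 * u1 z x + d$2 * u2 z x)"
    have uN: "u \<in> sl_N S z" unfolding u_def by (rule sl_N_linear[OF u_N[OF z] u_N[OF z]])
    have uv: "gb u = d$1" "ga u = d$2" "gb' u = d$1 * u'_b S v 1 z + d$2 * u'_b S v 2 z" "ga' u = d$1 * u'_a S v 1 z + d$2 * u'_a S v 2 z"
      unfolding u_def g_linear[OF u_dom[OF z] u_dom[OF z]] by (simp_all add: u_bv[OF z])
    have "gb' u + A$1$1 * gb u + A$2$1 * ga u = 0" "ga' u - (A$1$2 * gb u + A$2$2 * ga u) = 0"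
      using e unfolding uv by (simp_all add: algebra_simps)
    then have "u \<in> dom_herm A" using sl_N_dom[OF uN] by (simp add: dom_herm_def eq_neg_iff_add_eq_0 algebra_simps)
    then have "u x = 0" if "x \<in> I" for x
      by (intro sl_N_zero[OF uN z _ that] sym_domD(3)[OF sym_dom_herm[OF A]])
    then have "u x = 0 * u x + 0 * u x" if "x \<in> I" for x using that by simp
    from g_cong(1,2)[OF sl_N_dom[OF uN] this] have "ga u = 0 \<and> gb u = 0"
      using g_linear(1,2)[OF sl_N_dom[OF uN] sl_N_dom[OF uN], of 0 0] by simp
    then show "d = 0" unfolding uv by (simp add: vec_eq_iff forall_2)
  qed
  then have "invertible (transpose (K_herm A z))"
    using matrix_left_invertible_ker[of "transpose (K_herm A z)"] invertible_left_inverse by blast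
  then show ?thesis by (simp add: invertible_det_nz)
qed

text \<open>
  For \<open>f\<close> in the eigenspace of \<open>\<i>\<close> the inhomogeneous equation has the particular solution
  \<open>f / (\<i> - z)\<close>; only a solution of the homogeneous equation has to be adjusted to the boundary
  conditions.
\<close>

lemma resolvent_ansatz:
  fixes c d :: complex
  assumes z: "z \<notin> \<real>" "z \<noteq> \<i>" and f: "f \<in> sl_N S \<i>"
    and g_def: "g = (\<lambda>x. 1 / (\<i> - z) * f x + 1 * (c * u1 z x + d * u2 z x))"
  shows "g \<in> dom_max S" "AE x in lebesgue_on I. sl_tau S g x - z * g x = f x"
    "ga g = ga f / (\<i> - z) + d" "gb g = gb f / (\<i> - z) + c"
    "ga' g = ga' f / (\<i> - z) + c * u'_a S v 1 z + d * u'_a S v 2 z"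
    "gb' g = gb' f / (\<i> - z) + c * u'_b S v 1 z + d * u'_b S v 2 z"
proof -
  let ?u = "\<lambda>x. c * u1 z x + d * u2 z x"
  have u: "?u \<in> sl_N S z" by (rule sl_N_linear[OF u_N[OF z(1)] u_N[OF z(1)]])
  show gd: "g \<in> dom_max S" unfolding g_def by (rule dom_max_linear[OF sl_N_dom[OF f] sl_N_dom[OF u]])
  have "\<i> - z \<noteq> 0" using z(2) by simp
  then have alg: "1 / (\<i> - z) * (\<i> * y) + 1 * (z * w) - z * (1 / (\<i> - z) * y + 1 * w) = y" for y w
    by (simp add: divide_simps) (simp add: algebra_simps)
  show "AE x in lebesgue_on I. sl_tau S g x - z * g x = f x"
    using regular_linear(3)[OF dom_maxD(2)[OF sl_N_dom[OF f]] dom_maxD(2)[OF sl_N_dom[OF u]], of "1 / (\<i> - z)" 1]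
      sl_N_tau[OF f] sl_N_tau[OF u] unfolding g_def
    by eventually_elim (simp only: alg)
  show "ga g = ga f / (\<i> - z) + d" "gb g = gb f / (\<i> - z) + c"
    "ga' g = ga' f / (\<i> - z) + c * u'_a S v 1 z + d * u'_a S v 2 z"
    "gb' g = gb' f / (\<i> - z) + c * u'_b S v 1 z + d * u'_b S v 2 z"
    unfolding g_def g_linear[OF sl_N_dom[OF f] sl_N_dom[OF u]] g_linear[OF u_dom[OF z(1)] u_dom[OF z(1)]]
    by (simp_all add: u_bv[OF z(1)])
qed

lemma resolvent_dirichlet:
  assumes z: "z \<notin> \<real>" "z \<noteq> \<i>" and f: "f \<in> sl_N S \<i>"
    and g: "g = (\<lambda>x. 1 / (\<i> - z) * f x + 1 * (- (gb f / (\<i> - z)) * u1 z x + - (ga f / (\<i> - z)) * u2 z x))"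
  shows "g \<in> dom_dirichlet" "AE x in lebesgue_on I. sl_tau S g x - z * g x = f x"
  using resolvent_ansatz[OF z f g] by (simp_all add: dom_dirichlet_def)

lemma inner_u_f:
  assumes z: "z \<notin> \<real>" and f: "f \<in> sl_N S \<i>"
  shows "(z - \<i>) * L2r_inner S (u1 (cnj z)) f = gb' f - u'_b S v 1 z * gb f + u'_a S v 1 z * ga f"
    "(z - \<i>) * L2r_inner S (u2 (cnj z)) f = - u'_b S v 2 z * gb f - ga' f + u'_a S v 2 z * ga f"
  using inner_u_eq[OF cnj_not_real[OF z] f] by (simp_all add: boundary_form_def u_bv[OF z])

text \<open>
  The coefficients of \<open>u\<^sub>k(z,\<cdot>)\<close> in the difference of the two resolvents.
\<close>

definition krein_coeff :: "complex^2^2 \<Rightarrow> complex \<Rightarrow> (real \<Rightarrow> complex) \<Rightarrow> 2 \<Rightarrow> complex" where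
  "krein_coeff K z f k = (\<Sum>j\<in>UNIV. matrix_inv K $ j $ k * L2r_inner S (sl_u S v j (cnj z)) f)"

lemma krein_coeff_eq:
  assumes "invertible K"
  shows "(\<Sum>k\<in>UNIV. K $ k $ m * krein_coeff K z f k) = L2r_inner S (sl_u S v m (cnj z)) f"
proof -
  have inv: "matrix_inv K ** K = mat 1" 
    using someI_ex[OF assms[unfolded invertible_def]] unfolding matrix_inv_def by blast
  have "(\<Sum>k\<in>UNIV. K $ k $ m * krein_coeff K z f k) =
      (\<Sum>j\<in>UNIV. (\<Sum>k\<in>UNIV. matrix_inv K $ j $ k * K $ k $ m) * L2r_inner S (sl_u S v j (cnj z)) f)"
    unfolding krein_coeff_def by (simp add: sum_2 algebra_simps)
  also have "\<dots> = (\<Sum>j\<in>UNIV. (matrix_inv K ** K) $ j $ m * L2r_inner S (sl_u S v j (cnj z)) f)"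
    by (simp add: matrix_matrix_mult_def)
  also have "\<dots> = (\<Sum>j\<in>UNIV. if j = m then L2r_inner S (sl_u S v j (cnj z)) f else 0)"
    unfolding inv by (intro sum.cong refl) (simp add: mat_def)
  also have "\<dots> = L2r_inner S (sl_u S v m (cnj z)) f" by simp
  finally show ?thesis .
qed

text \<open>
  Krein's resolvent formula on the eigenspace of \<open>\<i>\<close>: the boundary conditions for the resolvent amount
  to the linear system \<open>krein_coeff_eq\<close> for the coefficients.
\<close>

lemma resolvent_herm:
  assumes A: "hermitian A" and z: "z \<notin> \<real>" "z \<noteq> \<i>" and f: "f \<in> sl_N S \<i>"
    and K_def: "K = K_herm A z"
    and g_def: "g = (\<lambda>x. 1 / (\<i> - z) * f x + 1 * ((krein_coeff K z f 1 - gb f / (\<i> - z)) * u1 z x + (krein_coeff K z f 2 - ga f / (\<i> - z)) * u2 z x))"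
  shows "g \<in> dom_herm A" "AE x in lebesgue_on I. sl_tau S g x - z * g x = f x"
proof -
  let ?d = "krein_coeff K z f"
  note r = resolvent_ansatz[OF z f g_def]
  show "AE x in lebesgue_on I. sl_tau S g x - z * g x = f x" by (rule r(2))
  have sym: "u'_b S v 2 z = - u'_a S v 1 z" by (rule u'_symmetric[OF z(1)])
  have inv: "invertible K" unfolding K_def by (rule K_herm_invertible[OF A z(1)])
  have e: "(A$1$1 + u'_b S v 1 z) * ?d 1 + (A$2$1 + u'_b S v 2 z) * ?d 2 = L2r_inner S (u1 (cnj z)) f"
    "(A$1$2 - u'_a S v 1 z) * ?d 1 + (A$2$2 - u'_a S v 2 z) * ?d 2 = L2r_inner S (u2 (cnj z)) f"
    using krein_coeff_eq[OF inv, of 1 z f] krein_coeff_eq[OF inv, of 2 z f] unfolding sum_2 by (simp_all add: K_def)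
  define w where "w = \<i> - z"
  have w: "w \<noteq> 0" using z(2) by (simp add: w_def)
  have s: "w * L2r_inner S (u1 (cnj z)) f = - (gb' f - u'_b S v 1 z * gb f + u'_a S v 1 z * ga f)"
    "w * L2r_inner S (u2 (cnj z)) f = - (- u'_b S v 2 z * gb f - ga' f + u'_a S v 2 z * ga f)"
    using inner_u_f[OF z(1) f] by (simp_all add: w_def algebra_simps)
  have bv: "ga g = ?d 2" "gb g = ?d 1" using r(3,4) by simp_all
  have "w * (gb' g + A$1$1 * gb g + A$2$1 * ga g) = 0"
  proof -
    have "w * gb' g = gb' f + (w * ?d 1 - gb f) * u'_b S v 1 z + (w * ?d 2 - ga f) * u'_b S v 2 z"
      unfolding r(6) w_def[symmetric] using w by (simp add: field_simps)
    moreover have "w * ((A$1$1 + u'_b S v 1 z) * ?d 1 + (A$2$1 + u'_b S v 2 z) * ?d 2) = - (gb' f - u'_b S v 1 z * gb f + u'_a S v 1 z * ga f)"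
      unfolding e s ..
    ultimately show ?thesis unfolding bv sym by algebra
  qed
  then have "gb' g + A$1$1 * gb g + A$2$1 * ga g = 0" using w by simp
  then have 1: "gb' g = - A$1$1 * gb g - A$2$1 * ga g" by algebra
  have "w * (A$1$2 * gb g + A$2$2 * ga g - ga' g) = 0"
  proof -
    have "w * ga' g = ga' f + (w * ?d 1 - gb f) * u'_a S v 1 z + (w * ?d 2 - ga f) * u'_a S v 2 z"
      unfolding r(5) w_def[symmetric] using w by (simp add: field_simps)
    moreover have "w * ((A$1$2 - u'_a S v 1 z) * ?d 1 + (A$2$2 - u'_a S v 2 z) * ?d 2) = - (- u'_b S v 2 z * gb f - ga' f + u'_a S v 2 z * ga f)"
      unfolding e s ..
    ultimately show ?thesis unfolding bv sym by algebra
  qed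
  then have 2: "ga' g = A$1$2 * gb g + A$2$2 * ga g" using w by simp
  show "g \<in> dom_herm A" using r(1) 1 2 by (simp add: dom_herm_def)
qed

lemma W_Kr_eq:
  assumes z: "z \<notin> \<real>"
  shows "(z\<^sup>2 + 1) * L2r_inner S (vb l) (sl_u S v k z) = (\<i> - z) * W_Kr S v z $ l $ k"
proof -
  have zz: "z\<^sup>2 + 1 = (\<i> - z) * (- \<i> - z)" by (simp add: algebra_simps power2_eq_square)
  note u = u_L2r[OF z]
  note i = inner_u_i[OF z]
  have "(- \<i> - z) * L2r_inner S (vb l) (sl_u S v k z) = W_Kr S v z $ l $ k"
  proof -
    have "(- \<i> - z) * L2r_inner S (vb 1) (u1 z) = W_Kr S v z $ 1 $ 1"
    proof -
      have "(- \<i> - z) * L2r_inner S (vb 1) (u1 z) = of_real (c1 S v) * ((- \<i> - z) * L2r_inner S (u1 \<i>) (u1 z))"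
        unfolding vb_inner(1)[OF u] by simp
      then show ?thesis unfolding i W_Kr_def by simp
    qed
    moreover have "(- \<i> - z) * L2r_inner S (vb 1) (u2 z) = W_Kr S v z $ 1 $ 2"
    proof -
      have "(- \<i> - z) * L2r_inner S (vb 1) (u2 z) = of_real (c1 S v) * ((- \<i> - z) * L2r_inner S (u1 \<i>) (u2 z))"
        unfolding vb_inner(1)[OF u] by simp
      then show ?thesis unfolding i W_Kr_def by simp
    qed
    moreover have "(- \<i> - z) * L2r_inner S (vb 2) (u1 z) = W_Kr S v z $ 2 $ 1"
    proof -
      have "(- \<i> - z) * L2r_inner S (vb 2) (u1 z) = of_real (c2 S v) *
          ((- \<i> - z) * L2r_inner S (u2 \<i>) (u1 z) - of_real (kappa S v) * ((- \<i> - z) * L2r_inner S (u1 \<i>) (u1 z)))"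
        unfolding vb_inner(2)[OF u] by (simp add: algebra_simps)
      then show ?thesis unfolding i W_Kr_def by (simp add: algebra_simps)
    qed
    moreover have "(- \<i> - z) * L2r_inner S (vb 2) (u2 z) = W_Kr S v z $ 2 $ 2"
    proof -
      have "(- \<i> - z) * L2r_inner S (vb 2) (u2 z) = of_real (c2 S v) *
          ((- \<i> - z) * L2r_inner S (u2 \<i>) (u2 z) - of_real (kappa S v) * ((- \<i> - z) * L2r_inner S (u1 \<i>) (u2 z)))"
        unfolding vb_inner(2)[OF u] by (simp add: algebra_simps)
      then show ?thesis unfolding i W_Kr_def by (simp add: algebra_simps)
    qed
    ultimately show ?thesis using exhaust_2[of l] exhaust_2[of k] by metis
  qed
  then show ?thesis unfolding zz by (simp add: mult.assoc)
qed

lemma donoghue_herm: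
  assumes A: "hermitian A" and z: "z \<notin> \<real>" "z \<noteq> \<i>" and f: "f \<in> sl_N S \<i>" and x: "x \<in> I"
  shows "donoghue S (dom_herm A) z f x = donoghue S dom_dirichlet z f x + (\<i> - z) *
     (\<Sum>j\<in>UNIV. \<Sum>k\<in>UNIV. \<Sum>l\<in>UNIV. matrix_inv (K_herm A z) $ j $ k * W_Kr S v z $ l $ k *
        L2r_inner S (sl_u S v j (cnj z)) f * vb l x)"
proof -
  let ?d = "krein_coeff (K_herm A z) z f"
  define g0 where "g0 = (\<lambda>x. 1 / (\<i> - z) * f x + 1 * (- (gb f / (\<i> - z)) * u1 z x + - (ga f / (\<i> - z)) * u2 z x))"
  define g where "g = (\<lambda>x. 1 / (\<i> - z) * f x + 1 * ((?d 1 - gb f / (\<i> - z)) * u1 z x + (?d 2 - ga f / (\<i> - z)) * u2 z x))"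
  note g0 = resolvent_dirichlet[OF z f g0_def]
  note g = resolvent_herm[OF A z f refl g_def]
  have g0L: "g0 \<in> L2r S" using g0(1) dom_maxD(1) by (auto simp: dom_dirichlet_def)
  have geq: "g = (\<lambda>x. 1 * g0 x + 1 * (?d 1 * u1 z x + ?d 2 * u2 z x))"
    by (simp add: g_def g0_def fun_eq_iff algebra_simps)
  have ip: "L2r_inner S (vb l) g = L2r_inner S (vb l) g0 + (\<Sum>k\<in>UNIV. ?d k * L2r_inner S (vb l) (sl_u S v k z))" for l
    unfolding geq inner_linear_right[OF g0L L2r_linear[OF u_L2r[OF z(1)] u_L2r[OF z(1)]] vb_L2r]
      inner_linear_right[OF u_L2r[OF z(1)] u_L2r[OF z(1)] vb_L2r] by (simp add: sum_2)
  have "donoghue S (dom_herm A) z f x - donoghue S dom_dirichlet z f x =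
     (z\<^sup>2 + 1) * (\<Sum>l\<in>UNIV. (\<Sum>k\<in>UNIV. ?d k * L2r_inner S (vb l) (sl_u S v k z)) * vb l x)"
    unfolding donoghue_on(2)[OF sym_dom_herm[OF A] z(1) f g(1) g(2) x] donoghue_on(2)[OF sym_dom_dirichlet z(1) f g0(1) g0(2) x] ip
    by (simp add: sum_2 algebra_simps)
  also have "\<dots> = (\<Sum>l\<in>UNIV. (\<Sum>k\<in>UNIV. ?d k * ((z\<^sup>2 + 1) * L2r_inner S (vb l) (sl_u S v k z))) * vb l x)"
    by (simp add: sum_2 algebra_simps)
  also have "\<dots> = (\<i> - z) * (\<Sum>j\<in>UNIV. \<Sum>k\<in>UNIV. \<Sum>l\<in>UNIV. matrix_inv (K_herm A z) $ j $ k * W_Kr S v z $ l $ k *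
        L2r_inner S (sl_u S v j (cnj z)) f * vb l x)"
    unfolding W_Kr_eq[OF z(1)] krein_coeff_def sum_2 by (simp add: algebra_simps)
  finally show ?thesis by (simp add: algebra_simps)
qed

lemma dom_herm_conclusion:
  assumes A: "hermitian A"
  shows "z \<notin> \<real> \<Longrightarrow> bounded_operator_on S (sl_N S \<i>) (donoghue S (dom_herm A) z)"
    "g \<in> sl_N S \<i> \<Longrightarrow> ae_eq S (donoghue S (dom_herm A) \<i> g) (\<lambda>x. \<i> * g x)"
    "g \<in> sl_N S \<i> \<Longrightarrow> ae_eq S (donoghue S (dom_herm A) (- \<i>) g) (\<lambda>x. - \<i> * g x)"
    "z \<notin> \<real> \<Longrightarrow> z \<noteq> \<i> \<Longrightarrow> g \<in> sl_N S \<i> \<Longrightarrow> ae_eq S (donoghue S (dom_herm A) z g)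
       (\<lambda>x. donoghue S dom_dirichlet z g x + (\<i> - z) *
          (\<Sum>j\<in>UNIV. \<Sum>k\<in>UNIV. \<Sum>l\<in>UNIV. matrix_inv (K_herm A z) $ j $ k * W_Kr S v z $ l $ k *
             L2r_inner S (sl_u S v j (cnj z)) g * vb l x))"
proof -
  show "bounded_operator_on S (sl_N S \<i>) (donoghue S (dom_herm A) z)" if z: "z \<notin> \<real>"
  proof (rule bounded_donoghue[OF sym_dom_herm[OF A] z])
    fix f assume "z \<noteq> \<i>" "f \<in> sl_N S \<i>"
    from resolvent_herm[OF A z this refl refl] show "\<exists>g\<in>dom_herm A. AE x in lebesgue_on I. sl_tau S g x - z * g x = f x" by blast
  qed
  show "ae_eq S (donoghue S (dom_herm A) \<i> g) (\<lambda>x. \<i> * g x)"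
    "ae_eq S (donoghue S (dom_herm A) (- \<i>) g) (\<lambda>x. - \<i> * g x)"
    unfolding donoghue_at_i by (rule ae_eq_onI, rule refl)+
  show "ae_eq S (donoghue S (dom_herm A) z g)
       (\<lambda>x. donoghue S dom_dirichlet z g x + (\<i> - z) *
          (\<Sum>j\<in>UNIV. \<Sum>k\<in>UNIV. \<Sum>l\<in>UNIV. matrix_inv (K_herm A z) $ j $ k * W_Kr S v z $ l $ k *
             L2r_inner S (sl_u S v j (cnj z)) g * vb l x))"
    if "z \<notin> \<real>" "z \<noteq> \<i>" "g \<in> sl_N S \<i>"
    by (rule ae_eq_onI) (rule donoghue_herm[OF A that])
qed

lemma dom_sep_zero: "dom_sep S v 0 0 = dom_dirichlet"
  by (simp add: dom_sep_def dom_dirichlet_def)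

text \<open>
  The coefficient matrix of the separated boundary conditions.
\<close>

definition A_sep :: "real \<Rightarrow> real \<Rightarrow> complex^2^2" where
  "A_sep \<alpha> \<beta> = vector [vector [of_real (cot \<beta>), 0], vector [0, - of_real (cot \<alpha>)]]"

lemma sep_eq:
  assumes "0 < \<alpha>" "\<alpha> < pi" "0 < \<beta>" "\<beta> < pi"
  shows "hermitian (A_sep \<alpha> \<beta>)" "dom_sep S v \<alpha> \<beta> = dom_herm (A_sep \<alpha> \<beta>)" "K_sep S v \<alpha> \<beta> z = K_herm (A_sep \<alpha> \<beta>) z"
proof -
  show "hermitian (A_sep \<alpha> \<beta>)" by (simp add: hermitian_def A_sep_def)
  show "K_sep S v \<alpha> \<beta> z = K_herm (A_sep \<alpha> \<beta>) z" by (simp add: K_sep_def K_herm_def A_sep_def)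
  have bc: "of_real (cos t) * x + of_real (sin t) * y = 0 \<longleftrightarrow> y = - of_real (cot t) * x"
    if "0 < t" "t < pi" for t and x y :: complex
  proof -
    have s: "complex_of_real (sin t) \<noteq> 0" using sin_gt_zero[OF that] by simp
    have "of_real (cos t) * x + of_real (sin t) * y = of_real (sin t) * (of_real (cot t) * x + y)"
      using s by (simp add: cot_def field_simps)
    then show ?thesis using s by (simp add: add_eq_0_iff)
  qed
  show "dom_sep S v \<alpha> \<beta> = dom_herm (A_sep \<alpha> \<beta>)"
    unfolding dom_sep_def dom_herm_def bc[OF assms(1,2)] bc[OF assms(3,4)] by (auto simp: A_sep_def)
qed

text \<open>
  The coefficient matrix of the coupled boundary conditions: the matrix equation is solved for the
  derivative boundary values, which is possible since \<open>R\<^sub>1\<^sub>,\<^sub>2 \<noteq> 0\<close>; that the result is Hermitian relies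
  on \<open>det R = 1\<close>.
\<close>

definition A_coupled :: "real \<Rightarrow> real^2^2 \<Rightarrow> complex^2^2" where
  "A_coupled \<phi> R = vector [vector [- of_real (R$2$2 / R$1$2), exp (- \<i> * of_real \<phi>) / of_real (R$1$2)],
     vector [exp (\<i> * of_real \<phi>) / of_real (R$1$2), - of_real (R$1$1 / R$1$2)]]"

lemma coupled_eq:
  assumes det: "det R = 1" and R12: "R$1$2 \<noteq> 0"
  shows "hermitian (A_coupled \<phi> R)" "dom_coupled S v \<phi> R = dom_herm (A_coupled \<phi> R)" "K_coupled S v \<phi> R z = K_herm (A_coupled \<phi> R) z"
proof -
  show "hermitian (A_coupled \<phi> R)" by (simp add: hermitian_def A_coupled_def exp_cnj)
  show "K_coupled S v \<phi> R z = K_herm (A_coupled \<phi> R) z" by (simp add: K_coupled_def K_herm_def A_coupled_def)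
  define E where "E = exp (\<i> * complex_of_real \<phi>)"
  define F where "F = exp (- \<i> * complex_of_real \<phi>)"
  have EF: "E * F = 1" unfolding E_def F_def by (simp flip: exp_add)
  define r11 r12 r21 r22 where r: "r11 = complex_of_real (R$1$1)" "r12 = complex_of_real (R$1$2)"
    "r21 = complex_of_real (R$2$1)" "r22 = complex_of_real (R$2$2)"
  have r12: "r12 \<noteq> 0" using R12 by (simp add: r)
  have "R$1$1 * R$2$2 - R$1$2 * R$2$1 = 1" using det by (simp add: det_2)
  then have dt: "r11 * r22 - r12 * r21 = 1" unfolding r by (metis of_real_1 of_real_diff of_real_mult)
  have bc: "(b = E * (r11 * a + r12 * a') \<and> b' = E * (r21 * a + r22 * a')) \<longleftrightarrow>
      (b' = r22 / r12 * b - E / r12 * a \<and> a' = F / r12 * b - r11 / r12 * a)" (is "?L \<longleftrightarrow> ?R") for a a' b b' :: complex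
  proof
    assume L: ?L
    have "r12 * b' = r22 * b - E * a" using L dt by algebra
    moreover have "r12 * a' = F * b - r11 * a" using L EF by algebra
    ultimately show ?R using r12 by (simp add: field_simps)
  next
    assume R: ?R
    then have "r12 * b' = r22 * b - E * a" "r12 * a' = F * b - r11 * a" using r12 by (simp_all add: field_simps)
    then have "b = E * (r11 * a + r12 * a')" "r12 * b' = r12 * (E * (r21 * a + r22 * a'))" using EF dt by algebra+
    then show ?L using r12 by simp
  qed
  have dc: "dom_coupled S v \<phi> R = {g \<in> dom_max S. gb g = E * (r11 * ga g + r12 * ga' g) \<and> gb' g = E * (r21 * ga g + r22 * ga' g)}"
    unfolding dom_coupled_def E_def r
    by (simp add: vec_eq_iff forall_2 matrix_vector_mult_def map_matrix_def sum_2)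
  show "dom_coupled S v \<phi> R = dom_herm (A_coupled \<phi> R)"
    unfolding dc bc dom_herm_def by (auto simp: A_coupled_def E_def F_def r)
qed

end

section \<open>The Donoghue functions of the self-adjoint extensions\<close>

theorem theorem6p2:
  fixes S :: sl_data and v :: "(real \<Rightarrow> complex) \<times> (real \<Rightarrow> complex)"
  assumes "sl_admissible S"
    and "limit_circle_a S" and "limit_circle_b S"
    and "boundary_frame S v"
  shows
    "(\<forall>\<alpha> \<beta> :: real. 0 < \<alpha> \<and> \<alpha> < pi \<and> 0 < \<beta> \<and> \<beta> < pi \<longrightarrow>
       (\<forall>z. z \<notin> \<real> \<longrightarrow> bounded_operator_on S (sl_N S \<i>) (donoghue S (dom_sep S v \<alpha> \<beta>) z)) \<and>
       (\<forall>g\<in>sl_N S \<i>. ae_eq S (donoghue S (dom_sep S v \<alpha> \<beta>) \<i> g) (\<lambda>x. \<i> * g x) \<and>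
                     ae_eq S (donoghue S (dom_sep S v \<alpha> \<beta>) (- \<i>) g) (\<lambda>x. - \<i> * g x)) \<and>
       (\<forall>z. z \<notin> \<real> \<and> z \<noteq> \<i> \<and> z \<noteq> - \<i> \<longrightarrow>
          invertible (K_sep S v \<alpha> \<beta> z) \<and>
          (\<forall>g\<in>sl_N S \<i>. ae_eq S (donoghue S (dom_sep S v \<alpha> \<beta>) z g)
             (\<lambda>x. donoghue S (dom_sep S v 0 0) z g x + (\<i> - z) *
                (\<Sum>j\<in>UNIV. \<Sum>k\<in>UNIV. \<Sum>l\<in>UNIV.
                   matrix_inv (K_sep S v \<alpha> \<beta> z) $ j $ k * W_Kr S v z $ l $ k *
                   L2r_inner S (sl_u S v j (cnj z)) g * v_basis S v l x)))))
     \<and>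
     (\<forall>(\<phi> :: real) (R :: real^2^2). 0 \<le> \<phi> \<and> \<phi> < 2 * pi \<and> det R = 1 \<and> R $ 1 $ 2 \<noteq> 0 \<longrightarrow>
       (\<forall>z. z \<notin> \<real> \<longrightarrow> bounded_operator_on S (sl_N S \<i>) (donoghue S (dom_coupled S v \<phi> R) z)) \<and>
       (\<forall>g\<in>sl_N S \<i>. ae_eq S (donoghue S (dom_coupled S v \<phi> R) \<i> g) (\<lambda>x. \<i> * g x) \<and>
                     ae_eq S (donoghue S (dom_coupled S v \<phi> R) (- \<i>) g) (\<lambda>x. - \<i> * g x)) \<and>
       (\<forall>z. z \<notin> \<real> \<and> z \<noteq> \<i> \<and> z \<noteq> - \<i> \<longrightarrow>
          invertible (K_coupled S v \<phi> R z) \<and>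
          (\<forall>g\<in>sl_N S \<i>. ae_eq S (donoghue S (dom_coupled S v \<phi> R) z g)
             (\<lambda>x. donoghue S (dom_sep S v 0 0) z g x + (\<i> - z) *
                (\<Sum>j\<in>UNIV. \<Sum>k\<in>UNIV. \<Sum>l\<in>UNIV.
                   matrix_inv (K_coupled S v \<phi> R z) $ j $ k * W_Kr S v z $ l $ k *
                   L2r_inner S (sl_u S v j (cnj z)) g * v_basis S v l x)))))"
proof -
  interpret sl_frame S v by unfold_locales (fact assms)+
  show ?thesis
  proof (intro conjI allI impI ballI; (elim conjE)?)
    fix \<alpha> \<beta> :: real and z g assume ab: "0 < \<alpha>" "\<alpha> < pi" "0 < \<beta>" "\<beta> < pi"
    note s = sep_eq[OF ab] and d = dom_herm_conclusion[OF sep_eq(1)[OF ab], folded sep_eq(2)[OF ab]]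
    show "z \<notin> \<real> \<Longrightarrow> bounded_operator_on S (sl_N S \<i>) (donoghue S (dom_sep S v \<alpha> \<beta>) z)" by (rule d(1))
    show "g \<in> sl_N S \<i> \<Longrightarrow> ae_eq S (donoghue S (dom_sep S v \<alpha> \<beta>) \<i> g) (\<lambda>x. \<i> * g x)" by (rule d(2))
    show "g \<in> sl_N S \<i> \<Longrightarrow> ae_eq S (donoghue S (dom_sep S v \<alpha> \<beta>) (- \<i>) g) (\<lambda>x. - \<i> * g x)" by (rule d(3))
    show "z \<notin> \<real> \<Longrightarrow> invertible (K_sep S v \<alpha> \<beta> z)" unfolding s(3) by (rule K_herm_invertible[OF s(1)])
    show "z \<notin> \<real> \<Longrightarrow> z \<noteq> \<i> \<Longrightarrow> g \<in> sl_N S \<i> \<Longrightarrow> ae_eq S (donoghue S (dom_sep S v \<alpha> \<beta>) z g)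
             (\<lambda>x. donoghue S (dom_sep S v 0 0) z g x + (\<i> - z) *
                (\<Sum>j\<in>UNIV. \<Sum>k\<in>UNIV. \<Sum>l\<in>UNIV.
                   matrix_inv (K_sep S v \<alpha> \<beta> z) $ j $ k * W_Kr S v z $ l $ k *
                   L2r_inner S (sl_u S v j (cnj z)) g * v_basis S v l x))"
      unfolding s(3) dom_sep_zero by (rule d(4))
  next
    fix \<phi> :: real and R :: "real^2^2" and z g assume R: "det R = 1" "R $ 1 $ 2 \<noteq> 0"
    note s = coupled_eq[OF R] and d = dom_herm_conclusion[OF coupled_eq(1)[OF R], folded coupled_eq(2)[OF R]]
    show "z \<notin> \<real> \<Longrightarrow> bounded_operator_on S (sl_N S \<i>) (donoghue S (dom_coupled S v \<phi> R) z)" by (rule d(1))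
    show "g \<in> sl_N S \<i> \<Longrightarrow> ae_eq S (donoghue S (dom_coupled S v \<phi> R) \<i> g) (\<lambda>x. \<i> * g x)" by (rule d(2))
    show "g \<in> sl_N S \<i> \<Longrightarrow> ae_eq S (donoghue S (dom_coupled S v \<phi> R) (- \<i>) g) (\<lambda>x. - \<i> * g x)" by (rule d(3))
    show "z \<notin> \<real> \<Longrightarrow> invertible (K_coupled S v \<phi> R z)" unfolding s(3) by (rule K_herm_invertible[OF s(1)])
    show "z \<notin> \<real> \<Longrightarrow> z \<noteq> \<i> \<Longrightarrow> g \<in> sl_N S \<i> \<Longrightarrow> ae_eq S (donoghue S (dom_coupled S v \<phi> R) z g)
             (\<lambda>x. donoghue S (dom_sep S v 0 0) z g x + (\<i> - z) *
                (\<Sum>j\<in>UNIV. \<Sum>k\<in>UNIV. \<Sum>l\<in>UNIV.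
                   matrix_inv (K_coupled S v \<phi> R z) $ j $ k * W_Kr S v z $ l $ k *
                   L2r_inner S (sl_u S v j (cnj z)) g * v_basis S v l x))"
      unfolding s(3) dom_sep_zero by (rule d(4))
  qed
qed

end
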